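(* Let $E\in\{[0,1],[0,\infty),\mathbb R\}$, let $\mathcal C$ be a constraint admissible for $E$, let $V_1,\dots,V_{i_k+2}$ be continuous functions $V_j:\overline{D_j}\to\mathbb R$ satisfying the integrability conditions stated in the context, and for each large enough $n$ let $(m_1^{(n)},\dots,m_n^{(n)})$ have distribution $\mathbb P^{\mathcal C}_{n,E,V}$. Let $l\ge i_k$, $l\ge1$. Then the vector $(m_1^{(n)},\dots,m_l^{(n)})$ satisfies a large deviations principle on $\mathbb R^l$ with speed $n$ and good rate function $$I_l^{\mathcal C,E}(\,\cdot\,)-\inf_{\mathbf m_l\in\mathcal M_l^{\mathcal C}(E)}I_l^{\mathcal C,E}(\mathbf m_l),$$ where $$I_l^{\mathcal C,E}(m_1,\dots,m_l):=\begin{cases}\sum_{j=1}^lW_j(y_j),&(m_1,\dots,m_l)\in\operatorname{relint}\mathcal M_l^{\mathcal C}(E),\\ \infty,&\text{else,}\end{cases}$$ $(y_1,\dots,y_l)$ being the canonical coordinates of $(m_1,\dots,m_l)$.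
   Context: Moment spaces. $\mathcal P(E)$ is the set of Borel probability measures on $E$ with moments of all orders, $m_j(\mu):=\int x^jd\mu(x)$, $\mathcal M_n(E):=\{(m_1(\mu),\dots,m_n(\mu)):\mu\in\mathcal P(E)\}$. A constraint $\mathcal C=\{m_{i_1}=c_{i_1},\dots,m_{i_k}=c_{i_k}\}$ consists of integers $1\le i_1<\dots<i_k$ and reals $c_{i_j}$ ($k=0$ allowed, with $i_k:=0$). $\mathcal P^{\mathcal C}(E):=\{\mu\in\mathcal P(E):m_{i_j}(\mu)=c_{i_j}\ \forall j\}$, $\mathcal M_n^{\mathcal C}(E):=\{(m_1(\mu),\dots,m_n(\mu)):\mu\in\mathcal P^{\mathcal C}(E)\}$. $\mathcal C$ is admissible for $E$ if $\mathcal M_{i_k}^{\mathcal C}(E)\cap\operatorname{Int}\mathcal M_{i_k}(E)\ne\emptyset$. For $n\ge i_k$, $\operatorname{relint}\mathcal M_n^{\mathcal C}(E):=\mathcal M_n^{\mathcal C}(E)\cap\operatorname{Int}\mathcal M_n(E)$. Canonical coordinates. For $\mathbf m_n=(m_1,\dots,m_n)\in\operatorname{Int}\mathcal M_n(E)$, let $m_j^-$ and (for $E=[0,1]$) $m_j^+$ be the minimal and maximal possible $j$-th moments of measures in $\mathcal P(E)$ with first $j-1$ moments $m_1,\dots,m_{j-1}$. For $E=[0,1]$: $y_j:=p_j:=\frac{m_j-m_j^-}{m_j^+-m_j^-}$, $D_j:=(0,1)$. For $E=[0,\infty)$: $y_j:=z_j:=\frac{m_j-m_j^-}{m_{j-1}-m_{j-1}^-}$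 with $m_0:=1,m_0^-:=0$, $D_j:=(0,\infty)$. For $E=\mathbb R$: the monic orthogonal polynomials of a measure with first moments $\mathbf m_n$ satisfy $P_j(x)=(x-\alpha_j)P_{j-1}(x)-\beta_{j-1}P_{j-2}(x)$ ($P_0=1$, $P_{-1}=0$), and $y_{2j-1}:=\alpha_j$, $D_{2j-1}:=\mathbb R$, $y_{2j}:=\beta_j$, $D_{2j}:=(0,\infty)$. In each case $(y_1,\dots,y_n)\mapsto\mathbf m_n$ is a smooth bijection $D_1\times\dots\times D_n\to\operatorname{Int}\mathcal M_n(E)$. Distributions. $V_j:\overline{D_j}\to\mathbb R$, $j=1,\dots,i_k+2$, are continuous, and (integrability conditions) for some $\varepsilon>0$ and all $y$ with $|y|$ large enough: if $E=[0,\infty)$, $V_j(y)\ge(2+\varepsilon)\log|y|$ for all $j$; if $E=\mathbb R$, $V_j(y)\ge(1+\varepsilon)\log|y|$ for odd $j$ and $V_j(y)\ge(2+\varepsilon)\log|y|$ for even $j$; no condition if $E=[0,1]$. Set $V_{i_k+2j-1}:=V_{i_k+1}$, $V_{i_k+2j}:=V_{i_k+2}$ for $j\ge2$. For $n\ge i_k$, let $\mathbf m_n^{\mathcal C}:=(m_j,1\le j\le n,j\ne i_1,\dots,i_k)$; $\mathcal M_n^{\mathcal C}(E)$ is identified with its projection to these coordinates and given $(n-k)$-dimensional Lebesgue measure. $\mathbb P^{\mathcal C}_{n,E,V}$ is the probability measure on $\mathcal M_n^{\mathcal C}(E)$ giving mass $0$ to the (relative) boundary and having density $\frac1{Z^{\mathcal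 C}_{n,E,V}}\exp\big(-n\sum_{j=1}^nV_j(y_j(\mathbf m_n))\big)$ on the (relative) interior, with $Z^{\mathcal C}_{n,E,V}\in(0,\infty)$ the normalizing constant. $W_j:D_j\to\mathbb R$: $W_j(y):=V_j(y)-\log(y(1-y))$ if $E=[0,1]$; $V_j(y)-\log y$ if $E=[0,\infty)$; $V_j(y)$ if $E=\mathbb R$, $j$ odd; $V_j(y)-\log y$ if $E=\mathbb R$, $j$ even. LDP. Laws $\mathbb P_n$ on a topological space satisfy a large deviations principle with speed $b_n\to\infty$ and rate function $J\ge0$ (values in $[0,\infty]$) if $J$ is lower semicontinuous and for all measurable $\Gamma$: $-\inf_{\operatorname{Int}\Gamma}J\le\liminf_n\frac1{b_n}\log\mathbb P_n(\Gamma)\le\limsup_n\frac1{b_n}\log\mathbb P_n(\Gamma)\le-\inf_{\overline\Gamma}J$; $J$ is good if its sublevel sets are compact. *)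

theory Defs
  imports "HOL-Probability.Probability" "HOL-Computational_Algebra.Polynomial"
begin

section \<open>Moment spaces\<close>

datatype support = UnitInterval | HalfLine | RealLine

fun carrier_of :: "support \<Rightarrow> real set" where
  "carrier_of UnitInterval = {0..1}"
| "carrier_of HalfLine = {0..}"
| "carrier_of RealLine = UNIV"

definition moment :: "real measure \<Rightarrow> nat \<Rightarrow> real" where
  "moment \<mu> j = (\<integral>x. x ^ j \<partial>\<mu>)"

text \<open>A probability measure on \<open>E\<close> is a Borel probability measure on the real line
  that is concentrated on \<open>E\<close>.\<close>

definition prob_measures :: "support \<Rightarrow> real measure set" where
  "prob_measures E = {\<mu>. prob_space \<mu> \<and> sets \<mu> = sets borel \<and> (AE x in \<mu>. x \<in> carrier_of E)
     \<and> (\<forall>j::nat. integrable \<mu> (\<lambda>x. x ^ j))}"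

text \<open>A vector \<open>(m\<^sub>1, \<dots>, m\<^sub>n)\<close> is a function on \<open>{1..n}\<close>, extended by \<open>undefined\<close>;
  \<open>R\<^sup>n\<close> is the corresponding product space.\<close>

definition Rtop :: "nat \<Rightarrow> (nat \<Rightarrow> real) topology" where
  "Rtop n = product_topology (\<lambda>_. euclidean) {1..n}"

definition moment_vec :: "nat \<Rightarrow> real measure \<Rightarrow> nat \<Rightarrow> real" where
  "moment_vec n \<mu> = restrict (moment \<mu>) {1..n}"

definition moment_space :: "support \<Rightarrow> nat \<Rightarrow> (nat \<Rightarrow> real) set" where
  "moment_space E n = moment_vec n ` prob_measures E"

definition int_moment_space :: "support \<Rightarrow> nat \<Rightarrow> (nat \<Rightarrow> real) set" where
  "int_moment_space E n = Rtop n interior_of moment_space E n"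

text \<open>A constraint consists of the finite set \<open>I = {i\<^sub>1, \<dots>, i\<^sub>k}\<close> of indices and a
  function \<open>c\<close>, of which only the values on \<open>I\<close> matter.\<close>

definition constraint_indices :: "nat set \<Rightarrow> bool" where
  "constraint_indices I \<longleftrightarrow> finite I \<and> (\<forall>i\<in>I. 1 \<le> i)"

definition last_index :: "nat set \<Rightarrow> nat" where
  "last_index I = Max (insert 0 I)"

definition constrained_measures :: "support \<Rightarrow> nat set \<Rightarrow> (nat \<Rightarrow> real) \<Rightarrow> real measure set" where
  "constrained_measures E I c = {\<mu> \<in> prob_measures E. \<forall>i\<in>I. moment \<mu> i = c i}"

definition constrained_moment_space ::
    "support \<Rightarrow> nat set \<Rightarrow> (nat \<Rightarrow> real) \<Rightarrow> nat \<Rightarrow> (nat \<Rightarrow> real) set" where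
  "constrained_moment_space E I c n = moment_vec n ` constrained_measures E I c"

definition relint_moment_space ::
    "support \<Rightarrow> nat set \<Rightarrow> (nat \<Rightarrow> real) \<Rightarrow> nat \<Rightarrow> (nat \<Rightarrow> real) set" where
  "relint_moment_space E I c n = constrained_moment_space E I c n \<inter> int_moment_space E n"

definition admissible :: "support \<Rightarrow> nat set \<Rightarrow> (nat \<Rightarrow> real) \<Rightarrow> bool" where
  "admissible E I c \<longleftrightarrow>
     constrained_moment_space E I c (last_index I) \<inter> int_moment_space E (last_index I) \<noteq> {}"


section \<open>Canonical coordinates\<close>

definition next_moments :: "support \<Rightarrow> (nat \<Rightarrow> real) \<Rightarrow> nat \<Rightarrow> real set" where
  "next_moments E m j =
     {moment \<mu> j | \<mu>. \<mu> \<in> prob_measures E \<and> (\<forall>i\<in>{1..<j}. moment \<mu> i = m i)}"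

definition lower_moment :: "support \<Rightarrow> (nat \<Rightarrow> real) \<Rightarrow> nat \<Rightarrow> real" where
  "lower_moment E m j = Inf (next_moments E m j)"

definition upper_moment :: "support \<Rightarrow> (nat \<Rightarrow> real) \<Rightarrow> nat \<Rightarrow> real" where
  "upper_moment E m j = Sup (next_moments E m j)"

definition coord_unit :: "(nat \<Rightarrow> real) \<Rightarrow> nat \<Rightarrow> real" where
  "coord_unit m j = (m j - lower_moment UnitInterval m j)
     / (upper_moment UnitInterval m j - lower_moment UnitInterval m j)"

text \<open>For \<open>j = 1\<close> the denominator is \<open>m\<^sub>0 - m\<^sub>0\<^sup>- = 1 - 0\<close>.\<close>

definition coord_half :: "(nat \<Rightarrow> real) \<Rightarrow> nat \<Rightarrow> real" where
  "coord_half m j = (m j - lower_moment HalfLine m j)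
     / (if j = 1 then 1 else m (j - 1) - lower_moment HalfLine m (j - 1))"

definition monic_orth_poly :: "real measure \<Rightarrow> nat \<Rightarrow> real poly" where
  "monic_orth_poly \<mu> j = (THE P. degree P = j \<and> lead_coeff P = 1 \<and>
     (\<forall>Q. degree Q < j \<longrightarrow> (\<integral>x. poly P x * poly Q x \<partial>\<mu>) = 0))"

definition recurrence :: "real measure \<Rightarrow> nat \<Rightarrow> real \<Rightarrow> real \<Rightarrow> bool" where
  "recurrence \<mu> j a b \<longleftrightarrow>
     monic_orth_poly \<mu> j = [:- a, 1:] * monic_orth_poly \<mu> (j - 1)
       - smult b (if j = 1 then 0 else monic_orth_poly \<mu> (j - 2))"

text \<open>In \<open>recurrence \<mu> j a b\<close>, \<open>a\<close> is \<open>\<alpha>\<^sub>j\<close> and \<open>b\<close> is \<open>\<beta>\<close> with index \<open>j - 1\<close>.\<close>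

definition rec_alpha :: "real measure \<Rightarrow> nat \<Rightarrow> real" where
  "rec_alpha \<mu> j = (THE a. \<exists>b. recurrence \<mu> j a b)"

definition rec_beta :: "real measure \<Rightarrow> nat \<Rightarrow> real" where
  "rec_beta \<mu> j = (THE b. \<exists>a. recurrence \<mu> (j + 1) a b)"

text \<open>On the interior of the moment space, the first \<open>n\<close> recurrence coefficients (in the order
  \<open>\<alpha>\<^sub>1, \<beta>\<^sub>1, \<alpha>\<^sub>2, \<dots>\<close>) do not depend on the choice of the representing measure.\<close>

definition coord_line :: "nat \<Rightarrow> (nat \<Rightarrow> real) \<Rightarrow> nat \<Rightarrow> real" where
  "coord_line n m j =
     (let \<mu> = (SOME \<mu>. \<mu> \<in> prob_measures RealLine \<and> (\<forall>i\<in>{1..n}. moment \<mu> i = m i))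
      in if odd j then rec_alpha \<mu> ((j + 1) div 2) else rec_beta \<mu> (j div 2))"

fun canonical_coord :: "support \<Rightarrow> nat \<Rightarrow> (nat \<Rightarrow> real) \<Rightarrow> nat \<Rightarrow> real" where
  "canonical_coord UnitInterval n m j = coord_unit m j"
| "canonical_coord HalfLine n m j = coord_half m j"
| "canonical_coord RealLine n m j = coord_line n m j"

fun coord_domain :: "support \<Rightarrow> nat \<Rightarrow> real set" where
  "coord_domain UnitInterval j = {0<..<1}"
| "coord_domain HalfLine j = {0<..}"
| "coord_domain RealLine j = (if odd j then UNIV else {0<..})"


section \<open>Distributions on constrained moment spaces\<close>

fun integrability_conditions :: "support \<Rightarrow> nat \<Rightarrow> (nat \<Rightarrow> real \<Rightarrow> real) \<Rightarrow> bool" where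
  "integrability_conditions UnitInterval N V \<longleftrightarrow> True"
| "integrability_conditions HalfLine N V \<longleftrightarrow>
     (\<exists>\<epsilon>>0. \<exists>R. \<forall>j\<in>{1..N}. \<forall>y\<in>closure (coord_domain HalfLine j). \<bar>y\<bar> \<ge> R \<longrightarrow>
        V j y \<ge> (2 + \<epsilon>) * ln \<bar>y\<bar>)"
| "integrability_conditions RealLine N V \<longleftrightarrow>
     (\<exists>\<epsilon>>0. \<exists>R. \<forall>j\<in>{1..N}. \<forall>y\<in>closure (coord_domain RealLine j). \<bar>y\<bar> \<ge> R \<longrightarrow>
        V j y \<ge> ((if odd j then 1 else 2) + \<epsilon>) * ln \<bar>y\<bar>)"

text \<open>The given potentials are \<open>V 1, \<dots>, V (s + 2)\<close> with \<open>s = i\<^sub>k\<close>; beyond these indices,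
  the last two alternate.\<close>

definition potential :: "nat \<Rightarrow> (nat \<Rightarrow> real \<Rightarrow> real) \<Rightarrow> nat \<Rightarrow> real \<Rightarrow> real" where
  "potential s V j =
     (if j \<le> s + 2 then V j else if odd (j - s) then V (s + 1) else V (s + 2))"

text \<open>Lebesgue measure on the free coordinates, and the map that inserts the prescribed moments.\<close>

definition free_lebesgue :: "nat set \<Rightarrow> nat \<Rightarrow> (nat \<Rightarrow> real) measure" where
  "free_lebesgue I n = (\<Pi>\<^sub>M j\<in>{1..n} - I. lborel)"

definition insert_constraint ::
    "nat set \<Rightarrow> (nat \<Rightarrow> real) \<Rightarrow> nat \<Rightarrow> (nat \<Rightarrow> real) \<Rightarrow> nat \<Rightarrow> real" where
  "insert_constraint I c n x = (\<lambda>j\<in>{1..n}. if j \<in> I then c j else x j)"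

definition moment_weight :: "support \<Rightarrow> nat set \<Rightarrow> (nat \<Rightarrow> real) \<Rightarrow> (nat \<Rightarrow> real \<Rightarrow> real) \<Rightarrow>
    nat \<Rightarrow> (nat \<Rightarrow> real) \<Rightarrow> ennreal" where
  "moment_weight E I c V n m =
     (if m \<in> relint_moment_space E I c n
      then ennreal (exp (- real n *
             (\<Sum>j=1..n. potential (last_index I) V j (canonical_coord E n m j))))
      else 0)"

definition partition_function ::
    "support \<Rightarrow> nat set \<Rightarrow> (nat \<Rightarrow> real) \<Rightarrow> (nat \<Rightarrow> real \<Rightarrow> real) \<Rightarrow> nat \<Rightarrow> ennreal" where
  "partition_function E I c V n =
     (\<integral>\<^sup>+x. moment_weight E I c V n (insert_constraint I c n x) \<partial>free_lebesgue I n)"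

definition borel_of :: "'a topology \<Rightarrow> 'a measure" where
  "borel_of X = sigma (topspace X) {U. openin X U}"

definition moment_distribution :: "support \<Rightarrow> nat set \<Rightarrow> (nat \<Rightarrow> real) \<Rightarrow>
    (nat \<Rightarrow> real \<Rightarrow> real) \<Rightarrow> nat \<Rightarrow> (nat \<Rightarrow> real) measure" where
  "moment_distribution E I c V n =
     distr (density (free_lebesgue I n)
              (\<lambda>x. moment_weight E I c V n (insert_constraint I c n x)
                     / partition_function E I c V n))
       (borel_of (Rtop n)) (insert_constraint I c n)"

definition marginal_law :: "support \<Rightarrow> nat set \<Rightarrow> (nat \<Rightarrow> real) \<Rightarrow>
    (nat \<Rightarrow> real \<Rightarrow> real) \<Rightarrow> nat \<Rightarrow> nat \<Rightarrow> (nat \<Rightarrow> real) measure" where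
  "marginal_law E I c V l n =
     distr (moment_distribution E I c V n) (borel_of (Rtop l)) (\<lambda>m. restrict m {1..l})"


section \<open>Large deviations principles\<close>

definition log_prob :: "real \<Rightarrow> ereal" where
  "log_prob p = (if p \<le> 0 then - \<infinity> else ereal (ln p))"

text \<open>The laws need to be probability measures only from some index on.\<close>

definition LDP ::
    "'a topology \<Rightarrow> (nat \<Rightarrow> 'a measure) \<Rightarrow> (nat \<Rightarrow> real) \<Rightarrow> ('a \<Rightarrow> ereal) \<Rightarrow> bool" where
  "LDP X P b J \<longleftrightarrow>
     (\<forall>\<^sub>F n in sequentially. prob_space (P n) \<and> sets (P n) = sets (borel_of X)) \<and>
     filterlim b at_top sequentially \<and>
     (\<forall>x\<in>topspace X. 0 \<le> J x) \<and>
     (\<forall>a::real. closedin X {x \<in> topspace X. J x \<le> ereal a}) \<and>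
     (\<forall>\<Gamma>\<in>sets (borel_of X).
        - (INF x\<in>X interior_of \<Gamma>. J x)
          \<le> liminf (\<lambda>n. ereal (1 / b n) * log_prob (measure (P n) \<Gamma>)) \<and>
        limsup (\<lambda>n. ereal (1 / b n) * log_prob (measure (P n) \<Gamma>))
          \<le> - (INF x\<in>X closure_of \<Gamma>. J x))"

definition good_rate :: "'a topology \<Rightarrow> ('a \<Rightarrow> ereal) \<Rightarrow> bool" where
  "good_rate X J \<longleftrightarrow> (\<forall>a::real. compactin X {x \<in> topspace X. J x \<le> ereal a})"


section \<open>The rate function\<close>

fun W_fun :: "support \<Rightarrow> (nat \<Rightarrow> real \<Rightarrow> real) \<Rightarrow> nat \<Rightarrow> real \<Rightarrow> real" where
  "W_fun UnitInterval V j y = V j y - ln (y * (1 - y))"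
| "W_fun HalfLine V j y = V j y - ln y"
| "W_fun RealLine V j y = (if odd j then V j y else V j y - ln y)"

definition rate :: "support \<Rightarrow> nat set \<Rightarrow> (nat \<Rightarrow> real) \<Rightarrow> (nat \<Rightarrow> real \<Rightarrow> real) \<Rightarrow>
    nat \<Rightarrow> (nat \<Rightarrow> real) \<Rightarrow> ereal" where
  "rate E I c V l m =
     (if m \<in> relint_moment_space E I c l
      then ereal (\<Sum>j=1..l. W_fun E (potential (last_index I) V) j (canonical_coord E l m j))
      else \<infinity>)"

definition normalized_rate :: "support \<Rightarrow> nat set \<Rightarrow> (nat \<Rightarrow> real) \<Rightarrow> (nat \<Rightarrow> real \<Rightarrow> real) \<Rightarrow>
    nat \<Rightarrow> (nat \<Rightarrow> real) \<Rightarrow> ereal" where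
  "normalized_rate E I c V l m =
     rate E I c V l m - (INF m'\<in>constrained_moment_space E I c l. rate E I c V l m')"

end

theory Submission
  imports Defs "HOL-Computational_Algebra.Fundamental_Theorem_Algebra"
begin

text \<open>In all three cases the moment \<open>m\<^sub>j\<close> is an affine function of the canonical coordinate \<open>y\<^sub>j\<close>,
  with offset and slope depending on \<open>y\<^sub>1, \<dots>, y\<^bsub>j-1\<^esub>\<close> only, and the slope is the product of factors
  \<open>g\<^sub>i(y\<^sub>i)\<close> over \<open>i < j\<close>. For the real line this is read off the expansion of \<open>x\<^sup>n\<close> in orthogonal
  polynomials; the half line and the unit interval reduce to symmetric measures on the real line.
  Gauss quadrature realizes all coordinates in the open domains, and the positivity of squares (for
  the unit interval also of \<open>1 - x\<^sup>2\<close> times a square) excludes everything beyond their closures.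
  Since the constrained moments have index at most \<open>l\<close>, the moments above \<open>l\<close> can be integrated out
  one after the other. Each substitution contributes one power of every \<open>g\<^sub>i\<close>, so the marginal density
  of \<open>(m\<^sub>1, \<dots>, m\<^sub>l)\<close> is proportional to \<open>exp (- (n - l) W - l V)\<close>, where \<open>W\<close> is the unnormalized rate,
  and the claim is an instance of the Laplace principle.\<close>

section \<open>Recurrence coefficients and moments\<close>

text \<open>The constraints prevent a full change to canonical coordinates: a prescribed moment is a
  nonlinear condition on several coordinates at once, so up to i_k the free moments do not
  correspond to free coordinates. Hence the first l moments are kept as moments and the rate is
  studied as a function of them, on a slice that has no product structure. Two estimates make up for
  this. V_j and W_j both dominate log (1 + |y|) up to a constant: of the logarithms in V_j >= (2 +
  eps) log |y| one pays for the slope and at least one is left for W_j, and where the slope is 1 the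
  condition with (1 + eps) does the same. Moreover each moment is bounded by a power of the product
  of the 1 + |y_i|. A bound on the rate also keeps every y_j away from the boundary of its domain,
  where the slope vanishes; this gives compact sublevel sets.\<close>

definition moment_functional :: "(nat \<Rightarrow> real) \<Rightarrow> real poly \<Rightarrow> real" where
  "moment_functional m p = (\<Sum>i\<le>degree p. coeff p i * m i)"

lemma moment_functional_eq_sum:
  assumes "degree p \<le> n"
  shows "moment_functional m p = (\<Sum>i\<le>n. coeff p i * m i)"
  unfolding moment_functional_def
  by (rule sum.mono_neutral_left) (use assms in \<open>auto simp: coeff_eq_0\<close>)

lemma moment_functional_add:
  "moment_functional m (p + q) = moment_functional m p + moment_functional m q"
proof -
  define n where "n = max (degree p) (degree q)"
  have "degree p \<le> n" "degree q \<le> n" "degree (p + q) \<le> n"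
    by (auto simp: n_def degree_add_le_max)
  then show ?thesis
    by (simp add: moment_functional_eq_sum[where n = n] algebra_simps sum.distrib)
qed

lemma moment_functional_smult: "moment_functional m (smult a p) = a * moment_functional m p"
  by (simp add: moment_functional_eq_sum[OF degree_smult_le] moment_functional_def
      sum_distrib_left mult.assoc)

lemma moment_functional_uminus: "moment_functional m (- p) = - moment_functional m p"
  using moment_functional_smult[of m "-1" p] by simp

lemma moment_functional_diff:
  "moment_functional m (p - q) = moment_functional m p - moment_functional m q"
  using moment_functional_add[of m p "- q"] by (simp add: moment_functional_uminus)

lemma moment_functional_0 [simp]: "moment_functional m 0 = 0"
  by (simp add: moment_functional_def)

lemma moment_functional_sum:
  "moment_functional m (\<Sum>i\<in>A. f i) = (\<Sum>i\<in>A. moment_functional m (f i))"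
  by (induction A rule: infinite_finite_induct) (auto simp: moment_functional_add)

lemma moment_functional_monom: "moment_functional m (monom a n) = a * m n"
proof -
  have "moment_functional m (monom a n) = (\<Sum>i\<le>n. coeff (monom a n) i * m i)"
    by (rule moment_functional_eq_sum) (rule degree_monom_le)
  also have "\<dots> = (\<Sum>i\<le>n. if i = n then a * m n else 0)"
    by (rule sum.cong) auto
  finally show ?thesis by simp
qed

lemma moment_functional_cong:
  assumes "\<And>i. i \<le> degree p \<Longrightarrow> m i = m' i"
  shows "moment_functional m p = moment_functional m' p"
  unfolding moment_functional_def using assms by (intro sum.cong) auto

text \<open>With \<open>\<alpha>\<^sub>k = y (2 k - 1)\<close> and \<open>\<beta>\<^sub>k = y (2 k)\<close>, the entry \<open>stieltjes y n k\<close> is the coefficient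
  of the \<open>k\<close>-th orthogonal polynomial in the expansion of \<open>x\<^sup>n\<close>.\<close>

fun stieltjes :: "(nat \<Rightarrow> real) \<Rightarrow> nat \<Rightarrow> nat \<Rightarrow> real" where
  "stieltjes y 0 k = (if k = 0 then 1 else 0)"
| "stieltjes y (Suc n) k = (if k = 0 then 0 else stieltjes y n (k - 1))
     + y (2 * k + 1) * stieltjes y n k + y (2 * k + 2) * stieltjes y n (Suc k)"

text \<open>Every orthogonal polynomial of positive degree has mean zero, so the mean of x^n is the
  entry k = 0 of its expansion. Combinatorially this counts Motzkin paths by weight: up steps weigh
  1, level steps at height k weigh \<open>y (2 * k + 1)\<close>, and down steps to height k weigh
  \<open>y (2 * k + 2)\<close>.\<close>

definition mom :: "(nat \<Rightarrow> real) \<Rightarrow> nat \<Rightarrow> real" where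
  "mom y n = stieltjes y n 0"

fun orth :: "(nat \<Rightarrow> real) \<Rightarrow> nat \<Rightarrow> real poly" where
  "orth y 0 = 1"
| "orth y (Suc 0) = [:- y 1, 1:]"
| "orth y (Suc (Suc n)) =
     [:- y (2 * n + 3), 1:] * orth y (Suc n) - smult (y (2 * n + 2)) (orth y n)"

declare orth.simps(3) [simp del]

lemma stieltjes_above: "n < k \<Longrightarrow> stieltjes y n k = 0"
  by (induction n arbitrary: k) auto

lemma stieltjes_diag: "stieltjes y n n = 1"
  by (induction n) (auto simp: stieltjes_above)

lemma mom_0 [simp]: "mom y 0 = 1"
  by (simp add: mom_def)

text \<open>A path of length n from height 0 to height k that climbs to h needs at least 2 * h - k
  steps, so no weight of index above n + k occurs on it.\<close>

lemma stieltjes_cong: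
  "(\<And>i. 1 \<le> i \<Longrightarrow> i \<le> n + k \<Longrightarrow> y i = y' i) \<Longrightarrow> stieltjes y n k = stieltjes y' n k"
proof (induction n arbitrary: k)
  case (Suc n)
  have 1: "k \<noteq> 0 \<Longrightarrow> stieltjes y n (k - 1) = stieltjes y' n (k - 1)"
    by (rule Suc.IH) (rule Suc.prems, auto)
  have 2: "stieltjes y n k = stieltjes y' n k" "stieltjes y n (Suc k) = stieltjes y' n (Suc k)"
    by (rule Suc.IH; rule Suc.prems; simp)+
  have 3: "k \<le> n \<Longrightarrow> y (2 * k + 1) = y' (2 * k + 1)"
    by (rule Suc.prems) auto
  have 4: "k < n \<Longrightarrow> y (2 * k + 2) = y' (2 * k + 2)"
    by (rule Suc.prems) auto
  show ?case
    using 1 2 3 4 stieltjes_above[of n k y] stieltjes_above[of n "Suc k" y]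
    by (cases "k < n"; cases "k = n") auto
qed simp

text \<open>Exactly one path carries the weight \<open>y (n + k)\<close>: straight up, one level
  step at the top if n + k is odd, then straight down to k. Its other down steps contribute the
  product of the even-indexed weights.\<close>

lemma stieltjes_affine:
  "k < n \<Longrightarrow> stieltjes y n k = stieltjes (y(n + k := 0)) n k
     + (\<Prod>i\<in>{2 * k<..<n + k}. if even i then y i else 1) * y (n + k)"
proof (induction n arbitrary: k)
  case (Suc n)
  define y' where "y' = y(Suc n + k := 0)"
  have 1: "k \<noteq> 0 \<Longrightarrow> stieltjes y n (k - 1) = stieltjes y' n (k - 1)"
    by (rule stieltjes_cong) (auto simp: y'_def)
  have 2: "stieltjes y n k = stieltjes y' n k"
    by (rule stieltjes_cong) (auto simp: y'_def)
  consider "n = k" | "n = Suc k" | "Suc k < n"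
    using Suc.prems by linarith
  then show ?case
  proof cases
    case A: 1
    have "{2 * k<..<2 * k + 1} = {}" by auto
    moreover have yk: "y' (2 * k + 1) = 0" using A by (simp add: y'_def)
    ultimately show ?thesis
      unfolding y'_def[symmetric] stieltjes.simps using 1 A yk
      by (auto simp: stieltjes_diag stieltjes_above simp flip: mult_2)
  next
    case B: 2
    have "{2 * k<..<2 * k + 2} = {2 * k + 1}" by auto
    moreover have yk: "y' (2 * k + 1) = y (2 * k + 1)" "y' (2 * k + 2) = 0"
      using B by (auto simp: y'_def)
    ultimately show ?thesis
      unfolding y'_def[symmetric] stieltjes.simps using 1 2 B yk
      by (auto simp: stieltjes_diag stieltjes_above simp flip: mult_2)
  next
    case 3
    \<comment> \<open>Since n + Suc k = Suc n + k, only the entry at height k + 1 sees the highest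
      coefficient; the step down multiplies its slope by \<open>y (2 * k + 2)\<close>.\<close>
    have "y(n + Suc k := 0) = y'"
      by (simp add: y'_def)
    then have IH: "stieltjes y n (Suc k) = stieltjes y' n (Suc k)
       + (\<Prod>i\<in>{2 * Suc k<..<n + Suc k}. if even i then y i else 1) * y (n + Suc k)"
      using Suc.IH[OF 3] by simp
    have "{2 * k<..<Suc n + k} = insert (2 * k + 1) (insert (2 * k + 2) {2 * Suc k<..<n + Suc k})"
      using 3 by auto
    then have P: "(\<Prod>i\<in>{2 * k<..<Suc n + k}. if even i then y i else 1)
        = y (2 * k + 2) * (\<Prod>i\<in>{2 * Suc k<..<n + Suc k}. if even i then y i else 1)"
      by (simp add: prod.insert_if)
    have "y' (2 * k + 1) = y (2 * k + 1)" "y' (2 * k + 2) = y (2 * k + 2)"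
      using 3 by (auto simp: y'_def)
    then show ?thesis
      unfolding stieltjes.simps P y'_def[symmetric] using 1 2 IH by (simp add: algebra_simps)
  qed
qed simp

lemma mom_cong: "(\<And>i. 1 \<le> i \<Longrightarrow> i \<le> n \<Longrightarrow> y i = y' i) \<Longrightarrow> mom y n = mom y' n"
  unfolding mom_def by (rule stieltjes_cong) auto

lemma mom_affine:
  "0 < n \<Longrightarrow> mom y n = mom (y(n := 0)) n + (\<Prod>i\<in>{1..<n}. if even i then y i else 1) * y n"
  using stieltjes_affine[of 0 n y] by (simp add: mom_def atLeastSucLessThan_greaterThanLessThan)

text \<open>Three summands, each at most R times the previous bound. This crude estimate is the
  source of the polynomial growth of the moments in the coordinates, on which the tail integrals
  rest.\<close>

lemma stieltjes_abs_le:
  assumes "1 \<le> R"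
  shows "(\<And>i. 1 \<le> i \<Longrightarrow> i \<le> n + k \<Longrightarrow> \<bar>y i\<bar> \<le> R) \<Longrightarrow> \<bar>stieltjes y n k\<bar> \<le> (3 * R) ^ n"
proof (induction n arbitrary: k)
  case (Suc n)
  let ?Q = "(3 * R) ^ n"
  have Q: "0 \<le> ?Q" "?Q \<le> R * ?Q" using assms mult_right_mono[of 1 R ?Q] by auto
  have 1: "k \<noteq> 0 \<Longrightarrow> \<bar>stieltjes y n (k - 1)\<bar> \<le> ?Q"
    by (rule Suc.IH) (rule Suc.prems, auto)
  have 2: "\<bar>stieltjes y n k\<bar> \<le> ?Q" "\<bar>stieltjes y n (Suc k)\<bar> \<le> ?Q"
    by (rule Suc.IH; rule Suc.prems; simp)+
  have 3: "\<bar>y (2 * k + 1) * stieltjes y n k\<bar> \<le> R * ?Q"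
  proof (cases "k \<le> n")
    case True
    then have "\<bar>y (2 * k + 1)\<bar> \<le> R" by (intro Suc.prems) auto
    then show ?thesis unfolding abs_mult using 2 assms by (intro mult_mono) auto
  qed (use Q assms in \<open>simp add: stieltjes_above\<close>)
  have 4: "\<bar>y (2 * k + 2) * stieltjes y n (Suc k)\<bar> \<le> R * ?Q"
  proof (cases "k < n")
    case True
    then have "\<bar>y (2 * k + 2)\<bar> \<le> R" by (intro Suc.prems) auto
    then show ?thesis unfolding abs_mult using 2 assms by (intro mult_mono) auto
  qed (use Q assms in \<open>simp add: stieltjes_above\<close>)
  have "\<bar>stieltjes y (Suc n) k\<bar> \<le> \<bar>if k = 0 then 0 else stieltjes y n (k - 1)\<bar>
      + \<bar>y (2 * k + 1) * stieltjes y n k\<bar> + \<bar>y (2 * k + 2) * stieltjes y n (Suc k)\<bar>"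
    unfolding stieltjes.simps by linarith
  also have "\<dots> \<le> R * ?Q + R * ?Q + R * ?Q"
    using order_trans[OF 1 Q(2)] 3 4 Q by (intro add_mono) (auto simp del: abs_mult)
  also have "\<dots> = (3 * R) ^ Suc n" by simp
  finally show ?case .
qed simp

lemma continuous_on_stieltjes:
  fixes F :: "'a::topological_space \<Rightarrow> nat \<Rightarrow> real"
  assumes "\<And>i. continuous_on S (\<lambda>x. F x i)"
  shows "continuous_on S (\<lambda>x. stieltjes (F x) n k)"
proof (induction n arbitrary: k)
  case (Suc n)
  then show ?case using assms by (cases "k = 0") (auto intro!: continuous_intros)
qed simp

section \<open>Orthogonal polynomials and positivity of the moment functional\<close>

lemma orth_deg: "degree (orth y n) = n \<and> lead_coeff (orth y n) = 1"
proof (induction y n rule: orth.induct)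
  case (3 y n)
  define P where "P = [:- y (2 * n + 3), 1:] * orth y (Suc n)"
  have nz: "orth y (Suc n) \<noteq> 0" using 3 by auto
  have dP: "degree P = Suc (Suc n)"
    unfolding P_def by (subst degree_mult_eq) (use 3 nz in auto)
  have lP: "lead_coeff P = 1"
    unfolding P_def lead_coeff_mult using conjunct2[OF 3(1)] by simp
  have dq: "degree (smult (y (2 * n + 2)) (orth y n)) < Suc (Suc n)"
    using 3 degree_smult_le[of "y (2 * n + 2)" "orth y n"] by linarith
  have "coeff (smult (y (2 * n + 2)) (orth y n)) (Suc (Suc n)) = 0"
    using dq by (rule coeff_eq_0)
  moreover have "degree (P - smult (y (2 * n + 2)) (orth y n)) = Suc (Suc n)"
    unfolding diff_conv_add_uminus
    by (subst degree_add_eq_left) (use dP dq in \<open>auto simp del: degree_smult_eq\<close>)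
  ultimately show ?case
    using dP lP by (simp del: mult_pCons_left add: P_def[symmetric] orth.simps(3))
qed auto

lemma degree_orth [simp]: "degree (orth y n) = n"
  and lead_coeff_orth [simp]: "coeff (orth y n) n = 1"
  using orth_deg[of y n] by auto

lemma orth_nz [simp]: "orth y n \<noteq> 0"
  using lead_coeff_orth[of y n] by (metis coeff_0 zero_neq_one)

lemma x_times_orth:
  "[:0, 1:] * orth y k = orth y (Suc k) + smult (y (2 * k + 1)) (orth y k)
     + (if k = 0 then 0 else smult (y (2 * k)) (orth y (k - 1)))"
proof (cases k)
  case (Suc n)
  have "[:0, 1:] * orth y (Suc n) = [:- y (2 * n + 3), 1:] * orth y (Suc n) +
      smult (y (2 * n + 3)) (orth y (Suc n))"
    by (simp add: algebra_simps)
  then show ?thesis by (simp add: Suc orth.simps(3) add.commute numeral_3_eq_3)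
qed (simp add: algebra_simps)

text \<open>Multiplication by x acts on the orthogonal basis through the three-term recurrence;
  shifting the three sums to a common index yields the recursion of
  \<open>stieltjes\<close>.\<close>

lemma monom_expand: "monom 1 n = (\<Sum>k\<le>n. smult (stieltjes y n k) (orth y k))"
proof (induction n)
  case 0
  show ?case by (simp add: one_poly_eq_simps monom_0)
next
  case (Suc n)
  let ?s = "stieltjes y n" and ?P = "orth y"
  have "monom 1 (Suc n) = [:0, 1:] * (monom 1 n :: real poly)"
    by (simp add: monom_Suc)
  also have "\<dots> = (\<Sum>k\<le>n. smult (?s k) ([:0, 1:] * ?P k))"
    by (simp add: Suc.IH sum_distrib_left mult_smult_right del: mult_pCons_left)
  also have "\<dots> = (\<Sum>k\<le>n. smult (?s k) (?P (Suc k))) + (\<Sum>k\<le>n. smult (y (2 * k + 1) * ?s k) (?P k))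
     + (\<Sum>k\<le>n. smult (?s k) (if k = 0 then 0 else smult (y (2 * k)) (?P (k - 1))))"
    unfolding x_times_orth by (simp add: smult_add_right sum.distrib mult.commute)
  also have "(\<Sum>k\<le>n. smult (?s k) (?P (Suc k)))
      = (\<Sum>k\<le>Suc n. smult (if k = 0 then 0 else ?s (k - 1)) (?P k))"
    by (subst sum.atMost_Suc_shift) simp
  also have "(\<Sum>k\<le>n. smult (y (2 * k + 1) * ?s k) (?P k))
      = (\<Sum>k\<le>Suc n. smult (y (2 * k + 1) * ?s k) (?P k))"
    by (simp add: stieltjes_above)
  also have "(\<Sum>k\<le>n. smult (?s k) (if k = 0 then 0 else smult (y (2 * k)) (?P (k - 1))))
      = (\<Sum>k\<le>Suc (Suc n). smult (?s k) (if k = 0 then 0 else smult (y (2 * k)) (?P (k - 1))))"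
    by (simp add: stieltjes_above)
  also have "\<dots> = (\<Sum>k\<le>Suc n. smult (y (2 * k + 2) * ?s (Suc k)) (?P k))"
    by (subst sum.atMost_Suc_shift) (simp add: mult.commute)
  finally show ?case
    by (simp only: stieltjes.simps smult_add_left sum.distrib)
qed

text \<open>In the mean of the expansion of x^n the terms 0 < k < n vanish by induction, and the
  term k = 0 already equals the n-th moment. Nothing is left for the term k = n, whose coefficient
  is 1.\<close>

lemma moment_functional_orth: "0 < n \<Longrightarrow> moment_functional (mom y) (orth y n) = 0"
proof (induction n rule: less_induct)
  case (less n)
  have "mom y n = moment_functional (mom y) (monom 1 n)"
    by (simp add: moment_functional_monom)
  also have "\<dots> = (\<Sum>k\<le>n. stieltjes y n k * moment_functional (mom y) (orth y k))"
    by (subst monom_expand[of n y]) (simp add: moment_functional_sum moment_functional_smult)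
  also have "\<dots> = (\<Sum>k\<in>{0, n}. stieltjes y n k * moment_functional (mom y) (orth y k))"
    by (rule sum.mono_neutral_right) (use less in auto)
  also have "\<dots> = mom y n + moment_functional (mom y) (orth y n)"
    using less.prems
    by (simp add: stieltjes_diag mom_def[of y n] moment_functional_def[of _ 1])
  finally show ?case by simp
qed

text \<open>The factors x are moved onto the orthogonal polynomial one at a time. A nonzero mean
  arises only at degree 0, which is reached only if i = j and every factor lowers the degree;
  lowering from degree j costs the factor \<open>y (2 * j)\<close>.\<close>

lemma moment_functional_monom_orth:
  "i \<le> j \<Longrightarrow> moment_functional (mom y) (monom 1 i * orth y j)
     = (if i = j then \<Prod>r\<in>{1..j}. y (2 * r) else 0)"
proof (induction i arbitrary: j)
  case 0
  show ?case
  proof (cases j)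
    case (Suc n)
    then show ?thesis using moment_functional_orth[of j y] by (simp add: monom_0)
  qed (simp add: monom_0 moment_functional_def)
next
  case (Suc i)
  then obtain n where n: "j = Suc n" by (cases j) auto
  have "monom 1 (Suc i) * orth y j = monom 1 i * ([:0, 1:] * orth y j)"
    by (simp add: monom_Suc)
  also have "\<dots> = monom 1 i * orth y (Suc j) + smult (y (2 * j + 1)) (monom 1 i * orth y j)
      + smult (y (2 * j)) (monom 1 i * orth y n)"
    unfolding x_times_orth by (simp add: n algebra_simps)
  finally show ?case
    using Suc n by (auto simp: moment_functional_add moment_functional_smult)
qed

lemma poly_eq_sum_smult_monom:
  fixes q :: "real poly"
  assumes "degree q \<le> n"
  shows "q = (\<Sum>i\<le>n. smult (coeff q i) (monom 1 i))"
  using poly_as_sum_of_monoms'[OF assms] by (simp add: smult_monom)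

lemma moment_functional_orth_mult:
  assumes "degree q \<le> j"
  shows "moment_functional (mom y) (orth y j * q) = coeff q j * (\<Prod>r\<in>{1..j}. y (2 * r))"
proof -
  have "orth y j * q = (\<Sum>i\<le>j. smult (coeff q i) (monom 1 i * orth y j))"
    by (subst poly_eq_sum_smult_monom[OF assms]) (simp add: sum_distrib_left algebra_simps)
  then have "moment_functional (mom y) (orth y j * q)
      = (\<Sum>i\<le>j. coeff q i * moment_functional (mom y) (monom 1 i * orth y j))"
    by (simp add: moment_functional_sum moment_functional_smult)
  also have "\<dots> = (\<Sum>i\<le>j. if i = j then coeff q j * (\<Prod>r\<in>{1..j}. y (2 * r)) else 0)"
    by (rule sum.cong) (auto simp: moment_functional_monom_orth)
  finally show ?thesis by simp
qed

text \<open>Gram-Schmidt: after removal of the leading orthogonal component the cross terms vanish,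
  and the removed part contributes a * a times a product of positive coefficients. This stands in
  for the positivity of a measure while no measure is known yet.\<close>

lemma moment_functional_square_pos:
  assumes "\<And>i. 1 \<le> i \<Longrightarrow> i \<le> k \<Longrightarrow> 0 < y (2 * i)"
  shows "p \<noteq> 0 \<Longrightarrow> degree p \<le> k \<Longrightarrow> 0 < moment_functional (mom y) (p * p)"
proof (induction "degree p" arbitrary: p rule: less_induct)
  case less
  define n a where "n = degree p" and "a = lead_coeff p"
  define q where "q = p - smult a (orth y n)"
  have h: "0 < (\<Prod>r\<in>{1..n}. y (2 * r))"
    using assms less.prems n_def by (intro prod_pos) auto
  have a: "a \<noteq> 0" using less.prems by (simp add: a_def)
  have dq: "degree q \<le> n"
    unfolding q_def n_def
    by (metis degree_diff_le degree_orth degree_smult_le order_refl)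
  have cq: "coeff q n = 0"
    by (simp add: q_def a_def n_def)
  have "p * p = q * q + smult a (orth y n * q) + smult a (orth y n * q) + smult (a * a) (orth y n * orth y n)"
  proof -
    have "(q + s) * (q + s) = q * q + s * q + s * q + s * s" for s
      by algebra
    from this[of "smult a (orth y n)"] show ?thesis by (simp add: q_def)
  qed
  note pp = this
  have E: "moment_functional (mom y) (p * p) = moment_functional (mom y) (q * q)
     + a * a * (\<Prod>r\<in>{1..n}. y (2 * r))"
    unfolding pp moment_functional_add moment_functional_smult moment_functional_orth_mult[OF dq]
    using moment_functional_orth_mult[of "orth y n" n y] by (simp add: cq)
  have "0 \<le> moment_functional (mom y) (q * q)"
  proof (cases "q = 0")
    case False
    then have "degree q < n"
      using dq cq by (metis leading_coeff_0_iff order_le_less)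
    then show ?thesis using less False n_def by (intro less_imp_le less.hyps) auto
  qed simp
  moreover have "0 < a * a" using a by (metis not_real_square_gt_zero)
  ultimately show ?case using h E by (simp add: add_nonneg_pos)
qed

section \<open>Gauss quadrature\<close>

lemma map_poly_of_real_mult:
  "map_poly complex_of_real (p * q) = map_poly complex_of_real p * map_poly complex_of_real q"
  by (rule poly_eqI) (simp add: coeff_map_poly coeff_mult)

lemma map_poly_of_real_add:
  "map_poly complex_of_real (p + q) = map_poly complex_of_real p + map_poly complex_of_real q"
  by (rule poly_eqI) (simp add: coeff_map_poly)

lemma poly_map_poly_of_real:
  "poly (map_poly complex_of_real p) (complex_of_real x) = complex_of_real (poly p x)"
  by (induction p) (auto simp: map_poly_pCons)

text \<open>If a + bi is a nonreal root, the remainder modulo (x - a)^2 + b^2 is a real polynomial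
  of degree at most one that vanishes at a nonreal point, hence zero.\<close>

lemma real_poly_root_or_quadratic_factor:
  fixes p :: "real poly"
  assumes "0 < degree p"
  shows "(\<exists>a. poly p a = 0) \<or> (\<exists>a b. b \<noteq> 0 \<and> [:a\<^sup>2 + b\<^sup>2, - 2 * a, 1:] dvd p)"
proof -
  let ?c = "map_poly complex_of_real"
  have "degree (?c p) \<noteq> 0"
    using assms by (simp add: degree_map_poly)
  then obtain z where z: "poly (?c p) z = 0"
    using fundamental_theorem_of_algebra constant_degree by metis
  define a b where "a = Re z" and "b = Im z"
  have zab: "z = Complex a b" by (simp add: a_def b_def)
  show ?thesis
  proof (cases "b = 0")
    case True
    then have "z = complex_of_real a" by (simp add: zab Complex_eq)
    then have "complex_of_real (poly p a) = 0"
      using z poly_map_poly_of_real[of p a] by simp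
    then show ?thesis by (auto simp: of_real_eq_0_iff)
  next
    case False
    define Q where "Q = [:a\<^sup>2 + b\<^sup>2, - 2 * a, 1:]"
    define r where "r = p mod Q"
    have "Q \<noteq> 0" "degree Q = 2" by (auto simp: Q_def)
    then have "degree r < 2" unfolding r_def
      using degree_mod_less'[of Q p] by (cases "r = 0") (auto simp: r_def)
    then obtain c d where r: "r = [:c, d:]"
      by (metis degree_pCons_eq_if less_2_cases_iff One_nat_def degree_eq_zeroE
          degree_0 pCons_0_0 pCons_cases Suc_inject less_Suc0 old.nat.inject zero_less_Suc less_one)
    have "poly (?c Q) z = 0"
      by (simp add: Q_def map_poly_pCons zab complex_eq_iff power2_eq_square algebra_simps)
    then have "poly (?c r) z = 0"
      using z mult_div_mod_eq[of Q p, symmetric]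
      by (metis add_0 map_poly_of_real_add map_poly_of_real_mult mult_zero_left poly_add poly_mult r_def)
    then have "d * b = 0" "c + d * a = 0"
      by (auto simp: r map_poly_pCons zab complex_eq_iff mult.commute)
    then have "r = 0" using False by (simp add: r)
    then have "Q dvd p" by (simp add: r_def mod_eq_0_iff_dvd)
    then show ?thesis using False unfolding Q_def by blast
  qed
qed

text \<open>The hypothesis excludes conjugate pairs of nonreal roots (b different from 0) and
  multiple real roots (b = 0), so all roots are real and simple.\<close>

lemma card_roots_no_quadratic_factor:
  fixes p :: "real poly"
  shows "p \<noteq> 0 \<Longrightarrow> (\<And>a b. \<not> [:a\<^sup>2 + b\<^sup>2, - 2 * a, 1:] dvd p) \<Longrightarrow> card {x. poly p x = 0} = degree p"
proof (induction "degree p" arbitrary: p rule: less_induct)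
  case less
  show ?case
  proof (cases "degree p = 0")
    case True
    then obtain a where "p = [:a:]" by (rule degree_eq_zeroE)
    then show ?thesis using less.prems by auto
  next
    case False
    then obtain a where "poly p a = 0"
      using real_poly_root_or_quadratic_factor[of p] less.prems by blast
    then obtain q where q: "p = [:- a, 1:] * q"
      by (metis dvdE poly_eq_0_iff_dvd)
    have qnz: "q \<noteq> 0" using less.prems q by auto
    then have dq: "degree p = Suc (degree q)"
      unfolding q by (subst degree_mult_eq) auto
    have "card {x. poly q x = 0} = degree q"
      using dvd_mult[of _ q "[:- a, 1:]"] less.prems(2) qnz dq unfolding q[symmetric]
      by (intro less.hyps) auto
    moreover have "poly q a \<noteq> 0"
    proof
      assume "poly q a = 0"
      then obtain s where "q = [:- a, 1:] * s"
        by (metis dvdE poly_eq_0_iff_dvd)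
      moreover have "[:- a, 1:] * [:- a, 1:] = [:a\<^sup>2 + 0\<^sup>2, - 2 * a, 1:]"
        by (simp add: power2_eq_square)
      ultimately have "p = [:a\<^sup>2 + 0\<^sup>2, - 2 * a, 1:] * s"
        by (metis q mult.assoc)
      then show False using less.prems(2)[of a 0] by (metis dvd_triv_left)
    qed
    moreover have "{x. poly p x = 0} = insert a {x. poly q x = 0}"
      by (auto simp: q)
    moreover have "finite {x. poly q x = 0}" using qnz by (rule poly_roots_finite)
    ultimately show ?thesis using dq by simp
  qed
qed

text \<open>If (x - a)^2 + b^2 divided P_k with quotient q, then P_k q = ((x - a) q)^2 + b^2 q^2
  would have positive mean, whereas orthogonality to the lower degree polynomial q gives mean 0.
  Nonreal and double roots are excluded at once.\<close>

lemma card_roots_orth: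
  assumes "\<And>i. 1 \<le> i \<Longrightarrow> i < k \<Longrightarrow> 0 < y (2 * i)"
  shows "card {x. poly (orth y k) x = 0} = k"
proof -
  have "\<not> [:a\<^sup>2 + b\<^sup>2, - 2 * a, 1:] dvd orth y k" for a b
  proof
    assume "[:a\<^sup>2 + b\<^sup>2, - 2 * a, 1:] dvd orth y k"
    then obtain q where q: "orth y k = [:a\<^sup>2 + b\<^sup>2, - 2 * a, 1:] * q" by (elim dvdE)
    then have qnz: "q \<noteq> 0" by (metis mult_zero_right orth_nz)
    have "degree (orth y k) = 2 + degree q"
      unfolding q by (subst degree_mult_eq) (use qnz in auto)
    then have k: "k = 2 + degree q" by simp
    have pos: "p \<noteq> 0 \<Longrightarrow> degree p \<le> k - 1 \<Longrightarrow> 0 < moment_functional (mom y) (p * p)" for p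
      by (rule moment_functional_square_pos[of "k - 1"]) (use assms k in auto)
    have "orth y k * q = ([:- a, 1:] * q) * ([:- a, 1:] * q) + smult (b\<^sup>2) (q * q)"
    proof -
      have "((X * X + C) * q) * q = (X * q) * (X * q) + C * (q * q)" for X C :: "real poly"
        by algebra
      moreover have "[:a\<^sup>2 + b\<^sup>2, - 2 * a, 1:] = [:- a, 1:] * [:- a, 1:] + [:b\<^sup>2:]"
        by (simp add: power2_eq_square)
      ultimately have "orth y k * q = ([:- a, 1:] * q) * ([:- a, 1:] * q) + [:b\<^sup>2:] * (q * q)"
        by (metis q)
      then show ?thesis by simp
    qed
    moreover have "moment_functional (mom y) (orth y k * q) = 0"
      using moment_functional_orth_mult[of q k y] k by (simp add: coeff_eq_0)
    moreover have "degree ([:- a, 1:] * q) \<le> k - 1"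
      using degree_mult_le[of "[:- a, 1:]" q] k by (simp del: mult_pCons_left)
    then have "0 < moment_functional (mom y) (([:- a, 1:] * q) * ([:- a, 1:] * q))"
      by (intro pos) (use qnz in \<open>auto simp del: mult_pCons_left\<close>)
    moreover have "0 < moment_functional (mom y) (q * q)"
      by (rule pos) (use qnz k in auto)
    ultimately show False
      by (simp del: mult_pCons_left add: moment_functional_add moment_functional_smult)
        (metis add_pos_nonneg less_irrefl less_imp_le mult_nonneg_nonneg zero_le_power2)
  qed
  then show ?thesis
    using card_roots_no_quadratic_factor[of "orth y k"] by simp
qed

text \<open>Division by P_k reduces exactness below degree 2 * k to Lagrange interpolation of the
  remainder, because the multiple of P_k has mean 0. The weight at x is the mean of the Lagrange
  polynomial \<open>B x\<close>; by exactness it equals the mean of its square and is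
  positive.\<close>

lemma gauss_quadrature:
  assumes "\<And>i. 1 \<le> i \<Longrightarrow> i < k \<Longrightarrow> 0 < y (2 * i)"
  obtains w where "\<And>x. poly (orth y k) x = 0 \<Longrightarrow> 0 < w x"
    and "\<And>p. degree p < 2 * k \<Longrightarrow>
      moment_functional (mom y) p = (\<Sum>x | poly (orth y k) x = 0. w x * poly p x)"
proof -
  define S where "S = {x. poly (orth y k) x = 0}"
  have S: "finite S" "card S = k"
    using card_roots_orth[of k y] assms by (auto simp: S_def poly_roots_finite)
  define B where "B x = (\<Prod>r\<in>S - {x}. smult (1 / (x - r)) [:- r, 1:])" for x
  have B1: "poly (B x) x = 1" for x
    unfolding B_def poly_prod
    by (rule prod.neutral) (auto simp flip: diff_divide_distrib)
  have B0: "x \<in> S \<Longrightarrow> r \<in> S \<Longrightarrow> r \<noteq> x \<Longrightarrow> poly (B x) r = 0" for x r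
    unfolding B_def poly_prod by (rule prod_zero) (use S in auto)
  have dB: "degree (B x) \<le> k - 1" if "x \<in> S" for x
  proof -
    have "degree (B x) \<le> (\<Sum>r\<in>S - {x}. degree (smult (1 / (x - r)) [:- r, 1:]))"
      unfolding B_def by (rule order_trans[OF degree_prod_sum_le]) (use S in auto)
    also have "\<dots> \<le> (\<Sum>r\<in>S - {x}. 1)"
      by (rule sum_mono) (rule order_trans[OF degree_smult_le], simp)
    also have "\<dots> = k - 1" using S that by simp
    finally show ?thesis .
  qed
  let ?L = "moment_functional (mom y)"
  have quad: "?L p = (\<Sum>x\<in>S. ?L (B x) * poly p x)" if "degree p < 2 * k" for p
  proof -
    define q r where "q = p div orth y k" and "r = p mod orth y k"
    have p: "p = orth y k * q + r" by (simp add: q_def r_def)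
    have k: "0 < k" using that by simp
    have dr: "degree r < k"
      using degree_mod_less'[of "orth y k" p] k by (cases "r = 0") (auto simp: r_def)
    have dq: "degree q < k"
    proof (rule ccontr)
      assume "\<not> degree q < k"
      then have "q \<noteq> 0" "k \<le> degree q" using k by auto
      then have "degree (orth y k * q) = k + degree q"
        by (subst degree_mult_eq) auto
      then have "degree p = k + degree q"
        unfolding p using dr \<open>k \<le> degree q\<close> by (subst degree_add_eq_left) auto
      then show False using that \<open>k \<le> degree q\<close> by simp
    qed
    have "r = (\<Sum>x\<in>S. smult (poly r x) (B x))"
    proof (rule poly_eqI_degree)
      show "poly r x = poly (\<Sum>x\<in>S. smult (poly r x) (B x)) x" if "x \<in> S" for x
      proof -
        have "poly (\<Sum>x\<in>S. smult (poly r x) (B x)) x = (\<Sum>z\<in>S. if z = x then poly r x else 0)"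
          unfolding poly_sum by (rule sum.cong) (use B0 B1 that in auto)
        then show ?thesis using that S by simp
      qed
      show "degree r < card S" using dr S by simp
      have "degree (\<Sum>x\<in>S. smult (poly r x) (B x)) \<le> k - 1"
        by (rule degree_sum_le) (use S dB in \<open>auto intro: order_trans[OF degree_smult_le]\<close>)
      then show "degree (\<Sum>x\<in>S. smult (poly r x) (B x)) < card S" using S k by simp
    qed
    then have "?L r = (\<Sum>x\<in>S. poly r x * ?L (B x))"
      by (metis (no_types, lifting) moment_functional_smult moment_functional_sum sum.cong)
    moreover have "?L (orth y k * q) = 0"
      using moment_functional_orth_mult[of q k y] dq by (simp add: coeff_eq_0)
    moreover have "x \<in> S \<Longrightarrow> poly r x = poly p x" for x
      by (simp add: p S_def)
    ultimately show ?thesis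
      by (subst p) (simp add: moment_functional_add mult.commute)
  qed
  show thesis
  proof
    fix x assume "poly (orth y k) x = 0"
    then have x: "x \<in> S" by (simp add: S_def)
    then have k: "0 < k" using S card_gt_0_iff by auto
    have "degree (B x * B x) < 2 * k"
      using degree_mult_le[of "B x" "B x"] dB[OF x] k by linarith
    then have "?L (B x * B x) = (\<Sum>z\<in>S. ?L (B z) * poly (B x * B x) z)" by (rule quad)
    also have "\<dots> = (\<Sum>z\<in>S. if z = x then ?L (B x) else 0)"
      by (rule sum.cong) (use B0 B1 x in auto)
    also have "\<dots> = ?L (B x)" using x S by simp
    finally have "?L (B x * B x) = ?L (B x)" .
    moreover have "B x \<noteq> 0" using B1[of x] by auto
    ultimately show "0 < ?L (B x)"
      using moment_functional_square_pos[of "k - 1" y "B x"] assms dB[OF x] k by auto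
  qed (use quad S_def in auto)
qed

text \<open>\<open>f\<close> transports the nodes: squaring moves the nodes of a symmetric rule on
  the line into the half line or the unit interval, and weights of nodes with the same image add
  up.\<close>

lemma finitely_supported_measure:
  fixes w f :: "real \<Rightarrow> real"
  assumes "finite S" "\<And>x. x \<in> S \<Longrightarrow> 0 < w x" "(\<Sum>x\<in>S. w x) = 1" "\<And>x. x \<in> S \<Longrightarrow> f x \<in> carrier_of E"
  shows "\<exists>\<mu>\<in>prob_measures E. \<forall>j. moment \<mu> j = (\<Sum>x\<in>S. w x * f x ^ j)"
proof -
  define N where "N = point_measure S (\<lambda>x. ennreal (w x))"
  define \<mu> where "\<mu> = distr N borel f"
  have meas: "f \<in> measurable N borel"
    by (simp add: N_def)
  have "emeasure N (space N) = 1"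
    using assms unfolding N_def
    by (simp add: space_point_measure emeasure_point_measure_finite sum_ennreal less_imp_le)
  then have N: "prob_space N" by (rule prob_spaceI)
  then have "prob_space \<mu>" unfolding \<mu>_def using meas by (rule prob_space.prob_space_distr)
  moreover have "AE x in \<mu>. x \<in> carrier_of E"
  proof -
    have "{x. x \<in> carrier_of E} \<in> sets borel" by (cases E) auto
    moreover have "AE x in N. f x \<in> carrier_of E"
      unfolding N_def AE_point_measure using assms by auto
    ultimately show ?thesis unfolding \<mu>_def
      by (subst AE_distr_iff[OF meas]) auto
  qed
  moreover have "integrable \<mu> (\<lambda>x. x ^ j) \<and> moment \<mu> j = (\<Sum>x\<in>S. w x * f x ^ j)" for j
  proof -
    have "integrable N (\<lambda>x. f x ^ j)"
      unfolding N_def by (rule integrable_point_measure_finite) (rule assms)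
    then have "integrable \<mu> (\<lambda>x. x ^ j)"
      unfolding \<mu>_def using meas by (subst integrable_distr_eq) auto
    moreover have "moment \<mu> j = (\<integral>x. f x ^ j \<partial>N)"
      unfolding moment_def \<mu>_def using meas by (subst integral_distr) auto
    moreover have "\<dots> = (\<Sum>x\<in>S. w x * f x ^ j)"
      unfolding N_def using assms by (subst lebesgue_integral_point_measure_finite) (auto intro: less_imp_le)
    ultimately show ?thesis by simp
  qed
  moreover have "sets \<mu> = sets borel" by (simp add: \<mu>_def)
  ultimately show ?thesis unfolding prob_measures_def by (intro bexI[of _ \<mu>]) auto
qed

section \<open>Canonical coordinates\<close>

text \<open>Under \<open>x \<mapsto> x\<^sup>2\<close> a measure on the half line corresponds to a symmetric measure on the real line,
  whose recurrence coefficients are \<open>\<alpha>\<^sub>k = 0\<close> and \<open>\<beta>\<^sub>k = z\<^sub>k\<close>; on the unit interval moreover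
  \<open>z\<^sub>k = (1 - p\<^bsub>k-1\<^esub>) p\<^sub>k\<close> with \<open>p\<^sub>0 = 0\<close>.\<close>

definition sym_coeffs :: "(nat \<Rightarrow> real) \<Rightarrow> nat \<Rightarrow> real" where
  "sym_coeffs z i = (if even i then z (i div 2) else 0)"

definition chain_seq :: "(nat \<Rightarrow> real) \<Rightarrow> nat \<Rightarrow> real" where
  "chain_seq p i = (1 - (if i \<le> 1 then 0 else p (i - 1))) * p i"

text \<open>The explicit inverse of the canonical coordinates. The argument \<open>2 * j\<close>
  appears because the j-th moment of the image under squaring is the 2j-th moment of the symmetric
  measure.\<close>

fun coord_moment :: "support \<Rightarrow> (nat \<Rightarrow> real) \<Rightarrow> nat \<Rightarrow> real" where
  "coord_moment UnitInterval y j = mom (sym_coeffs (chain_seq y)) (2 * j)"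
| "coord_moment HalfLine y j = mom (sym_coeffs y) (2 * j)"
| "coord_moment RealLine y j = mom y j"

text \<open>These are the factors g_j. Their logarithm is also the correction that turns V_j into
  W_j, which is how the Jacobian produces the rate function.\<close>

fun slope :: "support \<Rightarrow> nat \<Rightarrow> real \<Rightarrow> real" where
  "slope UnitInterval j t = t * (1 - t)"
| "slope HalfLine j t = t"
| "slope RealLine j t = (if odd j then 1 else t)"

text \<open>\<open>fiber_scale E y j\<close> is the derivative of \<open>m\<^sub>j\<close> with respect to \<open>y\<^sub>j\<close>; for the unit interval it
  equals \<open>m\<^sub>j\<^sup>+ - m\<^sub>j\<^sup>-\<close>.\<close>

definition fiber_scale :: "support \<Rightarrow> (nat \<Rightarrow> real) \<Rightarrow> nat \<Rightarrow> real" where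
  "fiber_scale E y j = (\<Prod>i\<in>{1..<j}. slope E i (y i))"

text \<open>The value 0 at index j singles out the offset of the affine map; the values 0 beyond j
  make the offset literally a function of the earlier coordinates.\<close>

definition trunc :: "nat \<Rightarrow> (nat \<Rightarrow> real) \<Rightarrow> nat \<Rightarrow> real" where
  "trunc j y = (\<lambda>i. if 1 \<le> i \<and> i < j then y i else 0)"

lemma coord_moment_0 [simp]: "coord_moment E y 0 = 1"
  by (cases E) auto

lemma coord_moment_cong:
  assumes "\<And>i. 1 \<le> i \<Longrightarrow> i \<le> j \<Longrightarrow> y i = y' i"
  shows "coord_moment E y j = coord_moment E y' j"
proof (cases E)
  case UnitInterval
  have "chain_seq y i = chain_seq y' i" if "1 \<le> i" "i \<le> j" for i
    using assms that by (auto simp: chain_seq_def)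
  then show ?thesis unfolding UnitInterval coord_moment.simps
    by (intro mom_cong) (auto simp: sym_coeffs_def elim!: evenE)
next
  case HalfLine
  then show ?thesis using assms by (auto intro!: mom_cong simp: sym_coeffs_def elim!: evenE)
next
  case RealLine
  then show ?thesis using assms by (auto intro!: mom_cong)
qed

lemma fiber_scale_cong:
  "(\<And>i. 1 \<le> i \<Longrightarrow> i < j \<Longrightarrow> y i = y' i) \<Longrightarrow> fiber_scale E y j = fiber_scale E y' j"
  unfolding fiber_scale_def by (rule prod.cong) auto

lemma fiber_scale_1 [simp]: "fiber_scale E y (Suc 0) = 1"
  by (simp add: fiber_scale_def)

lemma fiber_scale_Suc: "1 \<le> j \<Longrightarrow> fiber_scale E y (Suc j) = fiber_scale E y j * slope E j (y j)"
  by (simp add: fiber_scale_def atLeastLessThanSuc mult.commute)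

lemma prod_even_index: "(\<Prod>i\<in>{1..<2 * Suc j}. if even i then f (i div 2) else (1::real)) = prod f {1..j}"
proof (induction j)
  case 0
  have "{1..<2::nat} = {1}" by auto
  then show ?case by simp
next
  case (Suc j)
  have "{1..<2 * Suc (Suc j)} = insert (2 * j + 3) (insert (2 * j + 2) {1..<2 * Suc j})"
    by auto
  then have "(\<Prod>i\<in>{1..<2 * Suc (Suc j)}. if even i then f (i div 2) else 1)
     = f (Suc j) * (\<Prod>i\<in>{1..<2 * Suc j}. if even i then f (i div 2) else 1)"
    by (simp add: prod.insert_if)
  then show ?case using Suc by (simp add: prod.nat_ivl_Suc' mult.commute)
qed

lemma mom_sym_affine:
  assumes "1 \<le> j"
  shows "mom (sym_coeffs z) (2 * j) = mom (sym_coeffs (z(j := 0))) (2 * j) + (\<Prod>i\<in>{1..j}. z i)"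
proof -
  obtain k where k: "j = Suc k" using assms by (cases j) auto
  have "(\<Prod>i\<in>{1..<2 * j}. if even i then sym_coeffs z i else 1) = prod z {1..k}"
    unfolding k prod_even_index[symmetric] by (rule prod.cong) (auto simp: sym_coeffs_def)
  moreover have "mom ((sym_coeffs z)(2 * j := 0)) (2 * j) = mom (sym_coeffs (z(j := 0))) (2 * j)"
    by (rule mom_cong) (auto simp: sym_coeffs_def)
  ultimately show ?thesis
    using mom_affine[of "2 * j" "sym_coeffs z"] assms
    by (simp add: k sym_coeffs_def prod.nat_ivl_Suc')
qed

text \<open>The factors (1 - p_(i-1)) p_i regroup: each p_i with i < j meets 1 - p_i from the next
  factor, and only p_j stays alone. This is the origin of the slope p (1 - p).\<close>

lemma prod_chain_seq:
  "1 \<le> j \<Longrightarrow> (\<Prod>i\<in>{1..j}. chain_seq p i) = fiber_scale UnitInterval p j * p j"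
proof (induction j rule: dec_induct)
  case base
  show ?case by (simp add: chain_seq_def)
next
  case (step j)
  then show ?case
    by (simp add: fiber_scale_Suc chain_seq_def prod.nat_ivl_Suc')
qed

lemma prod_eq_fiber_scale_Half: "1 \<le> j \<Longrightarrow> (\<Prod>i\<in>{1..j}. z i) = fiber_scale HalfLine z j * z j"
  by (cases j) (auto simp: fiber_scale_def prod.nat_ivl_Suc' atLeastLessThanSuc_atLeastAtMost)

text \<open>Triangularity of the parametrization: the inverse map, the extremal moments and the
  Jacobian are all read off this formula.\<close>

lemma coord_moment_affine:
  assumes "1 \<le> j"
  shows "coord_moment E y j = coord_moment E (trunc j y) j + fiber_scale E y j * y j"
proof (cases E)
  case UnitInterval
  have "mom (sym_coeffs ((chain_seq y)(j := 0))) (2 * j) = mom (sym_coeffs (chain_seq (trunc j y))) (2 * j)"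
    by (rule mom_cong) (auto simp: sym_coeffs_def chain_seq_def trunc_def)
  then show ?thesis
    using mom_sym_affine[OF assms, of "chain_seq y"] prod_chain_seq[OF assms] by (simp add: UnitInterval)
next
  case HalfLine
  have "mom (sym_coeffs (y(j := 0))) (2 * j) = mom (sym_coeffs (trunc j y)) (2 * j)"
    by (rule mom_cong) (auto simp: sym_coeffs_def trunc_def)
  then show ?thesis
    using mom_sym_affine[OF assms, of y] prod_eq_fiber_scale_Half[OF assms] by (simp add: HalfLine)
next
  case RealLine
  have "mom (y(j := 0)) j = mom (trunc j y) j"
    by (rule mom_cong) (auto simp: trunc_def)
  moreover have "(\<Prod>i\<in>{1..<j}. if even i then y i else 1) = fiber_scale RealLine y j"
    unfolding fiber_scale_def by (rule prod.cong) auto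
  ultimately show ?thesis
    using mom_affine[of j y] assms by (simp add: RealLine)
qed

lemma continuous_on_coord_moment:
  fixes F :: "'a::topological_space \<Rightarrow> nat \<Rightarrow> real"
  assumes F: "\<And>i. continuous_on S (\<lambda>x. F x i)"
  shows "continuous_on S (\<lambda>x. coord_moment E (F x) j)"
proof (cases E)
  case UnitInterval
  have "continuous_on S (\<lambda>x. sym_coeffs (chain_seq (F x)) i)" for i
    unfolding sym_coeffs_def chain_seq_def
    by (cases "even i"; cases "i div 2 \<le> 1") (auto intro!: continuous_intros F)
  then show ?thesis by (simp add: UnitInterval mom_def continuous_on_stieltjes)
next
  case HalfLine
  have "continuous_on S (\<lambda>x. sym_coeffs (F x) i)" for i
    unfolding sym_coeffs_def by (cases "even i") (auto intro!: continuous_intros F)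
  then show ?thesis by (simp add: HalfLine mom_def continuous_on_stieltjes)
next
  case RealLine
  then show ?thesis using F by (simp add: mom_def continuous_on_stieltjes)
qed

lemma mom_abs_le:
  "1 \<le> R \<Longrightarrow> (\<And>i. 1 \<le> i \<Longrightarrow> i \<le> n \<Longrightarrow> \<bar>y i\<bar> \<le> R) \<Longrightarrow> \<bar>mom y n\<bar> \<le> (3 * R) ^ n"
  unfolding mom_def by (rule stieltjes_abs_le) auto

text \<open>The product of the 1 + |y_i| serves as common bound because its logarithm is what the
  growth of the potentials controls. In a chain sequence the factor 1 - p_(i-1) is at most 1, so the
  bound survives, and the exponent \<open>2 * j\<close> covers all three supports.\<close>

lemma coord_moment_abs_le:
  assumes "\<And>i. i \<in> {1..j} \<Longrightarrow> y i \<in> coord_domain E i"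
  shows "\<bar>coord_moment E y j\<bar> \<le> (3 * (\<Prod>i\<in>{1..j}. 1 + \<bar>y i\<bar>)) ^ (2 * j)"
proof -
  define R where "R = (\<Prod>i\<in>{1..j}. 1 + \<bar>y i\<bar>)"
  have R: "1 \<le> R" unfolding R_def by (rule prod_ge_1) auto
  have yR: "\<bar>y i\<bar> \<le> R" if "i \<in> {1..j}" for i
  proof -
    have "R = (1 + \<bar>y i\<bar>) * (\<Prod>i\<in>{1..j} - {i}. 1 + \<bar>y i\<bar>)"
      unfolding R_def by (rule prod.remove) (use that in auto)
    moreover have "1 \<le> (\<Prod>i\<in>{1..j} - {i}. 1 + \<bar>y i\<bar>)" by (rule prod_ge_1) auto
    ultimately show ?thesis
      using mult_left_mono[of 1 "\<Prod>i\<in>{1..j} - {i}. 1 + \<bar>y i\<bar>" "1 + \<bar>y i\<bar>"] by simp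
  qed
  show ?thesis unfolding R_def[symmetric]
  proof (cases E)
    case UnitInterval
    have "\<bar>sym_coeffs (chain_seq y) i\<bar> \<le> R" if "1 \<le> i" "i \<le> 2 * j" for i
    proof (cases "even i")
      case True
      then obtain r where r: "i = 2 * r" by (elim evenE)
      then have r1: "1 \<le> r" "r \<le> j" using that by auto
      define q where "q = (if r \<le> 1 then 0 else y (r - 1))"
      have yr: "0 < y r" "y r < 1" using assms[of r] r1 by (auto simp: UnitInterval)
      have "0 \<le> q" "q < 1" using assms[of "r - 1"] r1
        by (cases "r \<le> 1"; force simp: UnitInterval q_def)+
      then have "\<bar>1 - q\<bar> * \<bar>y r\<bar> \<le> 1 * R" using yr R by (intro mult_mono) auto
      moreover have "sym_coeffs (chain_seq y) i = (1 - q) * y r"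
        by (simp add: r sym_coeffs_def chain_seq_def q_def)
      ultimately show ?thesis by (simp add: abs_mult)
    qed (use R in \<open>simp add: sym_coeffs_def\<close>)
    then show "\<bar>coord_moment E y j\<bar> \<le> (3 * R) ^ (2 * j)"
      unfolding UnitInterval coord_moment.simps using R by (intro mom_abs_le) auto
  next
    case HalfLine
    have "\<bar>sym_coeffs y i\<bar> \<le> R" if "1 \<le> i" "i \<le> 2 * j" for i
      using that yR[of "i div 2"] R by (auto simp: sym_coeffs_def elim!: evenE)
    then show "\<bar>coord_moment E y j\<bar> \<le> (3 * R) ^ (2 * j)"
      unfolding HalfLine coord_moment.simps using R by (intro mom_abs_le) auto
  next
    case RealLine
    have "\<bar>coord_moment E y j\<bar> \<le> (3 * R) ^ j"
      unfolding RealLine coord_moment.simps using R yR by (intro mom_abs_le) auto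
    also have "\<dots> \<le> (3 * R) ^ (2 * j)" using R by (intro power_increasing) auto
    finally show "\<bar>coord_moment E y j\<bar> \<le> (3 * R) ^ (2 * j)" .
  qed
qed

lemma slope_pos: "t \<in> coord_domain E j \<Longrightarrow> 0 < slope E j t"
  by (cases E) (auto split: if_splits)

lemma fiber_scale_pos: "(\<And>i. 1 \<le> i \<Longrightarrow> i < j \<Longrightarrow> y i \<in> coord_domain E i) \<Longrightarrow> 0 < fiber_scale E y j"
  unfolding fiber_scale_def by (rule prod_pos) (auto intro: slope_pos)

lemma closure_coord_domain:
  "closure (coord_domain E j) = (case E of UnitInterval \<Rightarrow> {0..1} | HalfLine \<Rightarrow> {0..}
     | RealLine \<Rightarrow> if odd j then UNIV else {0..})"
  by (cases E) auto

section \<open>Location of zeros and realization of coordinates by quadrature\<close>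

lemma poly_orth_uminus:
  "poly (orth (sym_coeffs z) k) (- x) = (- 1) ^ k * poly (orth (sym_coeffs z) k) x"
proof (induction "sym_coeffs z" k rule: orth.induct)
  case (3 n)
  then show ?case by (simp add: orth.simps(3) algebra_simps) (simp add: sym_coeffs_def)
qed (auto simp: sym_coeffs_def)

lemma poly_orth_sym_Suc:
  "poly (orth (sym_coeffs z) (Suc (Suc n))) x =
     x * poly (orth (sym_coeffs z) (Suc n)) x - z (Suc n) * poly (orth (sym_coeffs z) n) x"
  by (simp add: orth.simps(3)) (simp add: sym_coeffs_def)

text \<open>By induction the chain coefficient times P_(k-1)(1) equals p_k P_k(1), so at x = 1 the
  recurrence merely multiplies by 1 - p_k.\<close>

lemma poly_orth_chain_1: "poly (orth (sym_coeffs (chain_seq p)) (Suc k)) 1 = (\<Prod>i\<in>{1..k}. 1 - p i)"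
proof (induction k rule: less_induct)
  case (less k)
  consider "k = 0" | "k = 1" | n where "k = Suc (Suc n)"
    by (metis One_nat_def old.nat.exhaust)
  then show ?case
  proof cases
    case 1
    then show ?thesis by (simp add: sym_coeffs_def)
  next
    case 2
    have "poly (orth (sym_coeffs (chain_seq p)) (Suc (Suc 0))) 1 = 1 - p 1"
      unfolding poly_orth_sym_Suc by (simp add: sym_coeffs_def chain_seq_def)
    then show ?thesis by (simp add: 2)
  next
    case (3 n)
    then show ?thesis
      using less[of "Suc n"] less[of n]
      by (simp add: poly_orth_sym_Suc[of _ "Suc n"] prod.nat_ivl_Suc' chain_seq_def algebra_simps)
  qed
qed

text \<open>Positivity alone does not pass through a recurrence with a subtracted term. The lower
  bound 1 - p_k for the ratio P_(k+1) / P_k does, thanks to the factor 1 - p_(k-1) in the chain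
  coefficient.\<close>

lemma poly_orth_chain_pos:
  assumes "\<And>i. 1 \<le> i \<Longrightarrow> p i \<in> {0<..<1}" "1 \<le> x"
  shows "0 < poly (orth (sym_coeffs (chain_seq p)) k) x \<and>
    (1 - (if k = 0 then 0 else p k)) * poly (orth (sym_coeffs (chain_seq p)) k) x
      \<le> poly (orth (sym_coeffs (chain_seq p)) (Suc k)) x"
proof (induction k)
  case 0
  show ?case using assms(2) by (simp add: sym_coeffs_def)
next
  case (Suc k)
  let ?P = "\<lambda>k. poly (orth (sym_coeffs (chain_seq p)) k) x"
  define q where "q = (if k = 0 then 0 else p k)"
  have q: "q < 1" using assms(1)[of k] by (auto simp: q_def)
  have p: "0 < p (Suc k)" "p (Suc k) < 1" using assms(1)[of "Suc k"] by auto
  have IH: "0 < ?P k" "(1 - q) * ?P k \<le> ?P (Suc k)" using Suc by (auto simp: q_def)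
  have "0 < (1 - q) * ?P k" using IH q by simp
  then have pos: "0 < ?P (Suc k)" using IH by linarith
  have ch: "chain_seq p (Suc k) = (1 - q) * p (Suc k)"
    by (cases k) (auto simp: chain_seq_def q_def)
  have "p (Suc k) * ((1 - q) * ?P k) \<le> p (Suc k) * ?P (Suc k)"
    using IH p by (intro mult_left_mono) auto
  moreover have "?P (Suc k) \<le> x * ?P (Suc k)"
    using pos assms(2) by simp
  ultimately have "(1 - p (Suc k)) * ?P (Suc k) \<le> ?P (Suc (Suc k))"
    unfolding poly_orth_sym_Suc ch by (simp add: algebra_simps)
  then show ?case using pos by simp
qed

text \<open>There is no zero at or beyond 1, and by parity none at or beyond -1. Hence the squared
  Gauss nodes stay in the unit interval.\<close>

lemma orth_chain_root:
  assumes "\<And>i. 1 \<le> i \<Longrightarrow> p i \<in> {0<..<1}" "poly (orth (sym_coeffs (chain_seq p)) k) x = 0"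
  shows "x\<^sup>2 \<le> 1"
proof (rule ccontr)
  assume "\<not> x\<^sup>2 \<le> 1"
  then have "1 \<le> x \<or> 1 \<le> - x" by (metis abs_le_square_iff abs_1 linorder_le_cases not_le abs_ge_self abs_le_iff one_power2 less_imp_le)
  then show False
    using poly_orth_chain_pos[of p, OF assms(1), where x = x and k = k]
      poly_orth_chain_pos[of p, OF assms(1), where x = "- x" and k = k]
      assms(2) by (auto simp: poly_orth_uminus)
qed

text \<open>Gauss nodes on the line are moved by \<open>f\<close>, which is the identity for d = 1
  and the square for d = 2.\<close>

lemma measure_of_recurrence:
  assumes pos: "\<And>i. 1 \<le> i \<Longrightarrow> 0 < y (2 * i)"
    and f: "\<And>x k. poly (orth y k) x = 0 \<Longrightarrow> f x \<in> carrier_of E"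
    and f': "\<And>x j. f x ^ j = x ^ (d * j)"
  shows "\<exists>\<mu>\<in>prob_measures E. \<forall>j\<le>n. moment \<mu> j = mom y (d * j)"
proof -
  \<comment> \<open>With this number of nodes the rule is exact up to degree 2 * d * n + 1, and
    there is a node even for n = 0.\<close>
  define k where "k = Suc (d * n)"
  obtain w where w: "\<And>x. poly (orth y k) x = 0 \<Longrightarrow> 0 < w x"
    and quad: "\<And>p. degree p < 2 * k \<Longrightarrow>
      moment_functional (mom y) p = (\<Sum>x | poly (orth y k) x = 0. w x * poly p x)"
    using gauss_quadrature[of k y] pos by (metis One_nat_def)
  have mono: "mom y i = (\<Sum>x | poly (orth y k) x = 0. w x * x ^ i)" if "i \<le> d * n" for i
    using quad[of "monom 1 i"] that degree_monom_le[of "1::real" i]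
    by (simp add: moment_functional_monom poly_monom k_def)
  have "(\<Sum>x | poly (orth y k) x = 0. w x) = 1"
    using mono[of 0] by simp
  then obtain \<mu> where "\<mu> \<in> prob_measures E"
    and "\<forall>j. moment \<mu> j = (\<Sum>x | poly (orth y k) x = 0. w x * f x ^ j)"
    using finitely_supported_measure[of "{x. poly (orth y k) x = 0}" w f E] w f
    by (auto simp: poly_roots_finite)
  then show ?thesis
    by (intro bexI[of _ \<mu>]) (auto simp: f' mono)
qed

lemma ex_measure_coord_moment:
  assumes "\<And>i. 1 \<le> i \<Longrightarrow> i \<le> n \<Longrightarrow> y i \<in> coord_domain E i"
  shows "\<exists>\<mu>\<in>prob_measures E. \<forall>j\<le>n. moment \<mu> j = coord_moment E y j"
proof -
  \<comment> \<open>The quadrature asks for admissible coefficients at every index. The value 1 / 2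
    lies in all coordinate domains, and indices above n do not affect the first n moments.\<close>
  define y' where "y' = (\<lambda>i. if i \<le> n then y i else 1 / 2)"
  have y': "y' i \<in> coord_domain E i" if "1 \<le> i" for i
    using assms[of i] that by (cases E) (auto simp: y'_def)
  have "\<exists>\<mu>\<in>prob_measures E. \<forall>j\<le>n. moment \<mu> j = coord_moment E y' j"
  proof (cases E)
    case UnitInterval
    have p: "y' i \<in> {0<..<1}" if "1 \<le> i" for i using y'[OF that] by (simp add: UnitInterval)
    have "0 < chain_seq y' i" if "1 \<le> i" for i
      unfolding chain_seq_def using p[OF that] p[of "i - 1"] by (auto intro!: mult_pos_pos)
    then show ?thesis unfolding UnitInterval coord_moment.simps
      by (intro measure_of_recurrence[where f = "\<lambda>x. x\<^sup>2"])
        (use orth_chain_root[OF p] in \<open>auto simp: sym_coeffs_def power_mult\<close>)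
  next
    case HalfLine
    then show ?thesis unfolding HalfLine coord_moment.simps
      by (intro measure_of_recurrence[where f = "\<lambda>x. x\<^sup>2"])
        (use HalfLine y' in \<open>auto simp: sym_coeffs_def power_mult\<close>)
  next
    case RealLine
    have "0 < y' (2 * i)" if "1 \<le> i" for i
      using y'[of "2 * i"] that by (simp add: RealLine)
    then have "\<exists>\<mu>\<in>prob_measures E. \<forall>j\<le>n. moment \<mu> j = mom y' (1 * j)"
      by (intro measure_of_recurrence[where f = "\<lambda>x. x"]) (auto simp: RealLine)
    then show ?thesis by (simp add: RealLine)
  qed
  moreover have "coord_moment E y' j = coord_moment E y j" if "j \<le> n" for j
    by (rule coord_moment_cong) (use that in \<open>auto simp: y'_def\<close>)
  ultimately show ?thesis by auto
qed

section \<open>Restrictions that a measure imposes on its coordinates\<close>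

lemma prob_measuresD:
  assumes "\<mu> \<in> prob_measures E"
  shows "prob_space \<mu>" "sets \<mu> = sets borel" "AE x in \<mu>. x \<in> carrier_of E"
    "integrable \<mu> (\<lambda>x. x ^ j)"
  using assms by (auto simp: prob_measures_def)

lemma moment_0:
  assumes "\<mu> \<in> prob_measures E"
  shows "moment \<mu> 0 = 1"
proof -
  interpret prob_space \<mu> using assms by (rule prob_measuresD)
  show ?thesis by (simp add: moment_def prob_space)
qed

lemma integral_poly:
  assumes "\<mu> \<in> prob_measures E"
  shows "(\<integral>x. poly p x \<partial>\<mu>) = moment_functional (moment \<mu>) p"
  using prob_measuresD(4)[OF assms]
  by (simp add: poly_altdef moment_functional_def moment_def)

lemma stieltjes_sym_odd: "odd (n + k) \<Longrightarrow> stieltjes (sym_coeffs z) n k = 0"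
proof (induction n arbitrary: k)
  case (Suc n)
  have "stieltjes (sym_coeffs z) n (k - 1) = 0" if "k \<noteq> 0"
    using Suc.IH[of "k - 1"] Suc.prems that by (cases k) auto
  moreover have "stieltjes (sym_coeffs z) n (Suc k) = 0"
    using Suc.IH[of "Suc k"] Suc.prems by auto
  moreover have "sym_coeffs z (2 * k + 1) = 0" by (simp add: sym_coeffs_def)
  ultimately show ?case by simp
qed (auto simp: odd_pos)

text \<open>Instead of building the symmetric measure on the line, p is averaged over the two square
  roots of x. Only even powers survive, so the average is a polynomial in x whose integral involves
  moments up to half the degree of p, while the odd moments of the symmetric functional
  vanish.\<close>

lemma moment_functional_sqrt_nonneg:
  assumes \<mu>: "\<mu> \<in> prob_measures E" and sub: "carrier_of E \<subseteq> {0..}"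
    and nonneg: "\<And>x. x \<in> carrier_of E \<Longrightarrow> 0 \<le> poly p (sqrt x) + poly p (- sqrt x)"
    and mom: "\<And>j. 1 \<le> j \<Longrightarrow> j \<le> n \<Longrightarrow> moment \<mu> j = mom (sym_coeffs z) (2 * j)"
    and deg: "degree p \<le> 2 * n"
  shows "0 \<le> moment_functional (mom (sym_coeffs z)) p"
proof -
  define q where "q x = (\<Sum>i\<le>degree p. (if even i then coeff p i else 0) * x ^ (i div 2))" for x :: real
  have "poly p (sqrt x) + poly p (- sqrt x) = 2 * q x" if "x \<in> carrier_of E" for x
  proof -
    have x: "0 \<le> x" using that sub by auto
    have "poly p (sqrt x) + poly p (- sqrt x) = (\<Sum>i\<le>degree p. coeff p i * (sqrt x ^ i + (- sqrt x) ^ i))"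
      by (simp add: poly_altdef sum.distrib algebra_simps)
    also have "\<dots> = (\<Sum>i\<le>degree p. 2 * ((if even i then coeff p i else 0) * x ^ (i div 2)))"
      by (rule sum.cong) (use x in \<open>auto simp: power_mult elim!: evenE\<close>)
    finally show ?thesis by (simp add: q_def sum_distrib_left)
  qed
  then have "AE x in \<mu>. 0 \<le> q x"
    using prob_measuresD(3)[OF \<mu>] nonneg by (elim AE_mp) (auto intro!: AE_I2 simp: zero_le_mult_iff)
  then have "0 \<le> (\<integral>x. q x \<partial>\<mu>)" by (rule integral_nonneg_AE)
  also have "(\<integral>x. q x \<partial>\<mu>) = (\<Sum>i\<le>degree p. (if even i then coeff p i else 0) * moment \<mu> (i div 2))"
    unfolding q_def moment_def using prob_measuresD(4)[OF \<mu>] by simp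
  also have "\<dots> = moment_functional (mom (sym_coeffs z)) p"
    unfolding moment_functional_def
  proof (rule sum.cong)
    fix i assume "i \<in> {..degree p}"
    then have i: "i \<le> 2 * n" using deg by simp
    show "(if even i then coeff p i else 0) * moment \<mu> (i div 2) = coeff p i * mom (sym_coeffs z) i"
    proof (cases "even i")
      case True
      then obtain r where r: "i = 2 * r" by (elim evenE)
      then show ?thesis using mom[of r] i moment_0[OF \<mu>] by (cases "r = 0") auto
    next
      case False
      then show ?thesis using stieltjes_sym_odd[of i 0 z] by (simp add: mom_def)
    qed
  qed simp
  finally show ?thesis .
qed

text \<open>Positivity is tested on the square of the n-th orthogonal polynomial, whose mean is the
  product of the recurrence coefficients.\<close>

lemma sym_coord_nonneg:
  assumes "\<mu> \<in> prob_measures E" "carrier_of E \<subseteq> {0..}"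
    and "\<And>i. 1 \<le> i \<Longrightarrow> i \<le> n \<Longrightarrow> moment \<mu> i = mom (sym_coeffs z) (2 * i)"
  shows "0 \<le> (\<Prod>i\<in>{1..n}. z i)"
proof -
  let ?P = "orth (sym_coeffs z) n"
  have "0 \<le> moment_functional (mom (sym_coeffs z)) (?P * ?P)"
    by (rule moment_functional_sqrt_nonneg[OF assms(1,2) _ assms(3), where n = n])
      (use degree_mult_le[of ?P ?P] in auto)
  also have "\<dots> = (\<Prod>i\<in>{1..n}. z i)"
    using moment_functional_orth_mult[of ?P n "sym_coeffs z"] by (simp add: sym_coeffs_def)
  finally show ?thesis .
qed

text \<open>The polynomial \<open>R\<close> with \<open>(x\<^sup>2 - 1) R = P\<^bsub>k+2\<^esub> - c P\<^sub>k\<close> is orthogonal with respect to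
  the weight \<open>1 - x\<^sup>2\<close> (Christoffel); its norm yields the upper bound.\<close>

lemma chain_coord_le_1:
  assumes \<mu>: "\<mu> \<in> prob_measures UnitInterval"
    and p: "\<And>i. 1 \<le> i \<Longrightarrow> i \<le> k \<Longrightarrow> p i \<in> {0<..<1}"
    and mom: "\<And>i. 1 \<le> i \<Longrightarrow> i \<le> Suc k \<Longrightarrow> moment \<mu> i = mom (sym_coeffs (chain_seq p)) (2 * i)"
  shows "p (Suc k) \<le> 1"
proof -
  let ?y = "sym_coeffs (chain_seq p)"
  let ?P = "orth ?y"
  \<comment> \<open>The ratio P_(k+2)(1) / P_k(1), chosen so that \<open>N\<close> vanishes at 1
    and, by parity, at -1. For k = 0 there is no factor with p_0.\<close>
  define c where "c = (if k = 0 then 1 else 1 - p k) * (1 - p (Suc k))"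
  define N where "N = ?P (Suc (Suc k)) - smult c (?P k)"
  have N1: "poly N 1 = 0"
  proof (cases k)
    case 0
    then show ?thesis
      using poly_orth_chain_1[of p "Suc 0"] by (simp add: N_def c_def)
  next
    case (Suc r)
    then show ?thesis
      using poly_orth_chain_1[of p "Suc k"] poly_orth_chain_1[of p r]
      by (simp add: N_def c_def prod.nat_ivl_Suc')
  qed
  have "poly N (- 1) = (- 1) ^ k * poly N 1"
    unfolding N_def using poly_orth_uminus[of "chain_seq p" _ 1] by (simp add: algebra_simps)
  then have N2: "poly N (- 1) = 0" using N1 by simp
  obtain M where M: "N = [:- 1, 1:] * M"
    using N1 by (metis dvdE poly_eq_0_iff_dvd)
  have "poly M (- 1) = 0" using N2 by (simp add: M)
  then obtain R where "M = [:1, 1:] * R"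
    by (metis dvdE poly_eq_0_iff_dvd minus_minus)
  then have NR: "N = [:- 1, 0, 1:] * R"
    by (simp add: M flip: mult.assoc)
  have degN: "degree N = Suc (Suc k)" unfolding N_def diff_conv_add_uminus
    by (subst degree_add_eq_left) (auto intro: le_less_trans[OF degree_smult_le])
  have Rnz: "R \<noteq> 0" using degN NR by auto
  have dR: "degree R = k"
    using degN Rnz unfolding NR by (subst (asm) degree_mult_eq) auto
  have "lead_coeff N = 1"
    unfolding degN by (simp add: N_def coeff_eq_0)
  then have cR: "coeff R k = 1"
    using lead_coeff_mult[of "[:- 1, 0, 1:]" R] by (simp add: NR dR)
  let ?L = "moment_functional (mom ?y)"
  \<comment> \<open>The tested polynomial equals c P_k R - P_(k+2) R. Orthogonality removes the
    second term and leaves c times the squared norm of P_k, so c cannot be negative.\<close>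
  have "0 \<le> ?L ([:1, 0, - 1:] * (R * R))"
  proof (rule moment_functional_sqrt_nonneg[OF \<mu> _ _ mom])
    fix x assume "x \<in> carrier_of UnitInterval"
    then have x: "0 \<le> x" "x \<le> 1" by auto
    have "poly ([:1, 0, - 1:] * (R * R)) s = (1 - s\<^sup>2) * (poly R s)\<^sup>2" for s
      by (simp add: power2_eq_square algebra_simps)
    then show "0 \<le> poly ([:1, 0, - 1:] * (R * R)) (sqrt x) + poly ([:1, 0, - 1:] * (R * R)) (- sqrt x)"
      using x by (simp del: mult_pCons_left)
  next
    show "degree ([:1, 0, - 1:] * (R * R)) \<le> 2 * Suc k"
      using degree_mult_le[of "[:1, 0, - 1:]" "R * R"] degree_mult_le[of R R] dR
      by (simp del: mult_pCons_left)
  qed auto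
  also have "[:1, 0, - 1:] * (R * R) = smult c (?P k * R) - ?P (Suc (Suc k)) * R"
  proof -
    have "[:1, 0, - 1:] * (R * R) = - (N * R)" by (simp add: NR algebra_simps)
    then show ?thesis by (simp add: N_def algebra_simps)
  qed
  also have "?L \<dots> = c * (\<Prod>i\<in>{1..k}. chain_seq p i)"
    using moment_functional_orth_mult[of R "Suc (Suc k)" ?y] moment_functional_orth_mult[of R k ?y]
    by (simp add: moment_functional_diff moment_functional_smult dR cR coeff_eq_0 sym_coeffs_def)
  finally have *: "0 \<le> c * (\<Prod>i\<in>{1..k}. chain_seq p i)" .
  have "0 < chain_seq p i" if "1 \<le> i" "i \<le> k" for i
    unfolding chain_seq_def using p[OF that] p[of "i - 1"] that by (auto intro!: mult_pos_pos)
  then have "0 < (\<Prod>i\<in>{1..k}. chain_seq p i)" by (intro prod_pos) auto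
  then have "0 \<le> c" using * by (simp add: zero_le_mult_iff)
  moreover have "0 < (if k = 0 then 1 else 1 - p k)" using p[of k] by auto
  ultimately show ?thesis by (auto simp: c_def zero_le_mult_iff)
qed

text \<open>The mean of a suitable square is \<open>y j\<close> times positive factors formed from
  the earlier coordinates; on the line the coordinates of odd index are unrestricted. For the unit
  interval the weight 1 - x^2 adds the upper bound.\<close>

lemma coord_in_closure:
  assumes \<mu>: "\<mu> \<in> prob_measures E" and j: "1 \<le> j"
    and dom: "\<And>i. 1 \<le> i \<Longrightarrow> i < j \<Longrightarrow> y i \<in> coord_domain E i"
    and mom: "\<And>i. 1 \<le> i \<Longrightarrow> i \<le> j \<Longrightarrow> moment \<mu> i = coord_moment E y i"
  shows "y j \<in> closure (coord_domain E j)"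
proof (cases E)
  case UnitInterval
  have "0 \<le> fiber_scale UnitInterval y j * y j"
    unfolding prod_chain_seq[OF j, symmetric]
    by (rule sym_coord_nonneg[of \<mu> UnitInterval]) (use \<mu> mom UnitInterval in auto)
  moreover have "0 < fiber_scale UnitInterval y j" using dom UnitInterval by (intro fiber_scale_pos) auto
  moreover have "y (Suc (j - 1)) \<le> 1"
    by (rule chain_coord_le_1[of \<mu>]) (use \<mu> mom dom UnitInterval j in auto)
  ultimately show ?thesis using j
    unfolding closure_coord_domain by (simp add: UnitInterval zero_le_mult_iff)
next
  case HalfLine
  have "0 \<le> fiber_scale HalfLine y j * y j"
    unfolding prod_eq_fiber_scale_Half[OF j, symmetric]
    by (rule sym_coord_nonneg[of \<mu> HalfLine]) (use \<mu> mom HalfLine in auto)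
  moreover have "0 < fiber_scale HalfLine y j" using dom HalfLine by (intro fiber_scale_pos) auto
  ultimately show ?thesis
    unfolding closure_coord_domain by (simp add: HalfLine zero_le_mult_iff)
next
  case RealLine
  show ?thesis
  proof (cases "even j")
    case True
    then obtain k where k: "j = 2 * k" by (elim evenE)
    let ?P = "orth y k"
    have "0 \<le> (\<integral>x. poly (?P * ?P) x \<partial>\<mu>)" by (rule Bochner_Integration.integral_nonneg) simp
    also have "\<dots> = moment_functional (moment \<mu>) (?P * ?P)" by (rule integral_poly[OF \<mu>])
    also have "\<dots> = moment_functional (mom y) (?P * ?P)"
    proof (rule moment_functional_cong)
      fix i assume "i \<le> degree (?P * ?P)"
      then have "i \<le> j" using degree_mult_le[of ?P ?P] k by simp
      then show "moment \<mu> i = mom y i"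
        using mom[of i] moment_0[OF \<mu>] by (cases "i = 0") (auto simp: RealLine)
    qed
    also have "\<dots> = (\<Prod>i\<in>{1..k}. y (2 * i))"
      using moment_functional_orth_mult[of ?P k y] by simp
    also have "\<dots> = y j * (\<Prod>i\<in>{1..<k}. y (2 * i))"
      using j k by (cases k) (auto simp: prod.nat_ivl_Suc' atLeastLessThanSuc_atLeastAtMost)
    finally have "0 \<le> y j * (\<Prod>i\<in>{1..<k}. y (2 * i))" .
    moreover have "0 < (\<Prod>i\<in>{1..<k}. y (2 * i))"
    proof (rule prod_pos)
      fix i assume "i \<in> {1..<k}"
      then show "0 < y (2 * i)" using dom[of "2 * i"] k by (auto simp: RealLine)
    qed
    ultimately show ?thesis using True
      unfolding closure_coord_domain by (simp add: RealLine zero_le_mult_iff)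
  qed (auto simp: RealLine)
qed

text \<open>Open domain from inside, closed domain from outside: this sandwich determines the
  infimum and supremum of the possible next moments, whether or not the endpoints are
  attained.\<close>

lemma next_moments_coord:
  assumes j: "1 \<le> j"
    and dom: "\<And>i. 1 \<le> i \<Longrightarrow> i < j \<Longrightarrow> y i \<in> coord_domain E i"
    and m: "\<And>i. 1 \<le> i \<Longrightarrow> i < j \<Longrightarrow> m i = coord_moment E y i"
  shows "(\<lambda>t. coord_moment E (trunc j y) j + fiber_scale E y j * t) ` coord_domain E j \<subseteq> next_moments E m j"
    and "next_moments E m j \<subseteq>
      (\<lambda>t. coord_moment E (trunc j y) j + fiber_scale E y j * t) ` closure (coord_domain E j)"
proof -
  have aff: "coord_moment E (y(j := t)) j = coord_moment E (trunc j y) j + fiber_scale E y j * t" for t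
  proof -
    have "trunc j (y(j := t)) = trunc j y" by (auto simp: trunc_def)
    moreover have "fiber_scale E (y(j := t)) j = fiber_scale E y j" by (rule fiber_scale_cong) auto
    ultimately show ?thesis using coord_moment_affine[OF j, of E "y(j := t)"] by simp
  qed
  have low: "coord_moment E (y(j := t)) i = coord_moment E y i" if "i < j" for t i
    by (rule coord_moment_cong) (use that in auto)
  show "(\<lambda>t. coord_moment E (trunc j y) j + fiber_scale E y j * t) ` coord_domain E j \<subseteq> next_moments E m j"
  proof clarify
    fix t assume t: "t \<in> coord_domain E j"
    have "(y(j := t)) i \<in> coord_domain E i" if "1 \<le> i" "i \<le> j" for i
      using dom[of i] t that by (cases "i = j") auto
    then obtain \<mu> where \<mu>: "\<mu> \<in> prob_measures E"
      and mom: "\<And>i. i \<le> j \<Longrightarrow> moment \<mu> i = coord_moment E (y(j := t)) i"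
      using ex_measure_coord_moment[of j "y(j := t)" E] by blast
    have "moment \<mu> i = m i" if "i \<in> {1..<j}" for i
      using mom[of i] low[of i t] m[of i] that by simp
    moreover have "coord_moment E (trunc j y) j + fiber_scale E y j * t = moment \<mu> j"
      using mom[of j] aff by simp
    ultimately show "coord_moment E (trunc j y) j + fiber_scale E y j * t \<in> next_moments E m j"
      unfolding next_moments_def using \<mu> by blast
  qed
  show "next_moments E m j \<subseteq>
      (\<lambda>t. coord_moment E (trunc j y) j + fiber_scale E y j * t) ` closure (coord_domain E j)"
  proof
    fix x assume "x \<in> next_moments E m j"
    then obtain \<mu> where \<mu>: "\<mu> \<in> prob_measures E" "x = moment \<mu> j"
      "\<forall>i\<in>{1..<j}. moment \<mu> i = m i" by (auto simp: next_moments_def)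
    have sc: "fiber_scale E y j > 0" using dom by (rule fiber_scale_pos)
    define t where "t = (x - coord_moment E (trunc j y) j) / fiber_scale E y j"
    have x: "x = coord_moment E (trunc j y) j + fiber_scale E y j * t"
      using sc by (simp add: t_def)
    have "moment \<mu> i = coord_moment E (y(j := t)) i" if "1 \<le> i" "i \<le> j" for i
      using \<mu> m[of i] low[of i t] aff[of t] x that by (cases "i = j") auto
    then have "(y(j := t)) j \<in> closure (coord_domain E j)"
      using coord_in_closure[OF \<mu>(1) j, of "y(j := t)"] dom by simp
    then show "x \<in> (\<lambda>t. coord_moment E (trunc j y) j + fiber_scale E y j * t) ` closure (coord_domain E j)"
      using x by auto
  qed
qed

section \<open>Agreement with the coordinates defined by extremal moments\<close>

lemma Inf_eq_left_endpoint:
  fixes a b :: real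
  assumes "{a<..<b} \<subseteq> X" "X \<subseteq> {a..}" "a < b"
  shows "Inf X = a"
proof (rule cInf_eq)
  fix t assume t: "\<And>x. x \<in> X \<Longrightarrow> t \<le> x"
  show "t \<le> a"
  proof (rule dense_ge_bounded[OF assms(3)])
    fix w assume "a < w" "w < b"
    then show "t \<le> w" using assms(1) by (intro t) auto
  qed
qed (use assms in auto)

lemma Sup_eq_right_endpoint:
  fixes a b :: real
  assumes "{a<..<b} \<subseteq> X" "X \<subseteq> {..b}" "a < b"
  shows "Sup X = b"
proof (rule cSup_eq)
  fix t assume t: "\<And>x. x \<in> X \<Longrightarrow> x \<le> t"
  show "b \<le> t"
  proof (rule dense_le_bounded[OF assms(3)])
    fix w assume "a < w" "w < b"
    then show "w \<le> t" using assms(1) by (intro t) auto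
  qed
qed (use assms in auto)

lemma affine_image_interval:
  fixes a b c d :: real
  assumes "0 < b"
  shows "(\<lambda>t. a + b * t) ` {c<..<d} = {a + b * c<..<a + b * d}"
proof
  show "{a + b * c<..<a + b * d} \<subseteq> (\<lambda>t. a + b * t) ` {c<..<d}"
  proof
    fix x assume "x \<in> {a + b * c<..<a + b * d}"
    then show "x \<in> (\<lambda>t. a + b * t) ` {c<..<d}"
      using assms by (intro image_eqI[where x = "(x - a) / b"]) (auto simp: field_simps)
  qed
qed (use assms in auto)

lemma lower_moment_coord:
  assumes "E \<noteq> RealLine" "1 \<le> j"
    and "\<And>i. 1 \<le> i \<Longrightarrow> i < j \<Longrightarrow> y i \<in> coord_domain E i"
    and "\<And>i. 1 \<le> i \<Longrightarrow> i < j \<Longrightarrow> m i = coord_moment E y i"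
  shows "lower_moment E m j = coord_moment E (trunc j y) j"
proof -
  let ?f = "\<lambda>t. coord_moment E (trunc j y) j + fiber_scale E y j * t"
  have sc: "fiber_scale E y j > 0" using assms(3) by (rule fiber_scale_pos)
  have "{0<..<1} \<subseteq> coord_domain E j" using assms(1) by (cases E) auto
  then have "?f ` {0<..<1} \<subseteq> next_moments E m j"
    using next_moments_coord(1)[OF assms(2-4)] by blast
  moreover have "closure (coord_domain E j) \<subseteq> {0..}"
    using assms(1) by (cases E) auto
  then have "?f ` closure (coord_domain E j) \<subseteq> {?f 0..}" using sc by auto
  then have "next_moments E m j \<subseteq> {?f 0..}"
    using next_moments_coord(2)[OF assms(2-4)] by (rule order_trans[rotated])
  ultimately show ?thesis
    unfolding lower_moment_def affine_image_interval[OF sc] using sc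
    by (intro Inf_eq_left_endpoint[of _ "?f 1"]) auto
qed

lemma upper_moment_coord:
  assumes "1 \<le> j"
    and "\<And>i. 1 \<le> i \<Longrightarrow> i < j \<Longrightarrow> y i \<in> coord_domain UnitInterval i"
    and "\<And>i. 1 \<le> i \<Longrightarrow> i < j \<Longrightarrow> m i = coord_moment UnitInterval y i"
  shows "upper_moment UnitInterval m j
    = coord_moment UnitInterval (trunc j y) j + fiber_scale UnitInterval y j"
proof -
  let ?f = "\<lambda>t. coord_moment UnitInterval (trunc j y) j + fiber_scale UnitInterval y j * t"
  have sc: "fiber_scale UnitInterval y j > 0" using assms(2) by (rule fiber_scale_pos)
  have "?f ` {0<..<1} \<subseteq> next_moments UnitInterval m j"
    using next_moments_coord(1)[OF assms] by simp
  moreover have "?f ` closure (coord_domain UnitInterval j) \<subseteq> {..?f 1}" using sc by auto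
  then have "next_moments UnitInterval m j \<subseteq> {..?f 1}"
    using next_moments_coord(2)[OF assms] by (rule order_trans[rotated])
  ultimately have "Sup (next_moments UnitInterval m j) = ?f 1"
    unfolding affine_image_interval[OF sc] using sc
    by (intro Sup_eq_right_endpoint[of "?f 0"]) auto
  then show ?thesis by (simp add: upper_moment_def)
qed

lemma coord_unit_eq:
  assumes "1 \<le> j" "j \<le> n"
    and dom: "\<And>i. 1 \<le> i \<Longrightarrow> i \<le> n \<Longrightarrow> y i \<in> coord_domain UnitInterval i"
    and m: "\<And>i. 1 \<le> i \<Longrightarrow> i \<le> n \<Longrightarrow> m i = coord_moment UnitInterval y i"
  shows "coord_unit m j = y j"
proof -
  have "fiber_scale UnitInterval y j > 0" using dom assms(2) by (intro fiber_scale_pos) auto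
  moreover have "lower_moment UnitInterval m j = coord_moment UnitInterval (trunc j y) j"
    by (rule lower_moment_coord) (use assms in auto)
  moreover have "upper_moment UnitInterval m j
      = coord_moment UnitInterval (trunc j y) j + fiber_scale UnitInterval y j"
    by (rule upper_moment_coord) (use assms in auto)
  ultimately show ?thesis
    using coord_moment_affine[OF assms(1), of UnitInterval y] m[OF assms(1,2)]
    by (simp add: coord_unit_def del: coord_moment.simps)
qed

text \<open>The gap between m_r and its minimal value is the product z_1 ... z_r, so the quotient of
  consecutive gaps is z_j.\<close>

lemma coord_half_eq:
  assumes "1 \<le> j" "j \<le> n"
    and dom: "\<And>i. 1 \<le> i \<Longrightarrow> i \<le> n \<Longrightarrow> y i \<in> coord_domain HalfLine i"
    and m: "\<And>i. 1 \<le> i \<Longrightarrow> i \<le> n \<Longrightarrow> m i = coord_moment HalfLine y i"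
  shows "coord_half m j = y j"
proof -
  have gap: "m r - lower_moment HalfLine m r = fiber_scale HalfLine y r * y r" if "1 \<le> r" "r \<le> j" for r
  proof -
    have "lower_moment HalfLine m r = coord_moment HalfLine (trunc r y) r"
      by (rule lower_moment_coord) (use assms that in auto)
    then show ?thesis
      using coord_moment_affine[OF that(1), of HalfLine y] m[of r] that assms(2)
      by (simp del: coord_moment.simps)
  qed
  have "fiber_scale HalfLine y j > 0" using dom assms(2) by (intro fiber_scale_pos) auto
  moreover have "fiber_scale HalfLine y j = fiber_scale HalfLine y (j - 1) * y (j - 1)" if "j \<noteq> 1"
    using fiber_scale_Suc[of "j - 1" HalfLine y] that assms(1) by simp
  ultimately show ?thesis
    using gap[of j] gap[of "j - 1"] assms(1) by (cases "j = 1") (auto simp: coord_half_def)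
qed

section \<open>Recurrence coefficients of a measure on the real line\<close>

context
  fixes \<mu> :: "real measure" and y :: "nat \<Rightarrow> real" and n :: nat
  assumes \<mu>: "\<mu> \<in> prob_measures RealLine"
    and mom: "\<And>i. 1 \<le> i \<Longrightarrow> i \<le> n \<Longrightarrow> moment \<mu> i = mom y i"
    and pos: "\<And>i. 1 \<le> i \<Longrightarrow> 2 * i \<le> n \<Longrightarrow> 0 < y (2 * i)"
begin

lemma integral_poly_mult:
  assumes "degree p + degree q \<le> n"
  shows "(\<integral>x. poly p x * poly q x \<partial>\<mu>) = moment_functional (mom y) (p * q)"
proof -
  have "(\<integral>x. poly p x * poly q x \<partial>\<mu>) = moment_functional (moment \<mu>) (p * q)"
    using integral_poly[OF \<mu>, of "p * q"] by simp
  also have "\<dots> = moment_functional (mom y) (p * q)"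
  proof (rule moment_functional_cong)
    fix i assume "i \<le> degree (p * q)"
    then have "i \<le> n" using degree_mult_le[of p q] assms by simp
    then show "moment \<mu> i = mom y i"
      using mom[of i] moment_0[OF \<mu>] by (cases "i = 0") auto
  qed
  finally show ?thesis .
qed

text \<open>Orthogonality to lower degrees involves moments up to 2 * k - 1 only, hence the bound on
  k. Two monic candidates differ by a polynomial of degree below k that is orthogonal to itself, so
  positivity of squares makes the difference zero.\<close>

lemma monic_orth_poly_eq:
  assumes k: "2 * k \<le> n + 1"
  shows "monic_orth_poly \<mu> k = orth y k"
  unfolding monic_orth_poly_def
proof (rule the_equality)
  have orth: "(\<integral>x. poly (orth y k) x * poly Q x \<partial>\<mu>) = 0" if "degree Q < k" for Q
    using integral_poly_mult[of "orth y k" Q] moment_functional_orth_mult[of Q k y] that k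
    by (simp add: coeff_eq_0)
  then show "degree (orth y k) = k \<and> lead_coeff (orth y k) = 1 \<and>
      (\<forall>Q. degree Q < k \<longrightarrow> (\<integral>x. poly (orth y k) x * poly Q x \<partial>\<mu>) = 0)" by simp
  fix P assume P: "degree P = k \<and> lead_coeff P = 1 \<and>
      (\<forall>Q. degree Q < k \<longrightarrow> (\<integral>x. poly P x * poly Q x \<partial>\<mu>) = 0)"
  define d where "d = P - orth y k"
  show "P = orth y k"
  proof (rule ccontr)
    assume "P \<noteq> orth y k"
    then have dnz: "d \<noteq> 0" by (simp add: d_def)
    have "degree d \<le> k" unfolding d_def using P by (intro degree_diff_le) auto
    moreover have "coeff d k = 0" using P by (auto simp: d_def)
    ultimately have dk: "degree d < k"
      using dnz by (metis leading_coeff_0_iff order_le_less)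
    have L: "moment_functional (mom y) (P * d) = 0" "moment_functional (mom y) (orth y k * d) = 0"
      using integral_poly_mult[of P d] integral_poly_mult[of "orth y k" d] P orth[OF dk] dk k by auto
    have "moment_functional (mom y) (d * d) = 0"
      using L moment_functional_diff[of "mom y" "P * d" "orth y k * d"] by (simp add: d_def algebra_simps)
    moreover have "0 < moment_functional (mom y) (d * d)"
      by (rule moment_functional_square_pos[of "k - 1"]) (use pos dnz dk k in auto)
    ultimately show False by simp
  qed
qed

text \<open>For k = 1 the last term is zero and leaves b free. Otherwise two valid pairs equate a
  multiple of P_(k-1) with a multiple of P_(k-2), and comparison of degrees makes both multiples
  vanish.\<close>

lemma recurrence_iff:
  assumes "1 \<le> k" "2 * k \<le> n + 1"
  shows "recurrence \<mu> k a b \<longleftrightarrow> a = y (2 * k - 1) \<and> (k = 1 \<or> b = y (2 * k - 2))"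
proof -
  have eqs: "monic_orth_poly \<mu> k = orth y k" "monic_orth_poly \<mu> (k - 1) = orth y (k - 1)"
    "monic_orth_poly \<mu> (k - 2) = orth y (k - 2)"
    using assms by (auto intro: monic_orth_poly_eq)
  show ?thesis
  proof (cases "k = 1")
    case True
    then show ?thesis using eqs by (auto simp: recurrence_def)
  next
    case False
    then have "k = Suc (Suc (k - 2))" using assms(1) by simp
    then obtain r where r: "k = Suc (Suc r)" by blast
    let ?P = "orth y (Suc r)" and ?Q = "orth y r"
    have "recurrence \<mu> k a b \<longleftrightarrow> [:- y (2 * r + 3), 1:] * ?P - smult (y (2 * r + 2)) ?Q
        = [:- a, 1:] * ?P - smult b ?Q"
      using eqs by (simp add: recurrence_def r orth.simps(3))
    also have "\<dots> \<longleftrightarrow> smult (a - y (2 * r + 3)) ?P = smult (y (2 * r + 2) - b) ?Q"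
    proof -
      have "A - u - q = A - v - s \<longleftrightarrow> v - u = q - s" for A u v q s :: "real poly"
        by (auto simp: algebra_simps)
      moreover have "[:- e, 1:] * ?P = [:0, 1:] * ?P - smult e ?P" for e
        by simp
      ultimately show ?thesis by (simp only: smult_diff_left)
    qed
    also have "\<dots> \<longleftrightarrow> a = y (2 * r + 3) \<and> b = y (2 * r + 2)"
    proof
      assume *: "smult (a - y (2 * r + 3)) ?P = smult (y (2 * r + 2) - b) ?Q"
      have "coeff (smult (a - y (2 * r + 3)) ?P) (Suc r) = 0"
        unfolding * by (simp add: coeff_eq_0)
      then have a: "a = y (2 * r + 3)" by simp
      then have "coeff (smult (y (2 * r + 2) - b) ?Q) r = 0"
        using * by simp
      then show "a = y (2 * r + 3) \<and> b = y (2 * r + 2)" using a by simp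
    qed auto
    finally show ?thesis by (simp add: r numeral_3_eq_3)
  qed
qed

lemma rec_alpha_eq: "1 \<le> k \<Longrightarrow> 2 * k \<le> n + 1 \<Longrightarrow> rec_alpha \<mu> k = y (2 * k - 1)"
  unfolding rec_alpha_def by (rule the_equality) (auto simp: recurrence_iff)

lemma rec_beta_eq: "1 \<le> k \<Longrightarrow> 2 * k \<le> n - 1 \<Longrightarrow> rec_beta \<mu> k = y (2 * k)"
  unfolding rec_beta_def by (rule the_equality) (auto simp: recurrence_iff)

end

lemma coord_line_eq:
  assumes j: "1 \<le> j" "j \<le> n"
    and dom: "\<And>i. 1 \<le> i \<Longrightarrow> i \<le> n \<Longrightarrow> y i \<in> coord_domain RealLine i"
    and m: "\<And>i. 1 \<le> i \<Longrightarrow> i \<le> n \<Longrightarrow> m i = coord_moment RealLine y i"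
  shows "coord_line n m j = y j"
proof -
  define \<mu> where "\<mu> = (SOME \<mu>. \<mu> \<in> prob_measures RealLine \<and> (\<forall>i\<in>{1..n}. moment \<mu> i = m i))"
  have "\<exists>\<mu>. \<mu> \<in> prob_measures RealLine \<and> (\<forall>i\<in>{1..n}. moment \<mu> i = m i)"
    using ex_measure_coord_moment[of n y RealLine] dom m by auto
  then have "\<mu> \<in> prob_measures RealLine \<and> (\<forall>i\<in>{1..n}. moment \<mu> i = m i)"
    unfolding \<mu>_def by (rule someI_ex)
  then have \<mu>: "\<mu> \<in> prob_measures RealLine" and mom: "\<And>i. 1 \<le> i \<Longrightarrow> i \<le> n \<Longrightarrow> moment \<mu> i = mom y i"
    using m by auto
  have pos: "0 < y (2 * i)" if "1 \<le> i" "2 * i \<le> n" for i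
    using dom[of "2 * i"] that by simp
  show ?thesis
  proof (cases "odd j")
    case True
    then obtain r where r: "j = 2 * r + 1" by (elim oddE)
    have "rec_alpha \<mu> (r + 1) = y (2 * (r + 1) - 1)"
      by (rule rec_alpha_eq[OF \<mu> mom pos]) (use j r in auto)
    then show ?thesis by (simp add: coord_line_def \<mu>_def r)
  next
    case False
    then obtain r where r: "j = 2 * r" by auto
    text \<open>\<open>rec_beta\<close> involves the orthogonal polynomial of degree \<open>r + 1\<close> and thus one more
      moment, which \<open>\<mu>\<close> itself provides.\<close>
    define t where "t = (moment \<mu> (j + 1) - mom (trunc (j + 1) y) (j + 1)) / fiber_scale RealLine y (j + 1)"
    define y' where "y' = y(j + 1 := t)"
    have "fiber_scale RealLine y (j + 1) > 0"
      using dom j by (intro fiber_scale_pos) auto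
    moreover have "fiber_scale RealLine y' (j + 1) = fiber_scale RealLine y (j + 1)" "trunc (j + 1) y' = trunc (j + 1) y"
      by (auto simp: y'_def trunc_def intro: fiber_scale_cong)
    ultimately have new: "mom y' (j + 1) = moment \<mu> (j + 1)"
      using coord_moment_affine[of "j + 1" RealLine y'] by (simp add: y'_def t_def)
    have "rec_beta \<mu> r = y' (2 * r)"
    proof (rule rec_beta_eq[OF \<mu>, of "j + 1" y'])
      fix i assume i: "1 \<le> i" "i \<le> j + 1"
      show "moment \<mu> i = mom y' i"
      proof (cases "i = j + 1")
        case False
        then have "mom y' i = mom y i" using i by (intro mom_cong) (auto simp: y'_def)
        then show ?thesis using mom i False j by simp
      qed (use new in simp)
    next
      fix i assume "1 \<le> i" "2 * i \<le> j + 1"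
      moreover from this have "2 * i \<le> j" using r by presburger
      ultimately show "0 < y' (2 * i)" using pos[of i] j by (auto simp: y'_def)
    qed (use j r in auto)
    then show ?thesis using False by (simp add: coord_line_def \<mu>_def r y'_def)
  qed
qed

lemma canonical_coord_eq:
  assumes "1 \<le> j" "j \<le> n"
    and "\<And>i. 1 \<le> i \<Longrightarrow> i \<le> n \<Longrightarrow> y i \<in> coord_domain E i"
    and "\<And>i. 1 \<le> i \<Longrightarrow> i \<le> n \<Longrightarrow> m i = coord_moment E y i"
  shows "canonical_coord E n m j = y j"
  using assms coord_unit_eq[of j n y m] coord_half_eq[of j n y m] coord_line_eq[of j n y m]
  by (cases E) auto

section \<open>The interior of the moment space\<close>

text \<open>Solves the affine relation index by index. The function is total, so off the interior
  its values carry meaning only as long as the earlier ones lie in their domains. The guard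
  \<open>i < j\<close> is spelled out in the equation so that termination can use it;
  \<open>coord_of_rec\<close> restores the form with \<open>trunc\<close>.\<close>

function coord_of :: "support \<Rightarrow> (nat \<Rightarrow> real) \<Rightarrow> nat \<Rightarrow> real" where
  "coord_of E m j =
     (m j - coord_moment E (\<lambda>i. if 1 \<le> i \<and> i < j then coord_of E m i else 0) j)
       / fiber_scale E (\<lambda>i. if 1 \<le> i \<and> i < j then coord_of E m i else 0) j"
  by pat_completeness auto
termination by (relation "Wellfounded.measure (\<lambda>(E, m, j). j)") auto

declare coord_of.simps [simp del]

lemma coord_of_rec:
  "coord_of E m j = (m j - coord_moment E (trunc j (coord_of E m)) j) / fiber_scale E (coord_of E m) j"
proof -
  have "fiber_scale E (trunc j (coord_of E m)) j = fiber_scale E (coord_of E m) j"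
    by (rule fiber_scale_cong) (auto simp: trunc_def)
  then show ?thesis
    using coord_of.simps[of E m j] by (simp add: trunc_def)
qed

lemma coord_of_cong:
  "(\<And>i. 1 \<le> i \<Longrightarrow> i \<le> j \<Longrightarrow> m i = m' i) \<Longrightarrow> 1 \<le> j \<Longrightarrow> coord_of E m j = coord_of E m' j"
proof (induction j rule: less_induct)
  case (less j)
  have "coord_of E m i = coord_of E m' i" if "1 \<le> i" "i < j" for i
    by (rule less.IH) (use that less.prems in auto)
  then have "trunc j (coord_of E m) = trunc j (coord_of E m')"
      "fiber_scale E (coord_of E m) j = fiber_scale E (coord_of E m') j"
    by (auto simp: trunc_def intro: fiber_scale_cong)
  then show ?case
    using less.prems by (simp add: coord_of_rec[of E m j] coord_of_rec[of E m' j])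
qed

lemma coord_moment_coord_of:
  assumes "1 \<le> j" "\<And>i. 1 \<le> i \<Longrightarrow> i < j \<Longrightarrow> coord_of E m i \<in> coord_domain E i"
  shows "coord_moment E (coord_of E m) j = m j"
proof -
  have "fiber_scale E (coord_of E m) j > 0" using assms(2) by (rule fiber_scale_pos)
  then show ?thesis
    using coord_moment_affine[OF assms(1), of E "coord_of E m"] coord_of_rec[of E m j] by simp
qed

lemma coord_of_eqI:
  "(\<And>i. 1 \<le> i \<Longrightarrow> i \<le> j \<Longrightarrow> y i \<in> coord_domain E i) \<Longrightarrow>
   (\<And>i. 1 \<le> i \<Longrightarrow> i \<le> j \<Longrightarrow> m i = coord_moment E y i) \<Longrightarrow> 1 \<le> j \<Longrightarrow> coord_of E m j = y j"
proof (induction j rule: less_induct)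
  case (less j)
  have "coord_of E m i = y i" if "1 \<le> i" "i < j" for i
    by (rule less.IH) (use that less.prems in auto)
  then have "trunc j (coord_of E m) = trunc j y" "fiber_scale E (coord_of E m) j = fiber_scale E y j"
    by (auto simp: trunc_def intro: fiber_scale_cong)
  moreover have "fiber_scale E y j > 0" using less.prems(1) by (intro fiber_scale_pos) auto
  ultimately show ?case
    using less.prems(2)[of j] less.prems(3) coord_moment_affine[of j E y]
    by (simp add: coord_of_rec[of E m j])
qed

text \<open>A cylinder in the space of all sequences, so that openness, continuity and measurability
  can be treated in the topology of the function type; its extensional members form the interior of
  the moment space.\<close>

definition coord_set :: "support \<Rightarrow> nat \<Rightarrow> (nat \<Rightarrow> real) set" where
  "coord_set E n = {m. \<forall>j\<in>{1..n}. coord_of E m j \<in> coord_domain E j}"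

lemma coord_set_Suc:
  "coord_set E (Suc n) = coord_set E n \<inter> {m. coord_of E m (Suc n) \<in> coord_domain E (Suc n)}"
  unfolding coord_set_def by (auto simp: atLeastAtMostSuc_conv)

lemma coord_set_cong: "(\<And>i. 1 \<le> i \<Longrightarrow> i \<le> n \<Longrightarrow> m i = m' i) \<Longrightarrow> m \<in> coord_set E n \<longleftrightarrow> m' \<in> coord_set E n"
  unfolding coord_set_def using coord_of_cong[of _ m m' E] by auto

lemma continuous_on_slope: "continuous_on S (slope E j)"
  by (cases E; cases "odd j") (auto intro!: continuous_intros)

lemma continuous_on_fiber_scale:
  fixes F :: "'a::topological_space \<Rightarrow> nat \<Rightarrow> real"
  assumes "\<And>i. 1 \<le> i \<Longrightarrow> i < j \<Longrightarrow> continuous_on S (\<lambda>x. F x i)"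
  shows "continuous_on S (\<lambda>x. fiber_scale E (F x) j)"
  unfolding fiber_scale_def
proof (rule continuous_on_prod)
  fix i assume "i \<in> {1..<j}"
  then show "continuous_on S (\<lambda>x. slope E i (F x i))"
    using assms[of i] by (intro continuous_on_compose2[OF continuous_on_slope[of UNIV]]) auto
qed

lemma open_coord_domain: "open (coord_domain E j)"
  by (cases E) auto

lemma continuous_on_coord_apply: "continuous_on S (\<lambda>m :: nat \<Rightarrow> real. m i)"
  by (rule continuous_on_subset[OF continuous_on_product_coordinates]) simp

lemma continuous_on_coord_of_step:
  assumes "\<And>j. j \<in> {1..n} \<Longrightarrow> continuous_on (coord_set E n) (\<lambda>m. coord_of E m j)"
  shows "continuous_on (coord_set E n) (\<lambda>m. coord_of E m (Suc n))"
proof -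
  have "continuous_on (coord_set E n) (\<lambda>m. coord_moment E (trunc (Suc n) (coord_of E m)) (Suc n))"
  proof (rule continuous_on_coord_moment)
    show "continuous_on (coord_set E n) (\<lambda>m. trunc (Suc n) (coord_of E m) i)" for i
      using assms[of i] by (cases "1 \<le> i \<and> i < Suc n") (auto simp: trunc_def)
  qed
  moreover have "continuous_on (coord_set E n) (\<lambda>m. fiber_scale E (coord_of E m) (Suc n))"
    using assms by (intro continuous_on_fiber_scale) auto
  moreover have "fiber_scale E (coord_of E m) (Suc n) \<noteq> 0" if "m \<in> coord_set E n" for m
    using fiber_scale_pos[of "Suc n" "coord_of E m" E] that by (auto simp: coord_set_def)
  ultimately show ?thesis
    unfolding coord_of_rec[of E _ "Suc n"]
    by (intro continuous_on_divide continuous_on_diff continuous_on_coord_apply) auto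
qed

text \<open>The two claims support each other: where the first n coordinates lie in their domains
  the scale is nonzero and the next coordinate is continuous, and the next set is the preimage of an
  open domain under it.\<close>

lemma open_coord_set_and_continuous:
  "open (coord_set E n) \<and> (\<forall>j\<in>{1..n}. continuous_on (coord_set E n) (\<lambda>m. coord_of E m j))"
proof (induction n)
  case 0
  then show ?case by (simp add: coord_set_def)
next
  case (Suc n)
  then have IH: "open (coord_set E n)"
    "\<And>j. j \<in> {1..n} \<Longrightarrow> continuous_on (coord_set E n) (\<lambda>m. coord_of E m j)" by auto
  have step: "continuous_on (coord_set E n) (\<lambda>m. coord_of E m (Suc n))"
    using IH(2) by (rule continuous_on_coord_of_step)
  have "open ((\<lambda>m. coord_of E m (Suc n)) -` coord_domain E (Suc n) \<inter> coord_set E n)"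
    using continuous_on_open_vimage[OF IH(1)] step open_coord_domain by blast
  moreover have "(\<lambda>m. coord_of E m (Suc n)) -` coord_domain E (Suc n) \<inter> coord_set E n = coord_set E (Suc n)"
    by (auto simp: coord_set_Suc)
  moreover have "continuous_on (coord_set E (Suc n)) (\<lambda>m. coord_of E m j)" if "j \<in> {1..Suc n}" for j
    using that IH(2)[of j] step
    by (cases "j = Suc n") (auto intro: continuous_on_subset simp: coord_set_Suc)
  ultimately show ?case by auto
qed

lemma open_coord_set: "open (coord_set E n)"
  and continuous_on_coord_of: "j \<in> {1..n} \<Longrightarrow> continuous_on (coord_set E n) (\<lambda>m. coord_of E m j)"
  using open_coord_set_and_continuous by auto

section \<open>Transfer between R^n and the space of all real sequences\<close>

lemma topspace_Rtop [simp]: "topspace (Rtop n) = PiE {1..n} (\<lambda>_. UNIV)"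
  by (simp add: Rtop_def)

lemma continuous_map_Rtop_id: "continuous_map (Rtop n) euclidean (\<lambda>m. m)"
proof -
  have "continuous_map (Rtop n) euclideanreal (\<lambda>m. m k)" for k
  proof (cases "k \<in> {1..n}")
    case True
    then show ?thesis unfolding Rtop_def by (rule continuous_map_product_projection)
  next
    case False
    have "continuous_map (Rtop n) euclideanreal (\<lambda>m. undefined)" by simp
    then show ?thesis
      by (rule continuous_map_eq) (use False in \<open>auto simp: PiE_def extensional_def\<close>)
  qed
  then show ?thesis
    unfolding euclidean_product_topology[symmetric] continuous_map_componentwise_UNIV by blast
qed

lemma continuous_map_restrict_Rtop: "continuous_map euclidean (Rtop n) (\<lambda>m. restrict m {1..n})"
  unfolding Rtop_def continuous_map_componentwise
  by (auto simp: continuous_on_coord_apply)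

lemma openin_Rtop_Int_open:
  assumes "open S"
  shows "openin (Rtop n) (PiE {1..n} (\<lambda>_. UNIV) \<inter> S)"
proof -
  have "openin (Rtop n) {m \<in> topspace (Rtop n). m \<in> S}"
    by (rule openin_continuous_map_preimage[OF continuous_map_Rtop_id]) (use assms in simp)
  moreover have "{m \<in> topspace (Rtop n). m \<in> S} = PiE {1..n} (\<lambda>_. UNIV) \<inter> S" by auto
  ultimately show ?thesis by simp
qed

lemma open_restrict_vimage:
  assumes "openin (Rtop n) U"
  shows "open {m. restrict m {1..n} \<in> U}"
  using openin_continuous_map_preimage[OF continuous_map_restrict_Rtop assms] by simp

lemma moment_vec_eqI:
  assumes "m \<in> PiE {1..n} (\<lambda>_. UNIV)" "\<And>j. j \<in> {1..n} \<Longrightarrow> moment \<mu> j = m j"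
  shows "moment_vec n \<mu> = m"
  unfolding moment_vec_def by (rule extensionalityI[of _ "{1..n}"]) (use assms in \<open>auto simp: PiE_def\<close>)

lemma interior_closure_coord_domain: "interior (closure (coord_domain E j)) = coord_domain E j"
  by (cases E) auto

text \<open>One inclusion holds because the coordinate set is open and quadrature realizes it. For
  the other, the j-th moment of an interior point is varied alone: all nearby values are still
  moments, so an open interval of coordinates lies in the closed domain, and the interior of the
  closed domain is the open one.\<close>

lemma int_moment_space_coord_set:
  "int_moment_space E n = PiE {1..n} (\<lambda>_. UNIV) \<inter> coord_set E n"
proof
  show "PiE {1..n} (\<lambda>_. UNIV) \<inter> coord_set E n \<subseteq> int_moment_space E n"
    unfolding int_moment_space_def
  proof (rule interior_of_maximal)
    show "PiE {1..n} (\<lambda>_. UNIV) \<inter> coord_set E n \<subseteq> moment_space E n"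
    proof
      fix m assume m: "m \<in> PiE {1..n} (\<lambda>_. UNIV) \<inter> coord_set E n"
      then have dom: "coord_of E m i \<in> coord_domain E i" if "1 \<le> i" "i \<le> n" for i
        using that by (auto simp: coord_set_def)
      then obtain \<mu> where "\<mu> \<in> prob_measures E" "\<forall>j\<le>n. moment \<mu> j = coord_moment E (coord_of E m) j"
        using ex_measure_coord_moment[of n "coord_of E m" E] by blast
      moreover have "coord_moment E (coord_of E m) j = m j" if "j \<in> {1..n}" for j
        using that dom by (intro coord_moment_coord_of) auto
      ultimately have "moment_vec n \<mu> = m" using m by (intro moment_vec_eqI) auto
      then show "m \<in> moment_space E n"
        unfolding moment_space_def using \<open>\<mu> \<in> prob_measures E\<close> by blast
    qed
  qed (rule openin_Rtop_Int_open[OF open_coord_set])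
  show "int_moment_space E n \<subseteq> PiE {1..n} (\<lambda>_. UNIV) \<inter> coord_set E n"
  proof
    fix m assume "m \<in> int_moment_space E n"
    then obtain U where U: "openin (Rtop n) U" "m \<in> U" "U \<subseteq> moment_space E n"
      unfolding int_moment_space_def by (auto simp: interior_of_def)
    have ext: "m \<in> PiE {1..n} (\<lambda>_. UNIV)" using openin_subset[OF U(1)] U(2) by auto
    have "coord_of E m j \<in> coord_domain E j" if "j \<in> {1..n}" for j
      using that
    proof (induction j rule: less_induct)
      case (less j)
      \<comment> \<open>Changing entry j keeps the earlier coordinates, so on \<open>T\<close> the
        j-th coordinate is an increasing affine function of t.\<close>
      define T where "T = {t. restrict (m(j := t)) {1..n} \<in> U}"
      have cont: "continuous_on UNIV (\<lambda>t. m(j := t))"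
      proof (rule continuous_on_coordinatewise_then_product)
        show "continuous_on UNIV (\<lambda>t. (m(j := t)) i)" for i
          by (cases "i = j") auto
      qed
      have "open ((\<lambda>t. m(j := t)) -` {m. restrict m {1..n} \<in> U})"
        using continuous_open_vimage[OF open_restrict_vimage[OF U(1)]] cont
        by (auto simp: continuous_on_eq_continuous_at)
      moreover have "(\<lambda>t. m(j := t)) -` {m. restrict m {1..n} \<in> U} = T" by (auto simp: T_def)
      ultimately have T: "open T" by simp
      have mT: "m j \<in> T"
        using U(2) ext by (simp add: T_def PiE_restrict)
      let ?A = "coord_moment E (trunc j (coord_of E m)) j" and ?B = "fiber_scale E (coord_of E m) j"
      have B: "?B > 0" using less by (intro fiber_scale_pos) auto
      have cl: "(t - ?A) / ?B \<in> closure (coord_domain E j)" if tT: "t \<in> T" for t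
      proof -
        obtain \<mu> where \<mu>: "\<mu> \<in> prob_measures E" "restrict (m(j := t)) {1..n} = moment_vec n \<mu>"
          using tT U(3) unfolding T_def moment_space_def by blast
        have mom: "moment \<mu> i = (m(j := t)) i" if "i \<in> {1..n}" for i
          using fun_cong[OF \<mu>(2), of i] that by (simp add: moment_vec_def)
        let ?y = "coord_of E (m(j := t))"
        have same: "?y i = coord_of E m i" if "1 \<le> i" "i < j" for i
          by (rule coord_of_cong) (use that in auto)
        then have dom: "?y i \<in> coord_domain E i" if "1 \<le> i" "i < j" for i
          using less that by auto
        have "moment \<mu> i = coord_moment E ?y i" if "1 \<le> i" "i \<le> j" for i
          using coord_moment_coord_of[of i E "m(j := t)"] mom[of i] dom that less.prems by auto
        then have "?y j \<in> closure (coord_domain E j)"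
          using coord_in_closure[OF \<mu>(1), of j ?y] less.prems dom by auto
        moreover have "trunc j ?y = trunc j (coord_of E m)" "fiber_scale E ?y j = ?B"
          using same by (auto simp: trunc_def intro: fiber_scale_cong)
        ultimately show ?thesis by (simp add: coord_of_rec[of E _ j])
      qed
      have "open ((\<lambda>s. ?A + ?B * s) -` T)"
        by (rule continuous_open_vimage[OF T]) (auto intro!: continuous_intros)
      moreover have "(\<lambda>s. ?A + ?B * s) -` T \<subseteq> closure (coord_domain E j)"
        using cl B by force
      moreover have "coord_of E m j \<in> (\<lambda>s. ?A + ?B * s) -` T"
        using mT B by (simp add: coord_of_rec[of E m j])
      ultimately have "coord_of E m j \<in> interior (closure (coord_domain E j))"
        by (meson interior_maximal subsetD)
      then show ?case by (simp add: interior_closure_coord_domain)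
    qed
    then show "m \<in> PiE {1..n} (\<lambda>_. UNIV) \<inter> coord_set E n"
      using ext by (auto simp: coord_set_def)
  qed
qed

lemma canonical_coord_coord_of:
  assumes "m \<in> coord_set E n" "j \<in> {1..n}"
  shows "canonical_coord E n m j = coord_of E m j"
  by (rule canonical_coord_eq)
    (use assms in \<open>auto simp: coord_set_def coord_moment_coord_of\<close>)

lemma relint_moment_space_coord_set:
  assumes "I \<subseteq> {1..n}"
  shows "relint_moment_space E I c n
    = {m \<in> PiE {1..n} (\<lambda>_. UNIV) \<inter> coord_set E n. \<forall>i\<in>I. m i = c i}"
proof
  show "relint_moment_space E I c n \<subseteq> {m \<in> PiE {1..n} (\<lambda>_. UNIV) \<inter> coord_set E n. \<forall>i\<in>I. m i = c i}"
    using assms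
    by (auto simp: relint_moment_space_def int_moment_space_coord_set constrained_moment_space_def
        constrained_measures_def moment_vec_def)
  show "{m \<in> PiE {1..n} (\<lambda>_. UNIV) \<inter> coord_set E n. \<forall>i\<in>I. m i = c i} \<subseteq> relint_moment_space E I c n"
  proof
    fix m assume m: "m \<in> {m \<in> PiE {1..n} (\<lambda>_. UNIV) \<inter> coord_set E n. \<forall>i\<in>I. m i = c i}"
    then have int: "m \<in> int_moment_space E n" by (simp add: int_moment_space_coord_set)
    then have "m \<in> moment_space E n"
      unfolding int_moment_space_def by (rule subsetD[OF interior_of_subset])
    then obtain \<mu> where \<mu>: "\<mu> \<in> prob_measures E" "m = moment_vec n \<mu>"
      by (auto simp: moment_space_def)
    have "moment \<mu> i = c i" if "i \<in> I" for i
    proof -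
      have "i \<in> {1..n}" using that assms by blast
      then show ?thesis using fun_cong[OF \<mu>(2), of i] m that by (simp add: moment_vec_def)
    qed
    then show "m \<in> relint_moment_space E I c n"
      using int \<mu> by (auto simp: relint_moment_space_def constrained_moment_space_def constrained_measures_def)
  qed
qed

section \<open>Borel sets of R^n\<close>

lemma measurable_PiM_to_fun:
  "(\<lambda>m. m) \<in> (\<Pi>\<^sub>M i\<in>{1..n}. (borel :: real measure)) \<rightarrow>\<^sub>M (borel :: (nat \<Rightarrow> real) measure)"
proof (rule measurable_coordinatewise_then_product)
  fix k
  show "(\<lambda>m. m k) \<in> (\<Pi>\<^sub>M i\<in>{1..n}. (borel :: real measure)) \<rightarrow>\<^sub>M borel"
  proof (cases "k \<in> {1..n}")
    case False
    then have "(\<lambda>m. m k) \<in> (\<Pi>\<^sub>M i\<in>{1..n}. (borel :: real measure)) \<rightarrow>\<^sub>M borel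
      \<longleftrightarrow> (\<lambda>m. undefined) \<in> (\<Pi>\<^sub>M i\<in>{1..n}. (borel :: real measure)) \<rightarrow>\<^sub>M (borel :: real measure)"
      by (intro measurable_cong) (auto simp: space_PiM PiE_def extensional_def)
    then show ?thesis by simp
  qed simp
qed

lemma space_borel_of [simp]: "space (borel_of X) = topspace X"
  unfolding borel_of_def by (intro space_measure_of) (auto dest: openin_subset)

lemma sets_borel_of: "sets (borel_of X) = sigma_sets (topspace X) {U. openin X U}"
  unfolding borel_of_def by (intro sets_measure_of) (auto dest: openin_subset)

text \<open>Open sets of R^n are traces of open sets of the sequence space, into which the inclusion
  is measurable for the product sigma-algebra. Conversely the projections are continuous.\<close>

lemma sets_borel_of_Rtop: "sets (borel_of (Rtop n)) = sets (\<Pi>\<^sub>M i\<in>{1..n}. (borel :: real measure))"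
proof
  let ?M = "\<Pi>\<^sub>M i\<in>{1..n}. (borel :: real measure)"
  have sp: "space ?M = PiE {1..n} (\<lambda>_. UNIV)" by (simp add: space_PiM)
  have "{U. openin (Rtop n) U} \<subseteq> sets ?M"
  proof clarify
    fix U assume U: "openin (Rtop n) U"
    have "(\<lambda>m. m) -` {m. restrict m {1..n} \<in> U} \<inter> space ?M \<in> sets ?M"
      by (rule measurable_sets[OF measurable_PiM_to_fun]) (rule borel_open[OF open_restrict_vimage[OF U]])
    moreover have "(\<lambda>m. m) -` {m. restrict m {1..n} \<in> U} \<inter> space ?M = U"
      using openin_subset[OF U] unfolding sp by (auto simp: PiE_restrict)
    ultimately show "U \<in> sets ?M" by simp
  qed
  then show "sets (borel_of (Rtop n)) \<subseteq> sets ?M"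
    unfolding sets_borel_of topspace_Rtop sp[symmetric] by (rule sets.sigma_sets_subset)
  have "(\<lambda>m. m) \<in> borel_of (Rtop n) \<rightarrow>\<^sub>M ?M"
  proof (rule measurable_PiM_single')
    fix i assume i: "i \<in> {1..n}"
    show "(\<lambda>m. m i) \<in> borel_of (Rtop n) \<rightarrow>\<^sub>M borel"
    proof (rule borel_measurableI)
      fix S :: "real set" assume "open S"
      then have "openin (Rtop n) {m \<in> topspace (Rtop n). m i \<in> S}"
        using i by (intro openin_continuous_map_preimage[of _ euclidean])
          (auto simp: Rtop_def simp del: topspace_product_topology intro: continuous_map_product_projection)
      moreover have "{m \<in> topspace (Rtop n). m i \<in> S} = (\<lambda>m. m i) -` S \<inter> space (borel_of (Rtop n))"
        by auto
      ultimately show "(\<lambda>m. m i) -` S \<inter> space (borel_of (Rtop n)) \<in> sets (borel_of (Rtop n))"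
        by (simp add: sets_borel_of sigma_sets.Basic)
    qed
  qed auto
  then show "sets ?M \<subseteq> sets (borel_of (Rtop n))"
  proof (intro subsetI)
    fix S assume S: "S \<in> sets ?M"
    have "(\<lambda>m. m) -` S \<inter> space (borel_of (Rtop n)) = S"
      using sets.sets_into_space[OF S] unfolding sp by auto
    then show "S \<in> sets (borel_of (Rtop n))"
      using measurable_sets[OF \<open>(\<lambda>m. m) \<in> borel_of (Rtop n) \<rightarrow>\<^sub>M ?M\<close> S] by simp
  qed
qed

section \<open>Integrating out the last moments\<close>

lemma log_lower_bound_if_tail:
  fixes f g :: "real \<Rightarrow> real"
  assumes S: "closed S" and f: "continuous_on S f" and g: "continuous_on S g"
    and tail: "\<And>t. t \<in> S \<Longrightarrow> R \<le> \<bar>t\<bar> \<Longrightarrow> 1 \<le> \<bar>t\<bar> \<Longrightarrow> ln \<bar>t\<bar> \<le> f t \<and> ln \<bar>t\<bar> \<le> f t - ln (g t)"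
  shows "\<exists>C. \<forall>t\<in>S. 0 < g t \<longrightarrow> ln (1 + \<bar>t\<bar>) - C \<le> f t \<and> ln (1 + \<bar>t\<bar>) - C \<le> f t - ln (g t)"
proof -
  define r where "r = max R 1"
  define K where "K = S \<inter> {-r..r}"
  have "compact K" unfolding K_def using S by (simp add: closed_Int_compact)
  have "continuous_on K f" "continuous_on K g"
    using f g by (auto intro: continuous_on_subset simp: K_def)
  then have "bounded (f ` K)" "bounded (g ` K)"
    using \<open>compact K\<close> by (auto intro: compact_imp_bounded compact_continuous_image)
  then obtain a b where a: "\<And>t. t \<in> K \<Longrightarrow> \<bar>f t\<bar> \<le> a" and b: "\<And>t. t \<in> K \<Longrightarrow> \<bar>g t\<bar> \<le> b"
    by (fastforce simp: bounded_iff)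
  \<comment> \<open>On the compact part the first two terms handle f and \<open>ln b\<close> bounds
    the logarithm of g; on the tail \<open>ln 2\<close> pays for passing from 1 + |t| to |t|. All
    terms are nonnegative, so one constant serves both regions.\<close>
  define C where "C = \<bar>a\<bar> + ln (1 + r) + \<bar>ln b\<bar> + ln 2"
  have r: "1 \<le> r" by (simp add: r_def)
  have "ln (1 + \<bar>t\<bar>) - C \<le> f t \<and> ln (1 + \<bar>t\<bar>) - C \<le> f t - ln (g t)" if t: "t \<in> S" "0 < g t" for t
  proof (cases "\<bar>t\<bar> \<le> r")
    case True
    then have "t \<in> K" using t by (auto simp: K_def)
    then have "- a \<le> f t" "g t \<le> b" using a[of t] b[of t] by auto
    moreover from this have "ln (g t) \<le> ln b" using t by (intro ln_mono) auto
    moreover have "ln (1 + \<bar>t\<bar>) \<le> ln (1 + r)" using True by (intro ln_mono) auto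
    moreover have "0 \<le> ln (2::real)" by simp
    ultimately show ?thesis unfolding C_def using r by linarith
  next
    case False
    then have "1 \<le> \<bar>t\<bar>" "R \<le> \<bar>t\<bar>" by (auto simp: r_def)
    moreover have "ln (1 + \<bar>t\<bar>) \<le> ln (2 * \<bar>t\<bar>)" using \<open>1 \<le> \<bar>t\<bar>\<close> by (intro ln_mono) auto
    moreover have "ln (2 * \<bar>t\<bar>) = ln 2 + ln \<bar>t\<bar>" using \<open>1 \<le> \<bar>t\<bar>\<close> by (subst ln_mult) auto
    moreover have "0 \<le> ln (1 + r)" using r by simp
    ultimately show ?thesis unfolding C_def using tail[OF t(1)] by linarith
  qed
  then show ?thesis by blast
qed

text \<open>The later integrands are exp (- N p) slope^k with k at most N, that is N - k copies of
  exp (- p) and k copies of exp (- (p - ln slope)). Therefore both exponents get a logarithmic lower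
  bound.\<close>

locale potentials =
  fixes E :: support and p :: "nat \<Rightarrow> real \<Rightarrow> real"
  assumes continuous: "1 \<le> j \<Longrightarrow> continuous_on (coord_domain E j) (p j)"
    and coercive: "1 \<le> j \<Longrightarrow> \<exists>C. \<forall>t\<in>coord_domain E j.
      ln (1 + \<bar>t\<bar>) - C \<le> p j t \<and> ln (1 + \<bar>t\<bar>) - C \<le> p j t - ln (slope E j t)"

lemma potentials_coercive:
  assumes "continuous_on (closure (coord_domain E j)) f"
    and tail: "\<exists>\<epsilon>>0. \<exists>R. \<forall>y\<in>closure (coord_domain E j). \<bar>y\<bar> \<ge> R \<longrightarrow>
      E = UnitInterval \<or> f y \<ge> ((if E = RealLine \<and> odd j then 1 else 2) + \<epsilon>) * ln \<bar>y\<bar>"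
  shows "\<exists>C. \<forall>t\<in>coord_domain E j.
      ln (1 + \<bar>t\<bar>) - C \<le> f t \<and> ln (1 + \<bar>t\<bar>) - C \<le> f t - ln (slope E j t)"
proof -
  obtain \<epsilon> R where \<epsilon>: "0 < \<epsilon>" and R: "\<And>y. y \<in> closure (coord_domain E j) \<Longrightarrow> \<bar>y\<bar> \<ge> R \<Longrightarrow>
      E = UnitInterval \<or> f y \<ge> ((if E = RealLine \<and> odd j then 1 else 2) + \<epsilon>) * ln \<bar>y\<bar>"
    using tail by blast
  have "\<exists>C. \<forall>t\<in>closure (coord_domain E j). 0 < slope E j t \<longrightarrow>
      ln (1 + \<bar>t\<bar>) - C \<le> f t \<and> ln (1 + \<bar>t\<bar>) - C \<le> f t - ln (slope E j t)"
  proof (rule log_lower_bound_if_tail[OF closed_closure assms(1) continuous_on_slope])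
    \<comment> \<open>The threshold 2 leaves no tail for the unit interval.\<close>
    fix t assume t: "t \<in> closure (coord_domain E j)" "max 2 R \<le> \<bar>t\<bar>" "1 \<le> \<bar>t\<bar>"
    have E: "E \<noteq> UnitInterval" using t by (auto simp: closure_coord_domain)
    \<comment> \<open>On the tail the slope is |t| to the power \<kappa> - 1. Of the \<kappa> +
      \<epsilon> logarithms, \<kappa> - 1 pay for it and at least one remains.\<close>
    define \<kappa> :: real where "\<kappa> = (if E = RealLine \<and> odd j then 1 else 2)"
    have f: "(\<kappa> + \<epsilon>) * ln \<bar>t\<bar> \<le> f t" using R[of t] E t by (simp add: \<kappa>_def)
    have l: "0 \<le> ln \<bar>t\<bar>" "0 \<le> \<epsilon> * ln \<bar>t\<bar>" using t \<epsilon> by auto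
    have "ln (slope E j t) = (\<kappa> - 1) * ln \<bar>t\<bar>"
      using E t by (cases E) (auto simp: \<kappa>_def closure_coord_domain split: if_splits)
    moreover have "1 \<le> \<kappa>" by (simp add: \<kappa>_def)
    then have "0 \<le> (\<kappa> - 1) * ln \<bar>t\<bar>" using l by simp
    ultimately show "ln \<bar>t\<bar> \<le> f t \<and> ln \<bar>t\<bar> \<le> f t - ln (slope E j t)"
      using f l by (auto simp: algebra_simps)
  qed
  then obtain C where "\<forall>t\<in>closure (coord_domain E j). 0 < slope E j t \<longrightarrow>
      ln (1 + \<bar>t\<bar>) - C \<le> f t \<and> ln (1 + \<bar>t\<bar>) - C \<le> f t - ln (slope E j t)" by blast
  then show ?thesis
    using slope_pos closure_subset by (intro exI[of _ C]) blast
qed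

lemma nn_integral_inverse_1_plus_square_finite: "(\<integral>\<^sup>+t. ennreal (inverse (1 + t\<^sup>2)) \<partial>lborel) < \<infinity>"
proof -
  have "integrable lborel (\<lambda>t::real. inverse (1 + t\<^sup>2))"
    using integrable_inverse_1_plus_square by (simp add: set_integrable_def)
  then show ?thesis
    by (subst nn_integral_eq_integral) auto
qed

lemma W_fun_eq: "W_fun E V j t = V j t - ln (slope E j t)"
  by (cases E) auto

section \<open>The density and its one-dimensional integrals\<close>

context potentials
begin

text \<open>The density after k integrations: N stays the original number of moments, n moments
  remain, and every integration has added one power of each remaining slope.\<close>

definition weight :: "nat \<Rightarrow> nat \<Rightarrow> nat \<Rightarrow> (nat \<Rightarrow> real) \<Rightarrow> real" where
  "weight N n k m = indicator (coord_set E n) m *\<^sub>R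
     (\<Prod>j\<in>{1..n}. exp (- (real N * p j (coord_of E m j))) * slope E j (coord_of E m j) ^ k)"

definition coord_integral :: "nat \<Rightarrow> nat \<Rightarrow> nat \<Rightarrow> ennreal" where
  "coord_integral N j k =
     (\<integral>\<^sup>+t. ennreal (indicator (coord_domain E j) t *\<^sub>R (exp (- (real N * p j t)) * slope E j t ^ k)) \<partial>lborel)"

lemma weight_cong:
  assumes "\<And>i. 1 \<le> i \<Longrightarrow> i \<le> n \<Longrightarrow> m i = m' i"
  shows "weight N n k m = weight N n k m'"
proof -
  have same: "coord_of E m j = coord_of E m' j" if "j \<in> {1..n}" for j
    by (rule coord_of_cong) (use that assms in auto)
  have "(\<Prod>j\<in>{1..n}. exp (- (real N * p j (coord_of E m j))) * slope E j (coord_of E m j) ^ k)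
      = (\<Prod>j\<in>{1..n}. exp (- (real N * p j (coord_of E m' j))) * slope E j (coord_of E m' j) ^ k)"
    by (rule prod.cong[OF refl]) (simp only: same)
  moreover have "m \<in> coord_set E n \<longleftrightarrow> m' \<in> coord_set E n" using assms by (rule coord_set_cong)
  ultimately show ?thesis by (auto simp: weight_def indicator_def)
qed

lemma continuous_on_coord_comp:
  assumes "j \<in> {1..n}" "continuous_on (coord_domain E j) f"
  shows "continuous_on (coord_set E n) (\<lambda>m. f (coord_of E m j))"
  by (rule continuous_on_compose2[OF assms(2) continuous_on_coord_of[OF assms(1)]])
    (use assms(1) in \<open>auto simp: coord_set_def\<close>)

lemma weight_measurable [measurable]: "weight N n k \<in> borel_measurable borel"
proof -
  have "continuous_on (coord_domain E j) (\<lambda>t. exp (- (real N * p j t)) * slope E j t ^ k)" if "1 \<le> j" for j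
    by (intro continuous_intros continuous[OF that] continuous_on_slope)
  then have "continuous_on (coord_set E n)
      (\<lambda>m. \<Prod>j\<in>{1..n}. exp (- (real N * p j (coord_of E m j))) * slope E j (coord_of E m j) ^ k)"
    by (intro continuous_on_prod continuous_on_coord_comp) auto
  then show ?thesis unfolding weight_def
    by (intro borel_measurable_continuous_on_indicator) (auto simp: open_coord_set)
qed

text \<open>The two growth bounds, taken N - k and k times, combine to decay of order (1 +
  |t|)^(-N); N >= 2 then allows comparison with 1 / (1 + t^2).\<close>

lemma coord_integral_finite:
  assumes "2 \<le> N" "k \<le> N" "1 \<le> j"
  shows "coord_integral N j k < \<infinity>"
proof -
  obtain C where C: "\<And>t. t \<in> coord_domain E j \<Longrightarrow> ln (1 + \<bar>t\<bar>) - C \<le> p j t"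
    "\<And>t. t \<in> coord_domain E j \<Longrightarrow> ln (1 + \<bar>t\<bar>) - C \<le> p j t - ln (slope E j t)"
    using coercive[OF assms(3)] by blast
  have "indicator (coord_domain E j) t *\<^sub>R (exp (- (real N * p j t)) * slope E j t ^ k)
      \<le> exp (real N * C) * inverse (1 + t\<^sup>2)" for t
  proof (cases "t \<in> coord_domain E j")
    case True
    have sp: "0 < slope E j t" using True by (rule slope_pos)
    have "exp (- (real N * p j t)) * slope E j t ^ k
        = exp (- (real N * p j t)) * exp (real k * ln (slope E j t))"
      using sp by (simp add: exp_of_nat_mult)
    also have "\<dots> = exp (- (real (N - k) * p j t + real k * (p j t - ln (slope E j t))))"
      using assms by (simp add: of_nat_diff algebra_simps flip: exp_add)
    also have "\<dots> \<le> exp (- (real (N - k) * (ln (1 + \<bar>t\<bar>) - C) + real k * (ln (1 + \<bar>t\<bar>) - C)))"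
    proof -
      have "real (N - k) * (ln (1 + \<bar>t\<bar>) - C) \<le> real (N - k) * p j t"
        using C(1)[OF True] by (rule mult_left_mono) simp
      moreover have "real k * (ln (1 + \<bar>t\<bar>) - C) \<le> real k * (p j t - ln (slope E j t))"
        using C(2)[OF True] by (rule mult_left_mono) simp
      ultimately show ?thesis by simp
    qed
    also have "\<dots> = exp (real N * C) * inverse ((1 + \<bar>t\<bar>) ^ N)"
    proof -
      have "real (N - k) * (ln (1 + \<bar>t\<bar>) - C) + real k * (ln (1 + \<bar>t\<bar>) - C) = real N * ln (1 + \<bar>t\<bar>) - real N * C"
        using assms by (simp add: of_nat_diff algebra_simps)
      moreover have "exp (real N * ln (1 + \<bar>t\<bar>)) = (1 + \<bar>t\<bar>) ^ N" by (simp add: exp_of_nat_mult)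
      ultimately show ?thesis by (simp add: exp_diff divide_inverse)
    qed
    also have "\<dots> \<le> exp (real N * C) * inverse (1 + t\<^sup>2)"
    proof -
      have "1 + t\<^sup>2 \<le> (1 + \<bar>t\<bar>)\<^sup>2" by (simp add: power2_eq_square algebra_simps)
      also have "\<dots> \<le> (1 + \<bar>t\<bar>) ^ N" using assms by (intro power_increasing) auto
      finally show ?thesis by (intro mult_left_mono le_imp_inverse_le) (auto simp: add_pos_nonneg)
    qed
    finally show ?thesis using True by simp
  qed (simp add: add_nonneg_nonneg)
  then have "coord_integral N j k \<le> (\<integral>\<^sup>+t. ennreal (exp (real N * C) * inverse (1 + t\<^sup>2)) \<partial>lborel)"
    unfolding coord_integral_def by (intro nn_integral_mono ennreal_leI)
  also have "\<dots> = ennreal (exp (real N * C)) * (\<integral>\<^sup>+t. ennreal (inverse (1 + t\<^sup>2)) \<partial>lborel)"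
    by (simp add: ennreal_mult' nn_integral_cmult)
  also have "\<dots> < \<infinity>"
    using nn_integral_inverse_1_plus_square_finite by (simp add: ennreal_mult_less_top)
  finally show ?thesis .
qed

lemma coord_integrand_measurable:
  assumes "1 \<le> j"
  shows "(\<lambda>t. indicator (coord_domain E j) t *\<^sub>R (exp (- (real N * p j t)) * slope E j t ^ k)) \<in> borel_measurable borel"
  by (intro borel_measurable_continuous_on_indicator continuous_intros continuous[OF assms]
      continuous_on_slope borel_open open_coord_domain)

lemma coord_integral_pos:
  assumes "1 \<le> j"
  shows "0 < coord_integral N j k"
proof (rule ccontr)
  let ?f = "\<lambda>t. indicator (coord_domain E j) t *\<^sub>R (exp (- (real N * p j t)) * slope E j t ^ k)"
  have [measurable]: "?f \<in> borel_measurable borel" using assms by (rule coord_integrand_measurable)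
  assume "\<not> 0 < coord_integral N j k"
  then have "(\<integral>\<^sup>+t. ennreal (?f t) \<partial>lborel) = 0"
    by (simp add: coord_integral_def)
  moreover have "(\<lambda>t. ennreal (?f t)) \<in> borel_measurable lborel" by measurable
  ultimately have "AE t in lborel. ennreal (?f t) = 0"
    by (simp only: nn_integral_0_iff_AE)
  \<comment> \<open>The interval (0, 1) lies in every coordinate domain and the integrand is
    positive on it, so a vanishing integral would make this interval a null set.\<close>
  then have "AE t in lborel. t \<notin> {0<..<1::real}"
  proof (rule AE_mp, intro AE_I2 impI notI)
    fix t :: real assume t: "ennreal (?f t) = 0" "t \<in> {0<..<1}"
    then have "t \<in> coord_domain E j" by (cases E) auto
    moreover from this have "0 < exp (- (real N * p j t)) * slope E j t ^ k"
      using slope_pos[of t E j] by simp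
    ultimately show False using t by (simp add: ennreal_eq_0_iff)
  qed
  then have "emeasure lborel {0<..<1::real} = 0"
    by (subst (asm) AE_iff_measurable[of "{0<..<1}"]) auto
  then show False by simp
qed

text \<open>Substituting the canonical coordinate for the last moment produces the Jacobian
  \<open>\<Prod>\<^bsub>j \<le> n\<^esub> slope\<^sub>j\<close>, which raises the exponent of the slopes by one.\<close>

lemma nn_integral_weight_last:
  assumes f: "\<And>t. f (m(Suc n := t)) = f m"
  shows "(\<integral>\<^sup>+t. ennreal (weight N (Suc n) k (m(Suc n := t))) * f (m(Suc n := t)) \<partial>lborel)
    = coord_integral N (Suc n) k * (ennreal (weight N n (Suc k) m) * f m)"
proof (cases "m \<in> coord_set E n")
  case False
  have "m(Suc n := t) \<notin> coord_set E (Suc n)" for t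
    using False coord_set_cong[of n m "m(Suc n := t)" E] by (auto simp: coord_set_Suc)
  then show ?thesis using False by (simp add: weight_def)
next
  case True
  let ?A = "coord_moment E (trunc (Suc n) (coord_of E m)) (Suc n)"
  let ?B = "fiber_scale E (coord_of E m) (Suc n)"
  let ?g = "\<lambda>s. indicator (coord_domain E (Suc n)) s *\<^sub>R (exp (- (real N * p (Suc n) s)) * slope E (Suc n) s ^ k)"
  let ?Q = "\<lambda>k. \<Prod>j\<in>{1..n}. exp (- (real N * p j (coord_of E m j))) * slope E j (coord_of E m j) ^ k"
  have B: "0 < ?B" using True by (intro fiber_scale_pos) (auto simp: coord_set_def)
  have Q: "0 \<le> ?Q k" for k
    using True
    by (auto intro!: prod_nonneg mult_nonneg_nonneg zero_le_power less_imp_le[OF slope_pos] simp: coord_set_def)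
  have same: "coord_of E (m(Suc n := t)) i = coord_of E m i" if "1 \<le> i" "i \<le> n" for i t
    by (rule coord_of_cong) (use that in auto)
  have last: "coord_of E (m(Suc n := t)) (Suc n) = (t - ?A) / ?B" for t
  proof -
    have "trunc (Suc n) (coord_of E (m(Suc n := t))) = trunc (Suc n) (coord_of E m)"
      "fiber_scale E (coord_of E (m(Suc n := t))) (Suc n) = ?B"
      using same by (auto simp: trunc_def intro: fiber_scale_cong)
    then show ?thesis by (simp add: coord_of_rec[of E _ "Suc n"])
  qed
  have "m(Suc n := t) \<in> coord_set E n" for t
    using True coord_set_cong[of n m "m(Suc n := t)" E] by auto
  then have wt: "weight N (Suc n) k (m(Suc n := t)) = ?Q k * ?g ((t - ?A) / ?B)" for t
    using same by (simp add: weight_def coord_set_Suc last indicator_def atLeastAtMostSuc_conv mult.commute)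
  have [measurable]: "?g \<in> borel_measurable borel" by (rule coord_integrand_measurable) simp
  have gm: "(\<lambda>t. ennreal (?g ((t - ?A) / ?B))) \<in> borel_measurable borel" by measurable
  have "(\<integral>\<^sup>+t. ennreal (weight N (Suc n) k (m(Suc n := t))) * f (m(Suc n := t)) \<partial>lborel)
    = (\<integral>\<^sup>+t. (ennreal (?Q k) * f m) * ennreal (?g ((t - ?A) / ?B)) \<partial>lborel)"
    by (rule nn_integral_cong, subst wt, subst f, subst ennreal_mult'[OF Q]) (simp only: mult_ac)
  also have "\<dots> = (ennreal (?Q k) * f m) * (\<integral>\<^sup>+t. ennreal (?g ((t - ?A) / ?B)) \<partial>lborel)"
    by (rule nn_integral_cmult) measurable
  also have "(\<integral>\<^sup>+t. ennreal (?g ((t - ?A) / ?B)) \<partial>lborel)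
      = ennreal \<bar>?B\<bar> * (\<integral>\<^sup>+s. ennreal (?g ((?A + ?B * s - ?A) / ?B)) \<partial>lborel)"
    by (rule nn_integral_real_affine[OF gm]) (use B in auto)
  also have "\<dots> = ennreal ?B * coord_integral N (Suc n) k"
    using B by (simp add: coord_integral_def)
  also have "(ennreal (?Q k) * f m) * (ennreal ?B * coord_integral N (Suc n) k)
      = coord_integral N (Suc n) k * (ennreal (?Q k * ?B) * f m)"
    using Q B by (simp add: ennreal_mult mult_ac)
  also have "?Q k * ?B = weight N n (Suc k) m"
    using True by (simp add: weight_def fiber_scale_def atLeastLessThanSuc_atLeastAtMost
        flip: prod.distrib) (simp add: mult_ac)
  finally show ?thesis .
qed

end

lemma measurable_insert_constraint [measurable]:
  "insert_constraint I c n \<in> free_lebesgue I n \<rightarrow>\<^sub>M (borel :: (nat \<Rightarrow> real) measure)"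
proof (rule measurable_coordinatewise_then_product)
  fix i
  show "(\<lambda>x. insert_constraint I c n x i) \<in> borel_measurable (free_lebesgue I n)"
    unfolding insert_constraint_def free_lebesgue_def
    by (cases "i \<in> {1..n}"; cases "i \<in> I") auto
qed

locale constrained_potentials = potentials +
  fixes I :: "nat set" and c :: "nat \<Rightarrow> real" and l :: nat
  assumes index: "I \<subseteq> {1..l}"
    and nonempty: "relint_moment_space E I c l \<noteq> {}"
begin

abbreviation ins :: "nat \<Rightarrow> (nat \<Rightarrow> real) \<Rightarrow> nat \<Rightarrow> real" where
  "ins n \<equiv> insert_constraint I c n"

text \<open>The index n + 1 lies above l and is therefore free. Fubini makes it the inner variable,
  along which \<open>f\<close> is constant.\<close>

lemma nn_integral_weight_Suc:
  assumes n: "l \<le> n" and [measurable]: "f \<in> borel_measurable borel"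
    and dep: "\<And>m m'. (\<And>i. 1 \<le> i \<Longrightarrow> i \<le> l \<Longrightarrow> m i = m' i) \<Longrightarrow> f m = f m'"
  shows "(\<integral>\<^sup>+x. ennreal (weight N (Suc n) k (ins (Suc n) x)) * f (ins (Suc n) x) \<partial>free_lebesgue I (Suc n))
    = coord_integral N (Suc n) k *
      (\<integral>\<^sup>+x. ennreal (weight N n (Suc k) (ins n x)) * f (ins n x) \<partial>free_lebesgue I n)"
proof -
  interpret product_sigma_finite "\<lambda>_. lborel :: real measure" ..
  let ?F = "{1..n} - I"
  have nI: "Suc n \<notin> I" using index n by auto
  have F: "{1..Suc n} - I = insert (Suc n) ?F" using nI by auto
  let ?h = "\<lambda>x. ennreal (weight N (Suc n) k (ins (Suc n) x)) * f (ins (Suc n) x)"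
  have [measurable]: "ins (Suc n) \<in> Pi\<^sub>M (insert (Suc n) ?F) (\<lambda>_. lborel) \<rightarrow>\<^sub>M borel"
    using measurable_insert_constraint[of I c "Suc n"] unfolding free_lebesgue_def F .
  have [measurable]: "ins n \<in> Pi\<^sub>M ?F (\<lambda>_. lborel) \<rightarrow>\<^sub>M borel"
    using measurable_insert_constraint[of I c n] unfolding free_lebesgue_def .
  have meas: "?h \<in> borel_measurable (Pi\<^sub>M (insert (Suc n) ?F) (\<lambda>_. lborel))" by measurable
  have "(\<integral>\<^sup>+x. ?h x \<partial>free_lebesgue I (Suc n))
      = (\<integral>\<^sup>+x. (\<integral>\<^sup>+t. ?h (x(Suc n := t)) \<partial>lborel) \<partial>Pi\<^sub>M ?F (\<lambda>_. lborel))"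
    unfolding free_lebesgue_def F by (rule product_nn_integral_insert[OF _ _ meas]) auto
  also have "\<dots> = (\<integral>\<^sup>+x. coord_integral N (Suc n) k *
      (ennreal (weight N n (Suc k) (ins n x)) * f (ins n x)) \<partial>Pi\<^sub>M ?F (\<lambda>_. lborel))"
  proof (rule nn_integral_cong)
    fix x :: "nat \<Rightarrow> real"
    have agree: "ins (Suc n) (x(Suc n := t)) i = ((ins n x)(Suc n := t)) i" if "1 \<le> i" "i \<le> Suc n" for t i
      using that nI by (auto simp: insert_constraint_def)
    have "?h (x(Suc n := t)) = ennreal (weight N (Suc n) k ((ins n x)(Suc n := t))) * f ((ins n x)(Suc n := t))" for t
    proof -
      have "weight N (Suc n) k (ins (Suc n) (x(Suc n := t))) = weight N (Suc n) k ((ins n x)(Suc n := t))"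
        by (rule weight_cong) (use agree in auto)
      moreover have "f (ins (Suc n) (x(Suc n := t))) = f ((ins n x)(Suc n := t))"
        by (rule dep) (use agree n in auto)
      ultimately show ?thesis by simp
    qed
    then show "(\<integral>\<^sup>+t. ?h (x(Suc n := t)) \<partial>lborel)
        = coord_integral N (Suc n) k * (ennreal (weight N n (Suc k) (ins n x)) * f (ins n x))"
      using nn_integral_weight_last[of f "ins n x" n N k] dep[of "(ins n x)(Suc n := _)" "ins n x"] n by simp
  qed
  also have "\<dots> = coord_integral N (Suc n) k *
      (\<integral>\<^sup>+x. ennreal (weight N n (Suc k) (ins n x)) * f (ins n x) \<partial>Pi\<^sub>M ?F (\<lambda>_. lborel))"
    by (rule nn_integral_cmult) measurable
  finally show ?thesis by (simp add: free_lebesgue_def)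
qed

text \<open>K is the same for all \<open>f\<close>, so it cancels in probabilities. The bound on k +
  d keeps the exponent of the slopes at most N, hence every one-dimensional factor finite.\<close>

lemma nn_integral_weight_marginal:
  assumes N: "2 \<le> N"
  shows "k + d \<le> N \<Longrightarrow> \<exists>K. 0 < K \<and> K < \<infinity> \<and> (\<forall>f\<in>borel_measurable borel.
      (\<forall>m m'. (\<forall>i\<in>{1..l}. m i = m' i) \<longrightarrow> f m = f m') \<longrightarrow>
      (\<integral>\<^sup>+x. ennreal (weight N (l + d) k (ins (l + d) x)) * f (ins (l + d) x) \<partial>free_lebesgue I (l + d))
      = K * (\<integral>\<^sup>+x. ennreal (weight N l (k + d) (ins l x)) * f (ins l x) \<partial>free_lebesgue I l))"
proof (induction d arbitrary: k)
  case 0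
  then show ?case by (intro exI[of _ 1]) auto
next
  case (Suc d)
  obtain K where K: "0 < K" "K < \<infinity>" "\<And>f. f \<in> borel_measurable borel \<Longrightarrow>
      (\<forall>m m'. (\<forall>i\<in>{1..l}. m i = m' i) \<longrightarrow> f m = f m') \<Longrightarrow>
      (\<integral>\<^sup>+x. ennreal (weight N (l + d) (Suc k) (ins (l + d) x)) * f (ins (l + d) x) \<partial>free_lebesgue I (l + d))
      = K * (\<integral>\<^sup>+x. ennreal (weight N l (Suc k + d) (ins l x)) * f (ins l x) \<partial>free_lebesgue I l)"
    using Suc.IH[of "Suc k"] Suc.prems by auto
  let ?c = "coord_integral N (Suc (l + d)) k"
  have c: "0 < ?c" "?c < \<infinity>"
    using Suc.prems N coord_integral_pos[of "Suc (l + d)" N k]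
      coord_integral_finite[of N k "Suc (l + d)"] by simp_all
  show ?case
  proof (intro exI[of _ "?c * K"] conjI ballI impI)
    show "0 < ?c * K" using c K by (simp add: ennreal_zero_less_mult_iff)
    show "?c * K < \<infinity>" using c K by (simp add: ennreal_mult_less_top)
    fix f :: "(nat \<Rightarrow> real) \<Rightarrow> ennreal"
    assume f: "f \<in> borel_measurable borel" "\<forall>m m'. (\<forall>i\<in>{1..l}. m i = m' i) \<longrightarrow> f m = f m'"
    then have dep: "(\<And>i. 1 \<le> i \<Longrightarrow> i \<le> l \<Longrightarrow> m i = m' i) \<Longrightarrow> f m = f m'" for m m' by auto
    show "(\<integral>\<^sup>+x. ennreal (weight N (l + Suc d) k (ins (l + Suc d) x)) * f (ins (l + Suc d) x) \<partial>free_lebesgue I (l + Suc d))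
      = ?c * K * (\<integral>\<^sup>+x. ennreal (weight N l (k + Suc d) (ins l x)) * f (ins l x) \<partial>free_lebesgue I l)"
      using nn_integral_weight_Suc[OF _ f(1) dep, of "l + d" N k] K(3)[OF f] by (simp add: mult.assoc)
  qed
qed

end

section \<open>Laplace principle\<close>

lemma measurable_restrict_borel_of [measurable]:
  "(\<lambda>m. restrict m {1..l}) \<in> (borel :: (nat \<Rightarrow> real) measure) \<rightarrow>\<^sub>M borel_of (Rtop l)"
proof -
  have "(\<lambda>m. restrict m {1..l}) \<in> (borel :: (nat \<Rightarrow> real) measure) \<rightarrow>\<^sub>M (\<Pi>\<^sub>M i\<in>{1..l}. borel)"
    by (rule measurable_restrict)
      (auto intro: borel_measurable_continuous_onI continuous_on_coord_apply)
  then show ?thesis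
    using measurable_cong_sets[OF refl sets_borel_of_Rtop] by blast
qed

lemma insert_constraint_PiE: "insert_constraint I c n x \<in> PiE {1..n} (\<lambda>_. UNIV)"
  by (auto simp: insert_constraint_def)

lemma restrict_insert_constraint: "restrict (insert_constraint I c n x) {1..n} = insert_constraint I c n x"
  using insert_constraint_PiE by (rule PiE_restrict)

lemma measurable_insert_constraint_borel_of:
  "insert_constraint I c n \<in> free_lebesgue I n \<rightarrow>\<^sub>M borel_of (Rtop n)"
  using measurable_compose[OF measurable_insert_constraint measurable_restrict_borel_of, of I c n n]
  by (simp only: restrict_insert_constraint)

lemma measurable_restrict_borel_of_le:
  assumes "l \<le> n"
  shows "(\<lambda>m. restrict m {1..l}) \<in> borel_of (Rtop n) \<rightarrow>\<^sub>M borel_of (Rtop l)"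
proof -
  have "(\<lambda>m. restrict m {1..l}) \<in> (\<Pi>\<^sub>M i\<in>{1..n}. (borel :: real measure)) \<rightarrow>\<^sub>M (\<Pi>\<^sub>M i\<in>{1..l}. borel)"
    by (rule measurable_restrict_subset) (use assms in auto)
  then show ?thesis
    using measurable_cong_sets[OF sets_borel_of_Rtop sets_borel_of_Rtop] by blast
qed

section \<open>Energy of the remaining moments and integrability of its exponential\<close>

context constrained_potentials
begin

definition energy :: "(nat \<Rightarrow> real) \<Rightarrow> real" where
  "energy m = (\<Sum>j=1..l. p j (coord_of E m j) - ln (slope E j (coord_of E m j)))"

definition total_potential :: "(nat \<Rightarrow> real) \<Rightarrow> real" where
  "total_potential m = (\<Sum>j=1..l. p j (coord_of E m j))"

lemma relint_eq:
  "relint_moment_space E I c l = {m \<in> PiE {1..l} (\<lambda>_. UNIV) \<inter> coord_set E l. \<forall>i\<in>I. m i = c i}"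
  using index by (rule relint_moment_space_coord_set)

lemma relintD:
  assumes "m \<in> relint_moment_space E I c l"
  shows "m \<in> coord_set E l" "m \<in> PiE {1..l} (\<lambda>_. UNIV)" "i \<in> I \<Longrightarrow> m i = c i"
  using assms by (auto simp: relint_eq)

lemma ins_relint_iff:
  assumes "l \<le> n"
  shows "ins n x \<in> relint_moment_space E I c n \<longleftrightarrow> ins n x \<in> coord_set E n"
proof -
  have "I \<subseteq> {1..n}" using index assms by auto
  moreover from this have "\<forall>i\<in>I. ins n x i = c i" by (auto simp: insert_constraint_def)
  ultimately show ?thesis
    using insert_constraint_PiE by (simp add: relint_moment_space_coord_set)
qed

text \<open>n p - (n - l) ln slope = (n - l) (p - ln slope) + l p. The last term has a fixed
  coefficient and does not affect the exponential rate.\<close>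

lemma weight_eq_exp:
  assumes m: "m \<in> coord_set E l" and n: "l \<le> n"
  shows "weight n l (n - l) m = exp (- (real (n - l) * energy m + real l * total_potential m))"
proof -
  have "exp (- (real n * p j (coord_of E m j))) * slope E j (coord_of E m j) ^ (n - l)
      = exp (- (real (n - l) * (p j (coord_of E m j) - ln (slope E j (coord_of E m j)))
          + real l * p j (coord_of E m j)))" if "j \<in> {1..l}" for j
  proof -
    have "0 < slope E j (coord_of E m j)"
      using m that by (intro slope_pos) (auto simp: coord_set_def)
    then have "slope E j (coord_of E m j) ^ (n - l) = exp (real (n - l) * ln (slope E j (coord_of E m j)))"
      by (simp add: exp_of_nat_mult)
    then show ?thesis
      using n by (simp add: of_nat_diff algebra_simps flip: exp_add)
  qed
  then have "weight n l (n - l) m = (\<Prod>j\<in>{1..l}.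
      exp (- (real (n - l) * (p j (coord_of E m j) - ln (slope E j (coord_of E m j)))
          + real l * p j (coord_of E m j))))"
    using m by (simp add: weight_def)
  also have "\<dots> = exp (- (real (n - l) * energy m + real l * total_potential m))"
    unfolding energy_def total_potential_def
    by (simp only: sum_distrib_left sum.distrib[symmetric] sum_negf[symmetric] exp_sum finite_atLeastAtMost)
  finally show ?thesis .
qed

lemma coercive_const:
  obtains C where "0 \<le> C"
    "\<And>j t. j \<in> {1..l} \<Longrightarrow> t \<in> coord_domain E j \<Longrightarrow> ln (1 + \<bar>t\<bar>) - C \<le> p j t"
    "\<And>j t. j \<in> {1..l} \<Longrightarrow> t \<in> coord_domain E j \<Longrightarrow> ln (1 + \<bar>t\<bar>) - C \<le> p j t - ln (slope E j t)"
proof -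
  have "\<forall>j\<in>{1..l}. \<exists>C. \<forall>t\<in>coord_domain E j.
      ln (1 + \<bar>t\<bar>) - C \<le> p j t \<and> ln (1 + \<bar>t\<bar>) - C \<le> p j t - ln (slope E j t)"
    using coercive by auto
  then obtain C where C: "\<And>j t. j \<in> {1..l} \<Longrightarrow> t \<in> coord_domain E j \<Longrightarrow>
      ln (1 + \<bar>t\<bar>) - C j \<le> p j t \<and> ln (1 + \<bar>t\<bar>) - C j \<le> p j t - ln (slope E j t)"
    by metis
  define D where "D = (\<Sum>j\<in>{1..l}. \<bar>C j\<bar>)"
  have "C j \<le> D" if "j \<in> {1..l}" for j
    using member_le_sum[of j "{1..l}" "\<lambda>j. \<bar>C j\<bar>"] that by (auto simp: D_def)
  then show thesis
    using C by (intro that[of D]) (fastforce simp: D_def intro: sum_nonneg)+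
qed

text \<open>Adding the coordinatewise bounds turns the logarithms into the logarithm of the very
  product that bounds the moments.\<close>

lemma energy_lower:
  "\<exists>C\<ge>0. \<forall>m\<in>coord_set E l. ln (\<Prod>j\<in>{1..l}. 1 + \<bar>coord_of E m j\<bar>) - C \<le> energy m
     \<and> - C \<le> total_potential m \<and> - C \<le> energy m"
proof -
  obtain C where C: "0 \<le> C"
    "\<And>j t. j \<in> {1..l} \<Longrightarrow> t \<in> coord_domain E j \<Longrightarrow> ln (1 + \<bar>t\<bar>) - C \<le> p j t"
    "\<And>j t. j \<in> {1..l} \<Longrightarrow> t \<in> coord_domain E j \<Longrightarrow> ln (1 + \<bar>t\<bar>) - C \<le> p j t - ln (slope E j t)"
    using coercive_const by blast
  have 1: "ln (\<Prod>j\<in>{1..l}. 1 + \<bar>coord_of E m j\<bar>) - real l * C \<le> energy m"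
    and 2: "- (real l * C) \<le> total_potential m"
    and 3: "- (real l * C) \<le> energy m" if m: "m \<in> coord_set E l" for m
  proof -
    have dom: "coord_of E m j \<in> coord_domain E j" if "j \<in> {1..l}" for j
      using m that by (auto simp: coord_set_def)
    have ln: "ln (\<Prod>j\<in>{1..l}. 1 + \<bar>coord_of E m j\<bar>) = (\<Sum>j\<in>{1..l}. ln (1 + \<bar>coord_of E m j\<bar>))"
      by (rule ln_prod) auto
    have "(\<Sum>j\<in>{1..l}. ln (1 + \<bar>coord_of E m j\<bar>) - C) \<le> energy m"
      unfolding energy_def by (rule sum_mono) (use C dom in auto)
    then show e: "ln (\<Prod>j\<in>{1..l}. 1 + \<bar>coord_of E m j\<bar>) - real l * C \<le> energy m"
      unfolding ln by (simp add: sum_subtractf)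
    have "(\<Sum>j\<in>{1..l}. ln (1 + \<bar>coord_of E m j\<bar>) - C) \<le> total_potential m"
      unfolding total_potential_def by (rule sum_mono) (use C dom in auto)
    moreover have "0 \<le> (\<Sum>j\<in>{1..l}. ln (1 + \<bar>coord_of E m j\<bar>))" by (rule sum_nonneg) simp
    ultimately show "- (real l * C) \<le> total_potential m" "- (real l * C) \<le> energy m"
      using e unfolding ln by (simp_all add: sum_subtractf)
  qed
  show ?thesis using C(1) 1 2 3 by (intro exI[of _ "real l * C"]) auto
qed

lemma moment_le_coord_prod:
  assumes m: "m \<in> coord_set E l" and j: "j \<in> {1..l}"
  shows "\<bar>m j\<bar> \<le> (3 * (\<Prod>i\<in>{1..l}. 1 + \<bar>coord_of E m i\<bar>)) ^ (2 * l)"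
proof -
  have dom: "coord_of E m i \<in> coord_domain E i" if "i \<in> {1..l}" for i
    using m that by (auto simp: coord_set_def)
  have "\<bar>m j\<bar> = \<bar>coord_moment E (coord_of E m) j\<bar>"
    using j dom by (subst coord_moment_coord_of) auto
  also have "\<dots> \<le> (3 * (\<Prod>i\<in>{1..j}. 1 + \<bar>coord_of E m i\<bar>)) ^ (2 * j)"
    by (rule coord_moment_abs_le) (use dom j in auto)
  also have "\<dots> \<le> (3 * (\<Prod>i\<in>{1..l}. 1 + \<bar>coord_of E m i\<bar>)) ^ (2 * j)"
  proof (rule power_mono)
    have "(\<Prod>i\<in>{1..j}. 1 + \<bar>coord_of E m i\<bar>) \<le> (\<Prod>i\<in>{1..l}. 1 + \<bar>coord_of E m i\<bar>)"
      by (rule prod_mono2) (use j in auto)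
    then show "3 * (\<Prod>i\<in>{1..j}. 1 + \<bar>coord_of E m i\<bar>) \<le> 3 * (\<Prod>i\<in>{1..l}. 1 + \<bar>coord_of E m i\<bar>)"
      by simp
    have "0 \<le> (\<Prod>i\<in>{1..j}. 1 + \<bar>coord_of E m i\<bar>)" by (rule prod_nonneg) simp
    then show "0 \<le> 3 * (\<Prod>i\<in>{1..j}. 1 + \<bar>coord_of E m i\<bar>)" by simp
  qed
  also have "\<dots> \<le> (3 * (\<Prod>i\<in>{1..l}. 1 + \<bar>coord_of E m i\<bar>)) ^ (2 * l)"
  proof (rule power_increasing)
    have "1 \<le> (\<Prod>i\<in>{1..l}. 1 + \<bar>coord_of E m i\<bar>)" by (rule prod_ge_1) auto
    then show "1 \<le> 3 * (\<Prod>i\<in>{1..l}. 1 + \<bar>coord_of E m i\<bar>)" by simp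
  qed (use j in auto)
  finally show ?thesis .
qed

text \<open>The moments grow at most polynomially in the coordinates, so a large multiple of the energy
  beats the tails of the free moments.\<close>

lemma nn_integral_exp_energy_finite:
  "\<exists>N. (\<integral>\<^sup>+x. ennreal (indicator (coord_set E l) (ins l x) * exp (- (real N * energy (ins l x))))
      \<partial>free_lebesgue I l) < \<infinity>"
proof -
  interpret product_sigma_finite "\<lambda>_. lborel :: real measure" ..
  let ?F = "{1..l} - I"
  obtain C where C: "0 \<le> C"
    "\<And>m. m \<in> coord_set E l \<Longrightarrow> ln (\<Prod>j\<in>{1..l}. 1 + \<bar>coord_of E m j\<bar>) - C \<le> energy m"
    using energy_lower by blast
  \<comment> \<open>Each of the at most l free moments satisfies 1 + x^2 <= 2 (3 R)^(4 l), so their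
    product grows at most like R^(4 l^2); the factor R^(-N) from the energy compensates exactly
    this.\<close>
  define N where "N = 4 * l * l"
  define A where "A = exp (real N * C) * 2 ^ l * 3 ^ (4 * l * l)"
  have bound: "indicator (coord_set E l) (ins l x) * exp (- (real N * energy (ins l x)))
      \<le> A * (\<Prod>j\<in>?F. inverse (1 + (x j)\<^sup>2))" for x
  proof (cases "ins l x \<in> coord_set E l")
    case True
    let ?m = "ins l x"
    define R where "R = (\<Prod>j\<in>{1..l}. 1 + \<bar>coord_of E ?m j\<bar>)"
    have R: "1 \<le> R" unfolding R_def by (rule prod_ge_1) auto
    have "exp (- (real N * energy ?m)) \<le> exp (- (real N * (ln R - C)))"
      using C(2)[OF True] by (simp add: R_def mult_left_mono)
    also have "\<dots> = exp (real N * C) * inverse (R ^ N)"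
    proof -
      have "exp (real N * ln R) = R ^ N" using R by (simp add: exp_of_nat_mult)
      then show ?thesis by (simp add: algebra_simps exp_diff divide_inverse)
    qed
    finally have e: "exp (- (real N * energy ?m)) \<le> exp (real N * C) * inverse (R ^ N)" .
    have "(\<Prod>j\<in>?F. 1 + (x j)\<^sup>2) \<le> (\<Prod>j\<in>?F. 2 * (3 * R) ^ (4 * l))"
    proof (rule prod_mono, intro conjI)
      fix j assume j: "j \<in> ?F"
      have "\<bar>x j\<bar> = \<bar>?m j\<bar>" using j by (simp add: insert_constraint_def)
      also have "\<dots> \<le> (3 * R) ^ (2 * l)"
        unfolding R_def by (rule moment_le_coord_prod[OF True]) (use j in auto)
      finally have "(x j)\<^sup>2 \<le> ((3 * R) ^ (2 * l))\<^sup>2" by (rule power2_le_iff_abs_le[THEN iffD2, rotated]) (use R in simp)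
      also have "\<dots> = (3 * R) ^ (2 * l * 2)" by (rule power_mult[symmetric])
      also have "2 * l * 2 = 4 * l" by simp
      finally have "(x j)\<^sup>2 \<le> (3 * R) ^ (4 * l)" .
      moreover have "1 \<le> (3 * R) ^ (4 * l)" using R by (intro one_le_power) simp
      ultimately show "1 + (x j)\<^sup>2 \<le> 2 * (3 * R) ^ (4 * l)" by simp
    qed simp
    also have "\<dots> = (2 * (3 * R) ^ (4 * l)) ^ card ?F" by simp
    also have "\<dots> \<le> (2 * (3 * R) ^ (4 * l)) ^ l"
    proof (rule power_increasing)
      show "card ?F \<le> l" using card_mono[of "{1..l}" ?F] by simp
      have "1 \<le> (3 * R) ^ (4 * l)" using R by (intro one_le_power) simp
      then show "1 \<le> 2 * (3 * R) ^ (4 * l)" by simp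
    qed
    also have "\<dots> = 2 ^ l * 3 ^ (4 * l * l) * R ^ N"
      by (simp add: power_mult_distrib N_def flip: power_mult)
    finally have P: "(\<Prod>j\<in>?F. 1 + (x j)\<^sup>2) \<le> 2 ^ l * 3 ^ (4 * l * l) * R ^ N" .
    have P0: "0 < (\<Prod>j\<in>?F. 1 + (x j)\<^sup>2)" by (rule prod_pos) (auto simp: add_pos_nonneg)
    have RN: "0 < R ^ N" using R by simp
    have "exp (real N * C) * inverse (R ^ N) \<le> A * inverse (\<Prod>j\<in>?F. 1 + (x j)\<^sup>2)"
    proof -
      have "inverse (R ^ N) * (\<Prod>j\<in>?F. 1 + (x j)\<^sup>2) \<le> 2 ^ l * 3 ^ (4 * l * l)"
        using P RN by (simp add: field_simps)
      then have "inverse (R ^ N) \<le> 2 ^ l * 3 ^ (4 * l * l) * inverse (\<Prod>j\<in>?F. 1 + (x j)\<^sup>2)"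
        using P0 by (simp add: field_simps)
      then show ?thesis unfolding A_def
        using mult_left_mono[of _ _ "exp (real N * C)"] by (simp add: mult.assoc)
    qed
    then show ?thesis
      using e True prod_inversef[of "\<lambda>j. 1 + (x j)\<^sup>2" ?F] by (simp add: comp_def)
  qed (auto simp: A_def intro!: mult_nonneg_nonneg prod_nonneg add_nonneg_nonneg)
  have A: "0 \<le> A" by (simp add: A_def)
  have "(\<integral>\<^sup>+x. ennreal (indicator (coord_set E l) (ins l x) * exp (- (real N * energy (ins l x)))) \<partial>free_lebesgue I l)
      \<le> (\<integral>\<^sup>+x. ennreal A * (\<Prod>j\<in>?F. ennreal (inverse (1 + (x j)\<^sup>2))) \<partial>free_lebesgue I l)"
  proof (rule nn_integral_mono)
    fix x
    have "ennreal (A * (\<Prod>j\<in>?F. inverse (1 + (x j)\<^sup>2))) = ennreal A * (\<Prod>j\<in>?F. ennreal (inverse (1 + (x j)\<^sup>2)))"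
      using A by (simp add: ennreal_mult' prod_ennreal)
    then show "ennreal (indicator (coord_set E l) (ins l x) * exp (- (real N * energy (ins l x))))
        \<le> ennreal A * (\<Prod>j\<in>?F. ennreal (inverse (1 + (x j)\<^sup>2)))"
      using ennreal_leI[OF bound[of x]] by simp
  qed
  also have "\<dots> = ennreal A * (\<integral>\<^sup>+x. (\<Prod>j\<in>?F. ennreal (inverse (1 + (x j)\<^sup>2))) \<partial>free_lebesgue I l)"
    unfolding free_lebesgue_def by (rule nn_integral_cmult) measurable
  also have "(\<integral>\<^sup>+x. (\<Prod>j\<in>?F. ennreal (inverse (1 + (x j)\<^sup>2))) \<partial>free_lebesgue I l)
      = (\<Prod>j\<in>?F. \<integral>\<^sup>+t. ennreal (inverse (1 + t\<^sup>2)) \<partial>lborel)"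
    unfolding free_lebesgue_def by (rule product_nn_integral_prod) auto
  also have "ennreal A * \<dots> < \<infinity>"
    using nn_integral_inverse_1_plus_square_finite
    by (simp add: ennreal_mult_less_top power_less_top_ennreal)
  finally show ?thesis by blast
qed

text \<open>The unnormalized law of the first l moments, up to the constant that the integrated
  moments leave behind.\<close>

definition mass :: "nat \<Rightarrow> (nat \<Rightarrow> real) set \<Rightarrow> ennreal" where
  "mass n A = (\<integral>\<^sup>+x. ennreal (weight n l (n - l) (ins l x)) * indicator A (ins l x) \<partial>free_lebesgue I l)"

lemma mass_mono: "A \<inter> relint_moment_space E I c l \<subseteq> B \<Longrightarrow> mass n A \<le> mass n B"
  unfolding mass_def
proof (rule nn_integral_mono)
  fix x assume AB: "A \<inter> relint_moment_space E I c l \<subseteq> B"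
  show "ennreal (weight n l (n - l) (ins l x)) * indicator A (ins l x)
      \<le> ennreal (weight n l (n - l) (ins l x)) * indicator B (ins l x)"
  proof (cases "ins l x \<in> coord_set E l")
    case True
    then have "ins l x \<in> relint_moment_space E I c l" by (simp add: ins_relint_iff)
    then show ?thesis using AB by (auto simp: indicator_def)
  qed (simp add: weight_def)
qed

lemma continuous_on_energy: "continuous_on (coord_set E l) energy"
  unfolding energy_def
proof (rule continuous_on_sum)
  fix j assume j: "j \<in> {1..l}"
  have "continuous_on (coord_domain E j) (\<lambda>t. p j t - ln (slope E j t))"
    using j slope_pos[of _ E j]
    by (intro continuous_on_diff continuous_on_ln continuous continuous_on_slope) fastforce+
  then show "continuous_on (coord_set E l) (\<lambda>m. p j (coord_of E m j) - ln (slope E j (coord_of E m j)))"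
    by (rule continuous_on_coord_comp[OF j])
qed

lemma energy_weight_measurable:
  "(\<lambda>x. ennreal (indicator (coord_set E l) (ins l x) * exp (- (real N * energy (ins l x)))))
     \<in> borel_measurable (free_lebesgue I l)"
proof -
  have "(\<lambda>m. indicator (coord_set E l) m *\<^sub>R exp (- (real N * energy m))) \<in> borel_measurable borel"
    by (intro borel_measurable_continuous_on_indicator continuous_intros continuous_on_energy
        borel_open open_coord_set)
  then have [measurable]: "(\<lambda>m. indicator (coord_set E l) m * exp (- (real N * energy m))) \<in> borel_measurable borel"
    by simp
  show ?thesis by measurable
qed

text \<open>N copies of the energy are set aside to make the integral finite, the other n - l - N
  are estimated by a, and the term with the total potential is bounded below.\<close>

lemma mass_upper:
  assumes a: "\<And>m. m \<in> relint_moment_space E I c l \<Longrightarrow> m \<in> A \<Longrightarrow> a \<le> energy m"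
  shows "\<exists>C N. \<forall>n\<ge>N. mass n A \<le> ennreal (exp (C - real n * a))"
proof -
  obtain N where N: "(\<integral>\<^sup>+x. ennreal (indicator (coord_set E l) (ins l x) * exp (- (real N * energy (ins l x))))
      \<partial>free_lebesgue I l) < \<infinity>" (is "?T < \<infinity>")
    using nn_integral_exp_energy_finite by blast
  obtain B where B: "0 \<le> B" "\<And>m. m \<in> coord_set E l \<Longrightarrow> - B \<le> total_potential m"
    using energy_lower by blast
  obtain T where T: "1 \<le> T" "?T \<le> ennreal T"
  proof (rule that[of "max 1 (enn2real ?T)"])
    have "?T = ennreal (enn2real ?T)" using N by simp
    also have "\<dots> \<le> ennreal (max 1 (enn2real ?T))" by (intro ennreal_leI) simp
    finally show "?T \<le> ennreal (max 1 (enn2real ?T))" .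
  qed simp
  let ?C = "real (l + N) * a + real l * B + ln T"
  have "mass n A \<le> ennreal (exp (?C - real n * a))" if n: "l + N \<le> n" for n
  proof -
    let ?K = "exp (real l * B - real (n - l - N) * a)"
    have "mass n A \<le> (\<integral>\<^sup>+x. ennreal ?K *
        ennreal (indicator (coord_set E l) (ins l x) * exp (- (real N * energy (ins l x)))) \<partial>free_lebesgue I l)"
      unfolding mass_def
    proof (rule nn_integral_mono)
      fix x
      let ?m = "ins l x"
      show "ennreal (weight n l (n - l) ?m) * indicator A ?m
          \<le> ennreal ?K * ennreal (indicator (coord_set E l) ?m * exp (- (real N * energy ?m)))"
      proof (cases "?m \<in> coord_set E l \<and> ?m \<in> A")
        case True
        then have "a \<le> energy ?m" using a[of ?m] by (simp add: ins_relint_iff)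
        then have "real (n - l - N) * a \<le> real (n - l - N) * energy ?m" by (rule mult_left_mono) simp
        moreover have "- (real l * B) \<le> real l * total_potential ?m"
          using mult_left_mono[OF B(2), of ?m "real l"] True by simp
        ultimately have "real (n - l - N) * a - real l * B + real N * energy ?m
            \<le> real (n - l) * energy ?m + real l * total_potential ?m"
          using n by (simp add: of_nat_diff algebra_simps)
        then have "weight n l (n - l) ?m \<le> ?K * exp (- (real N * energy ?m))"
          using True n by (simp add: weight_eq_exp flip: exp_add)
        then show ?thesis using True
          by (simp add: ennreal_mult'[symmetric] ennreal_leI)
      qed (auto simp: weight_def)
    qed
    also have "\<dots> = ennreal ?K * ?T"
      by (rule nn_integral_cmult) (rule energy_weight_measurable)
    also have "\<dots> \<le> ennreal ?K * ennreal T" using T(2) by (rule mult_left_mono) simp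
    also have "\<dots> = ennreal (exp (?C - real n * a))"
    proof -
      have "?K * T = ?K * exp (ln T)" using T(1) by simp
      also have "\<dots> = exp (?C - real n * a)"
        using n by (simp add: of_nat_diff algebra_simps flip: exp_add)
      finally show ?thesis by (simp flip: ennreal_mult')
    qed
    finally show ?thesis .
  qed
  then show ?thesis by (intro exI[of _ ?C] exI[of _ "l + N"]) auto
qed

lemma continuous_on_total_potential: "continuous_on (coord_set E l) total_potential"
  unfolding total_potential_def
  by (intro continuous_on_sum continuous_on_coord_comp continuous) auto

text \<open>A basic neighbourhood of m meets the slice of prescribed moments in a box of free
  coordinates. If there are no free coordinates, its volume is the empty product 1.\<close>

lemma free_lebesgue_open_pos:
  assumes U: "open U" and m: "m \<in> U" "m \<in> PiE {1..l} (\<lambda>_. UNIV)" "\<And>i. i \<in> I \<Longrightarrow> m i = c i"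
  shows "\<exists>r>0. ennreal r \<le> emeasure (free_lebesgue I l) {x \<in> space (free_lebesgue I l). ins l x \<in> U}"
proof -
  interpret product_sigma_finite "\<lambda>_. lborel :: real measure" ..
  let ?F = "{1..l} - I"
  have "openin (product_topology (\<lambda>_. euclidean) UNIV) U"
    using U by (simp add: euclidean_product_topology)
  then obtain X where X: "m \<in> PiE UNIV X" "\<And>i. open (X i)" "PiE UNIV X \<subseteq> U"
    using product_topology_open_contains_basis[of "\<lambda>_. euclidean" UNIV U m] m(1)
    by (auto simp flip: open_openin)
  have "\<exists>e>0. ball (m i) e \<subseteq> X i" for i
    using X(1,2) by (meson PiE_mem UNIV_I open_contains_ball)
  then obtain e where e: "\<And>i. 0 < e i" "\<And>i. ball (m i) (e i) \<subseteq> X i" by metis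
  let ?B = "PiE ?F (\<lambda>i. ball (m i) (e i))"
  have sub: "?B \<subseteq> {x \<in> space (free_lebesgue I l). ins l x \<in> U}"
  proof
    fix x assume x: "x \<in> ?B"
    have "ins l x i \<in> X i" for i
    proof -
      have "m i \<in> X i" using X(1) by auto
      then show ?thesis
        using x m e(2)[of i] by (cases "i \<in> {1..l}"; cases "i \<in> I")
          (auto simp: insert_constraint_def PiE_def extensional_def Pi_def)
    qed
    then have "ins l x \<in> U" using X(3) by auto
    moreover have "x \<in> space (free_lebesgue I l)"
      using x by (auto simp: free_lebesgue_def space_PiM)
    ultimately show "x \<in> {x \<in> space (free_lebesgue I l). ins l x \<in> U}" by simp
  qed
  have "emeasure (free_lebesgue I l) ?B = (\<Prod>i\<in>?F. emeasure lborel (ball (m i) (e i)))"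
    unfolding free_lebesgue_def by (rule emeasure_PiM) auto
  also have "\<dots> = (\<Prod>i\<in>?F. ennreal (2 * e i))"
    using e(1) by (intro prod.cong) (auto simp: ball_eq_greaterThanLessThan less_imp_le)
  also have "\<dots> = ennreal (\<Prod>i\<in>?F. 2 * e i)"
    using e(1) by (intro prod_ennreal) (simp add: less_imp_le)
  finally have B: "emeasure (free_lebesgue I l) ?B = ennreal (\<Prod>i\<in>?F. 2 * e i)" .
  have "{x \<in> space (free_lebesgue I l). ins l x \<in> U} \<in> sets (free_lebesgue I l)"
    using measurable_sets[OF measurable_insert_constraint borel_open[OF U], of I c l]
    by (simp add: vimage_def Int_def conj_commute)
  then have "ennreal (\<Prod>i\<in>?F. 2 * e i) \<le> emeasure (free_lebesgue I l) {x \<in> space (free_lebesgue I l). ins l x \<in> U}"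
    unfolding B[symmetric] by (rule emeasure_mono[OF sub])
  moreover have "0 < (\<Prod>i\<in>?F. 2 * e i)" by (rule prod_pos) (use e(1) in auto)
  ultimately show ?thesis by blast
qed

text \<open>By continuity the energy stays below b and the total potential below its value at m plus
  1 on a neighbourhood, whose slice has positive volume.\<close>

lemma mass_lower:
  assumes m: "m \<in> relint_moment_space E I c l" "m \<in> G" and G: "open G" and b: "energy m < b"
  shows "\<exists>C. \<forall>n\<ge>l. ennreal (exp (C - real n * b)) \<le> mass n G"
proof -
  let ?v = "total_potential m + 1"
  define U where "U = (energy -` {..<b} \<inter> coord_set E l) \<inter> (total_potential -` {..<?v} \<inter> coord_set E l) \<inter> G"
  have O1: "open (energy -` {..<b} \<inter> coord_set E l)"
    using iffD1[OF continuous_on_open_vimage[OF open_coord_set] continuous_on_energy] by simp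
  have O2: "open (total_potential -` {..<?v} \<inter> coord_set E l)"
    using iffD1[OF continuous_on_open_vimage[OF open_coord_set] continuous_on_total_potential] by simp
  have "open U" unfolding U_def by (rule open_Int[OF open_Int[OF O1 O2] G])
  moreover have "m \<in> U" using m b relintD(1)[OF m(1)] by (auto simp: U_def)
  ultimately have "\<exists>r>0. ennreal r \<le> emeasure (free_lebesgue I l) {x \<in> space (free_lebesgue I l). ins l x \<in> U}"
    using relintD(2,3)[OF m(1)] by (intro free_lebesgue_open_pos)
  then obtain r where r: "0 < r"
    "ennreal r \<le> emeasure (free_lebesgue I l) {x \<in> space (free_lebesgue I l). ins l x \<in> U}" (is "_ \<le> emeasure _ ?S")
    by blast
  have S: "?S \<in> sets (free_lebesgue I l)"
    using measurable_sets[OF measurable_insert_constraint borel_open[OF \<open>open U\<close>], of I c l]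
    by (simp add: vimage_def Int_def conj_commute)
  let ?C = "real l * b - real l * ?v + ln r"
  have "ennreal (exp (?C - real n * b)) \<le> mass n G" if n: "l \<le> n" for n
  proof -
    let ?K = "exp (- (real (n - l) * b + real l * ?v))"
    have "exp (?C - real n * b) = ?K * exp (ln r)"
      using n by (simp add: of_nat_diff algebra_simps flip: exp_add)
    then have "ennreal (exp (?C - real n * b)) = ennreal ?K * ennreal r"
      using r(1) by (simp add: ennreal_mult')
    also have "\<dots> \<le> ennreal ?K * emeasure (free_lebesgue I l) ?S"
      using r(2) by (rule mult_left_mono) simp
    also have "\<dots> = (\<integral>\<^sup>+x. ennreal ?K * indicator ?S x \<partial>free_lebesgue I l)"
      using S by (simp add: nn_integral_cmult_indicator)
    also have "\<dots> \<le> mass n G"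
      unfolding mass_def
    proof (rule nn_integral_mono)
      fix x
      show "ennreal ?K * indicator ?S x \<le> ennreal (weight n l (n - l) (ins l x)) * indicator G (ins l x)"
      proof (cases "x \<in> ?S")
        case True
        then have x: "ins l x \<in> coord_set E l" "ins l x \<in> G" "energy (ins l x) < b"
          "total_potential (ins l x) < ?v" by (auto simp: U_def)
        have "real (n - l) * energy (ins l x) \<le> real (n - l) * b"
          "real l * total_potential (ins l x) \<le> real l * ?v"
          using x by (auto intro!: mult_left_mono)
        then have "?K \<le> weight n l (n - l) (ins l x)"
          using x n by (simp add: weight_eq_exp)
        then show ?thesis using x True by (simp add: ennreal_leI)
      qed simp
    qed
    finally show ?thesis .
  qed
  then show ?thesis by blast
qed

end

section \<open>The normalized marginal law and its exponential bounds\<close>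

lemma divide_left_mono_ennreal:
  fixes a b c :: ennreal
  assumes "b \<le> c" "0 < b" "b < \<infinity>"
  shows "a / c \<le> a / b"
proof (rule divide_le_posI_ennreal)
  show "0 < c" using assms(2,1) by (rule less_le_trans)
  have "a = (a / b) * b"
    using assms mult_divide_eq_ennreal[of b a] by (simp add: ennreal_divide_times ennreal_times_divide)
  also have "\<dots> \<le> c * (a / b)" using assms by (simp add: mult.commute mult_right_mono)
  finally show "a \<le> c * (a / b)" .
qed

context constrained_potentials
begin

lemma moment_weight_eq:
  assumes "p = potential (last_index I) V" "l \<le> n"
  shows "moment_weight E I c V n (ins n x) = ennreal (weight n n 0 (ins n x))"
proof (cases "ins n x \<in> coord_set E n")
  case True
  have "(\<Sum>j=1..n. potential (last_index I) V j (canonical_coord E n (ins n x) j))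
      = (\<Sum>j=1..n. p j (coord_of E (ins n x) j))"
    by (rule sum.cong) (use canonical_coord_coord_of[OF True] assms in auto)
  then show ?thesis
    using True assms(2) by (simp add: moment_weight_def ins_relint_iff weight_def exp_sum sum_distrib_left
        flip: sum_negf)
next
  case False
  then show ?thesis using assms(2) by (simp add: moment_weight_def ins_relint_iff weight_def)
qed

text \<open>The partition function and the numerator reduce to masses with the same factor K, which
  is positive and finite and cancels.\<close>

lemma emeasure_marginal_law:
  assumes p: "p = potential (last_index I) V" and n: "l \<le> n" "2 \<le> n"
    and A: "A \<in> sets (borel_of (Rtop l))"
  shows "emeasure (marginal_law E I c V l n) A = mass n A / mass n UNIV"
proof -
  have A': "{m. restrict m {1..l} \<in> A} \<in> sets borel"
    using measurable_sets[OF measurable_restrict_borel_of A] by (simp add: vimage_def)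
  obtain K where K: "0 < K" "K < \<infinity>" and marg: "\<And>f. f \<in> borel_measurable borel \<Longrightarrow>
      (\<forall>m m'. (\<forall>i\<in>{1..l}. m i = m' i) \<longrightarrow> f m = f m') \<Longrightarrow>
      (\<integral>\<^sup>+x. ennreal (weight n n 0 (ins n x)) * f (ins n x) \<partial>free_lebesgue I n)
      = K * (\<integral>\<^sup>+x. ennreal (weight n l (n - l) (ins l x)) * f (ins l x) \<partial>free_lebesgue I l)"
    using nn_integral_weight_marginal[of n 0 "n - l"] n by auto
  have Z: "partition_function E I c V n = K * mass n UNIV"
    using marg[of "\<lambda>_. 1"] by (simp add: partition_function_def moment_weight_eq[OF p n(1)] mass_def)
  let ?f = "indicator {m. restrict m {1..l} \<in> A} :: (nat \<Rightarrow> real) \<Rightarrow> ennreal"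
  have f_dep: "?f m = ?f m'" if "\<forall>i\<in>{1..l}. m i = m' i" for m m'
  proof -
    have "restrict m {1..l} = restrict m' {1..l}" using that by (auto simp: restrict_def)
    then show ?thesis by (simp add: indicator_def)
  qed
  have f_ins: "?f (ins l x) = indicator A (ins l x)" for x
    by (simp only: indicator_def mem_Collect_eq restrict_insert_constraint)
  have num: "(\<integral>\<^sup>+x. ennreal (weight n n 0 (ins n x)) * ?f (ins n x) \<partial>free_lebesgue I n) = K * mass n A"
    using marg[of ?f] A' f_dep by (simp add: mass_def f_ins del: One_nat_def)
  let ?d = "\<lambda>x. moment_weight E I c V n (ins n x) / partition_function E I c V n"
  have d: "?d \<in> borel_measurable (free_lebesgue I n)"
    unfolding moment_weight_eq[OF p n(1)] by measurable
  have "marginal_law E I c V l n = distr (density (free_lebesgue I n) ?d) (borel_of (Rtop l))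
      ((\<lambda>m. restrict m {1..l}) \<circ> ins n)"
    unfolding marginal_law_def moment_distribution_def
    using distr_distr[OF measurable_restrict_borel_of_le[OF n(1)], of "ins n" "density (free_lebesgue I n) ?d"]
      measurable_insert_constraint_borel_of[of I c n] by simp
  then have "emeasure (marginal_law E I c V l n) A
      = emeasure (density (free_lebesgue I n) ?d)
          (((\<lambda>m. restrict m {1..l}) \<circ> ins n) -` A \<inter> space (free_lebesgue I n))"
    using emeasure_distr[OF _ A, of "(\<lambda>m. restrict m {1..l}) \<circ> ins n" "density (free_lebesgue I n) ?d"]
      measurable_comp[OF measurable_insert_constraint_borel_of measurable_restrict_borel_of_le[OF n(1)]]
    by simp
  also have "\<dots> = (\<integral>\<^sup>+x. ?d x * indicator (((\<lambda>m. restrict m {1..l}) \<circ> ins n) -` A \<inter> space (free_lebesgue I n)) x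
      \<partial>free_lebesgue I n)"
  proof (rule emeasure_density[OF d])
    show "((\<lambda>m. restrict m {1..l}) \<circ> ins n) -` A \<inter> space (free_lebesgue I n) \<in> sets (free_lebesgue I n)"
      by (rule measurable_sets[OF measurable_comp[OF measurable_insert_constraint_borel_of
              measurable_restrict_borel_of_le[OF n(1)]] A])
  qed
  also have "\<dots> = (\<integral>\<^sup>+x. (ennreal (weight n n 0 (ins n x)) * ?f (ins n x)) / (K * mass n UNIV) \<partial>free_lebesgue I n)"
    by (rule nn_integral_cong)
      (auto simp: moment_weight_eq[OF p n(1)] Z indicator_def)
  also have "\<dots> = (\<integral>\<^sup>+x. ennreal (weight n n 0 (ins n x)) * ?f (ins n x) \<partial>free_lebesgue I n) / (K * mass n UNIV)"
  proof (rule nn_integral_divide)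
    have [measurable]: "{m. restrict m {1..l} \<in> A} \<in> sets borel" by (rule A')
    show "(\<lambda>x. ennreal (weight n n 0 (ins n x)) * ?f (ins n x)) \<in> borel_measurable (free_lebesgue I n)"
      by measurable
  qed
  also have "\<dots> = (mass n A * K) / (mass n UNIV * K)"
    by (simp only: num mult.commute)
  also have "\<dots> = mass n A / mass n UNIV"
    using K by (intro divide_mult_eq) auto
  finally show ?thesis .
qed

definition min_energy :: real where
  "min_energy = Inf (energy ` relint_moment_space E I c l)"

lemma min_energy_le: "m \<in> relint_moment_space E I c l \<Longrightarrow> min_energy \<le> energy m"
proof -
  obtain C where "\<And>m. m \<in> coord_set E l \<Longrightarrow> - C \<le> energy m"
    using energy_lower by blast
  then have "bdd_below (energy ` relint_moment_space E I c l)"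
    by (intro bdd_belowI[of _ "- C"]) (auto dest: relintD(1))
  then show "m \<in> relint_moment_space E I c l \<Longrightarrow> min_energy \<le> energy m"
    unfolding min_energy_def by (intro cInf_lower) auto
qed

lemma min_energy_approx:
  assumes "0 < \<delta>"
  obtains m where "m \<in> relint_moment_space E I c l" "energy m < min_energy + \<delta>"
proof -
  have "Inf (energy ` relint_moment_space E I c l) < min_energy + \<delta>"
    using assms by (simp add: min_energy_def)
  then obtain x where "x \<in> energy ` relint_moment_space E I c l" "x < min_energy + \<delta>"
    using cInf_lessD nonempty by (metis image_is_empty)
  then show thesis using that by blast
qed

lemma rate_eq:
  assumes "p = potential (last_index I) V"
  shows "rate E I c V l m = (if m \<in> relint_moment_space E I c l then ereal (energy m) else \<infinity>)"
proof (cases "m \<in> relint_moment_space E I c l")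
  case True
  have "(\<Sum>j=1..l. W_fun E (potential (last_index I) V) j (canonical_coord E l m j)) = energy m"
    unfolding energy_def
    by (rule sum.cong) (use canonical_coord_coord_of[OF relintD(1)[OF True]] assms in \<open>auto simp: W_fun_eq\<close>)
  then show ?thesis using True by (simp add: rate_def)
qed (simp add: rate_def)

text \<open>Outside the relative interior the rate is infinite, so the infimum over the whole
  constrained moment space is the infimum of the energy.\<close>

lemma normalized_rate_eq:
  assumes "p = potential (last_index I) V"
  shows "normalized_rate E I c V l m
    = (if m \<in> relint_moment_space E I c l then ereal (energy m - min_energy) else \<infinity>)"
proof -
  have "(INF m'\<in>constrained_moment_space E I c l. rate E I c V l m') = ereal min_energy"
  proof (rule antisym)
    show "(INF m'\<in>constrained_moment_space E I c l. rate E I c V l m') \<le> ereal min_energy"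
    proof (rule ereal_le_epsilon2)
      fix \<delta> :: real assume "0 < \<delta>"
      then obtain m where m: "m \<in> relint_moment_space E I c l" "energy m < min_energy + \<delta>"
        by (rule min_energy_approx)
      then have "m \<in> constrained_moment_space E I c l" by (simp add: relint_moment_space_def)
      then have "(INF m'\<in>constrained_moment_space E I c l. rate E I c V l m') \<le> rate E I c V l m"
        by (rule INF_lower)
      also have "\<dots> \<le> ereal min_energy + ereal \<delta>"
        using m by (simp add: rate_eq[OF assms])
      finally show "(INF m'\<in>constrained_moment_space E I c l. rate E I c V l m') \<le> ereal min_energy + ereal \<delta>" .
    qed
    show "ereal min_energy \<le> (INF m'\<in>constrained_moment_space E I c l. rate E I c V l m')"
      by (rule INF_greatest) (simp add: rate_eq[OF assms] min_energy_le)
  qed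
  then show ?thesis by (simp add: normalized_rate_def rate_eq[OF assms])
qed

text \<open>The loss \<delta> on the lower side stems from approximating the infimum of the energy
  by the energy at a point of the relative interior.\<close>

lemma mass_UNIV_bounds:
  assumes "0 < \<delta>"
  shows "\<exists>C N. \<forall>n\<ge>N. mass n UNIV \<le> ennreal (exp (C - real n * min_energy)) \<and>
     ennreal (exp (- C - real n * (min_energy + \<delta>))) \<le> mass n UNIV"
proof -
  obtain C N where C: "\<forall>n\<ge>N. mass n UNIV \<le> ennreal (exp (C - real n * min_energy))"
    using mass_upper[of UNIV min_energy] min_energy_le by blast
  obtain m where "m \<in> relint_moment_space E I c l" "energy m < min_energy + \<delta>"
    using assms by (rule min_energy_approx)
  then obtain D where D: "\<forall>n\<ge>l. ennreal (exp (D - real n * (min_energy + \<delta>))) \<le> mass n UNIV"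
    using mass_lower[of m UNIV "min_energy + \<delta>"] by auto
  have "mass n UNIV \<le> ennreal (exp (max C (- D) - real n * min_energy)) \<and>
     ennreal (exp (- max C (- D) - real n * (min_energy + \<delta>))) \<le> mass n UNIV" if "max N l \<le> n" for n
  proof
    have "mass n UNIV \<le> ennreal (exp (C - real n * min_energy))" using C that by simp
    also have "\<dots> \<le> ennreal (exp (max C (- D) - real n * min_energy))" by (intro ennreal_leI) simp
    finally show "mass n UNIV \<le> ennreal (exp (max C (- D) - real n * min_energy))" .
    have "ennreal (exp (- max C (- D) - real n * (min_energy + \<delta>))) \<le> ennreal (exp (D - real n * (min_energy + \<delta>)))"
      by (intro ennreal_leI) simp
    also have "\<dots> \<le> mass n UNIV" using D that by simp
    finally show "ennreal (exp (- max C (- D) - real n * (min_energy + \<delta>))) \<le> mass n UNIV" .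
  qed
  then show ?thesis by blast
qed

lemma mass_UNIV_pos_finite: "\<exists>N. \<forall>n\<ge>N. 0 < mass n UNIV \<and> mass n UNIV < \<infinity>"
proof -
  obtain C N where C: "\<forall>n\<ge>N. mass n UNIV \<le> ennreal (exp (C - real n * min_energy)) \<and>
     ennreal (exp (- C - real n * (min_energy + 1))) \<le> mass n UNIV"
    using mass_UNIV_bounds[of 1] by auto
  have "0 < mass n UNIV \<and> mass n UNIV < \<infinity>" if "N \<le> n" for n
  proof
    have "0 < ennreal (exp (- C - real n * (min_energy + 1)))" by simp
    also have "\<dots> \<le> mass n UNIV" using C that by simp
    finally show "0 < mass n UNIV" .
    have "mass n UNIV \<le> ennreal (exp (C - real n * min_energy))" using C that by simp
    also have "\<dots> < \<infinity>" by simp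
    finally show "mass n UNIV < \<infinity>" .
  qed
  then show ?thesis by blast
qed

text \<open>The estimate uses the energy on A itself, not on its closure; \<delta> enters through
  the lower bound for the total mass.\<close>

lemma measure_marginal_upper:
  assumes p: "p = potential (last_index I) V" and A: "A \<in> sets (borel_of (Rtop l))" and \<delta>: "0 < \<delta>"
    and a: "\<And>m. m \<in> relint_moment_space E I c l \<Longrightarrow> m \<in> A \<Longrightarrow> a \<le> energy m - min_energy"
  shows "\<exists>C N. \<forall>n\<ge>N. measure (marginal_law E I c V l n) A \<le> exp (C - real n * (a - \<delta>))"
proof -
  obtain C N where C: "\<And>n. N \<le> n \<Longrightarrow> mass n A \<le> ennreal (exp (C - real n * (a + min_energy)))"
    using mass_upper[of A "a + min_energy"] a by (force simp: algebra_simps)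
  obtain D M where D: "\<And>n. M \<le> n \<Longrightarrow> ennreal (exp (- D - real n * (min_energy + \<delta>))) \<le> mass n UNIV"
    using mass_UNIV_bounds[OF \<delta>] by blast
  have "measure (marginal_law E I c V l n) A \<le> exp (C + D - real n * (a - \<delta>))" if "N + M + l + 2 \<le> n" for n
  proof -
    have "emeasure (marginal_law E I c V l n) A = mass n A / mass n UNIV"
      by (rule emeasure_marginal_law[OF p _ _ A]) (use that in auto)
    also have "\<dots> \<le> ennreal (exp (C - real n * (a + min_energy))) / ennreal (exp (- D - real n * (min_energy + \<delta>)))"
      by (rule order_trans[OF divide_right_mono_ennreal[OF C] divide_left_mono_ennreal[OF D]]) (use that in auto)
    also have "\<dots> = ennreal (exp (C - real n * (a + min_energy)) / exp (- D - real n * (min_energy + \<delta>)))"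
      by (rule divide_ennreal) auto
    also have "exp (C - real n * (a + min_energy)) / exp (- D - real n * (min_energy + \<delta>))
        = exp (C + D - real n * (a - \<delta>))"
      by (simp add: algebra_simps flip: exp_diff)
    finally show ?thesis
      unfolding measure_def by (metis enn2real_leI exp_ge_zero)
  qed
  then show ?thesis by blast
qed

text \<open>The open set G of R^l is replaced by its preimage under restriction, an open cylinder in
  the sequence space with the same trace on the relative interior.\<close>

lemma measure_marginal_lower:
  assumes p: "p = potential (last_index I) V" and A: "A \<in> sets (borel_of (Rtop l))"
    and G: "openin (Rtop l) G" "G \<subseteq> A" and m: "m \<in> G" "m \<in> relint_moment_space E I c l" and \<delta>: "0 < \<delta>"
  shows "\<exists>C N. \<forall>n\<ge>N. exp (C - real n * (energy m - min_energy + \<delta>)) \<le> measure (marginal_law E I c V l n) A"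
proof -
  let ?G = "{m. restrict m {1..l} \<in> G}"
  have "m \<in> ?G" using m relintD(2)[OF m(2)] by (simp add: PiE_restrict)
  moreover have "open ?G" by (rule open_restrict_vimage[OF G(1)])
  ultimately obtain C where C: "\<And>n. l \<le> n \<Longrightarrow> ennreal (exp (C - real n * (energy m + \<delta>))) \<le> mass n ?G"
    using mass_lower[of m ?G "energy m + \<delta>"] m \<delta> by auto
  have GA: "mass n ?G \<le> mass n A" for n
  proof (rule mass_mono)
    show "?G \<inter> relint_moment_space E I c l \<subseteq> A"
    proof
      fix m' assume m': "m' \<in> ?G \<inter> relint_moment_space E I c l"
      then have "restrict m' {1..l} = m'" using relintD(2) by (intro PiE_restrict) auto
      then show "m' \<in> A" using m' G(2) by auto
    qed
  qed
  obtain D M where D: "\<And>n. M \<le> n \<Longrightarrow> mass n UNIV \<le> ennreal (exp (D - real n * min_energy))"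
    using mass_UNIV_bounds[OF \<delta>] by blast
  obtain M' where M': "\<And>n. M' \<le> n \<Longrightarrow> 0 < mass n UNIV \<and> mass n UNIV < \<infinity>"
    using mass_UNIV_pos_finite by blast
  have "exp (C - D - real n * (energy m - min_energy + \<delta>)) \<le> measure (marginal_law E I c V l n) A"
    if n: "M + M' + l + 2 \<le> n" for n
  proof -
    have "ennreal (exp (C - real n * (energy m + \<delta>)) / exp (D - real n * min_energy))
        = ennreal (exp (C - real n * (energy m + \<delta>))) / ennreal (exp (D - real n * min_energy))"
      by (rule divide_ennreal[symmetric]) auto
    also have "\<dots> \<le> mass n A / mass n UNIV"
      by (rule order_trans[OF divide_right_mono_ennreal[OF order_trans[OF C GA]] divide_left_mono_ennreal[OF D]])
        (use n M'[of n] in auto)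
    also have "\<dots> = emeasure (marginal_law E I c V l n) A"
      by (rule emeasure_marginal_law[OF p _ _ A, symmetric]) (use n in auto)
    finally have le: "ennreal (exp (C - real n * (energy m + \<delta>)) / exp (D - real n * min_energy))
        \<le> emeasure (marginal_law E I c V l n) A" .
    have "emeasure (marginal_law E I c V l n) A = mass n A / mass n UNIV"
      by (rule emeasure_marginal_law[OF p _ _ A]) (use n in auto)
    also have "\<dots> \<le> mass n UNIV / mass n UNIV"
      by (intro divide_right_mono_ennreal mass_mono) simp
    also have "\<dots> = 1" using M'[of n] n by (intro ennreal_divide_self) auto
    finally have fin: "emeasure (marginal_law E I c V l n) A < \<infinity>"
      by (rule le_less_trans) simp
    have "exp (C - real n * (energy m + \<delta>)) / exp (D - real n * min_energy)
        \<le> measure (marginal_law E I c V l n) A"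
      unfolding measure_def using enn2real_mono[OF le] fin by simp
    moreover have "exp (C - real n * (energy m + \<delta>)) / exp (D - real n * min_energy)
        = exp (C - D - real n * (energy m - min_energy + \<delta>))"
      by (simp add: algebra_simps flip: exp_diff)
    ultimately show ?thesis by simp
  qed
  then show ?thesis by blast
qed

lemma sets_marginal_law: "sets (marginal_law E I c V l n) = sets (borel_of (Rtop l))"
  by (simp add: marginal_law_def)

lemma prob_space_marginal_law:
  assumes p: "p = potential (last_index I) V"
  shows "\<forall>\<^sub>F n in sequentially. prob_space (marginal_law E I c V l n)"
proof -
  obtain N where N: "\<And>n. N \<le> n \<Longrightarrow> 0 < mass n UNIV \<and> mass n UNIV < \<infinity>"
    using mass_UNIV_pos_finite by blast
  have "prob_space (marginal_law E I c V l n)" if n: "N + l + 2 \<le> n" for n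
  proof (rule prob_spaceI)
    have sp: "space (marginal_law E I c V l n) = PiE {1..l} (\<lambda>_. UNIV)"
      by (simp add: marginal_law_def)
    have top: "PiE {1..l} (\<lambda>_. UNIV) \<in> sets (borel_of (Rtop l))"
      using sets.top[of "borel_of (Rtop l)"] by simp
    have "mass n UNIV / mass n UNIV = 1"
      using N[of n] n by (intro ennreal_divide_self) auto
    moreover have "mass n (PiE {1..l} (\<lambda>_. UNIV)) = mass n UNIV"
      by (rule antisym; rule mass_mono) (use relintD(2) in auto)
    ultimately show "emeasure (marginal_law E I c V l n) (space (marginal_law E I c V l n)) = 1"
      using emeasure_marginal_law[OF p _ _ top, of n] n by (simp add: sp)
  qed
  then show ?thesis unfolding eventually_sequentially by blast
qed

end

section \<open>Large deviations\<close>

lemma limsup_log_prob_le: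
  assumes "\<And>n. N \<le> n \<Longrightarrow> q n \<le> exp (C - real n * a)"
  shows "limsup (\<lambda>n. ereal (1 / real n) * log_prob (q n)) \<le> ereal (- a)"
proof -
  have "(\<lambda>n. C / real n - a) \<longlonglongrightarrow> 0 - a"
    by (intro tendsto_diff tendsto_const lim_const_over_n)
  then have "(\<lambda>n. ereal (C / real n - a)) \<longlonglongrightarrow> ereal (- a)" by simp
  then have "limsup (\<lambda>n. ereal (C / real n - a)) = ereal (- a)"
    by (intro lim_imp_Limsup) auto
  moreover have "limsup (\<lambda>n. ereal (1 / real n) * log_prob (q n)) \<le> limsup (\<lambda>n. ereal (C / real n - a))"
  proof (rule Limsup_mono, rule eventually_sequentiallyI)
    fix n assume n: "N + 1 \<le> n"
    show "ereal (1 / real n) * log_prob (q n) \<le> ereal (C / real n - a)"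
    proof (cases "q n \<le> 0")
      case False
      have "ln (q n) \<le> ln (exp (C - real n * a))"
        using False assms[of n] n by (intro ln_mono) auto
      then have "ln (q n) / real n \<le> (C - real n * a) / real n" by (intro divide_right_mono) auto
      then show ?thesis using False n by (simp add: log_prob_def field_simps)
    qed (use n in \<open>simp add: log_prob_def\<close>)
  qed
  ultimately show ?thesis by simp
qed

lemma liminf_log_prob_ge:
  assumes "\<And>n. N \<le> n \<Longrightarrow> exp (C - real n * a) \<le> q n"
  shows "ereal (- a) \<le> liminf (\<lambda>n. ereal (1 / real n) * log_prob (q n))"
proof -
  have "(\<lambda>n. C / real n - a) \<longlonglongrightarrow> 0 - a"
    by (intro tendsto_diff tendsto_const lim_const_over_n)
  then have "(\<lambda>n. ereal (C / real n - a)) \<longlonglongrightarrow> ereal (- a)" by simp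
  then have "liminf (\<lambda>n. ereal (C / real n - a)) = ereal (- a)"
    by (intro lim_imp_Liminf) auto
  moreover have "liminf (\<lambda>n. ereal (C / real n - a)) \<le> liminf (\<lambda>n. ereal (1 / real n) * log_prob (q n))"
  proof (rule Liminf_mono, rule eventually_sequentiallyI)
    fix n assume n: "N + 1 \<le> n"
    have e: "exp (C - real n * a) \<le> q n" using assms n by simp
    then have q: "0 < q n" using exp_gt_zero less_le_trans by blast
    have "C - real n * a \<le> ln (q n)" using e q by (simp add: ln_ge_iff)
    then have "(C - real n * a) / real n \<le> ln (q n) / real n" by (intro divide_right_mono) auto
    then show "ereal (C / real n - a) \<le> ereal (1 / real n) * log_prob (q n)"
      using q n by (simp add: log_prob_def field_simps)
  qed
  ultimately show ?thesis by simp
qed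

text \<open>The slope vanishes at every boundary point of the domain.\<close>

lemma coord_domain_if_slope_pos: "t \<in> closure (coord_domain E j) \<Longrightarrow> 0 < slope E j t \<Longrightarrow> t \<in> coord_domain E j"
  unfolding closure_coord_domain
  by (cases E) (auto simp: zero_less_mult_iff split: if_splits)

lemma continuous_map_coord_moment:
  "continuous_map euclidean (Rtop n) (\<lambda>y. restrict (coord_moment E y) {1..n})"
  unfolding Rtop_def continuous_map_componentwise
  by (auto intro: continuous_on_coord_moment continuous_on_coord_apply)

section \<open>Compact sublevel sets and the large deviations bounds\<close>

context constrained_potentials
begin

text \<open>In coordinates the sublevel set is compact: growth bounds each coordinate, and since p
  is bounded below, a bound on p - ln slope also bounds the slope away from 0. The box thus lies
  inside the open domains, where the energy is continuous. The constraints are closed conditions,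
  and the moments are continuous images.\<close>

lemma compactin_energy_sublevel:
  "compactin (Rtop l) {m \<in> relint_moment_space E I c l. energy m \<le> b}"
proof -
  obtain C where C: "0 \<le> C"
    "\<And>j t. j \<in> {1..l} \<Longrightarrow> t \<in> coord_domain E j \<Longrightarrow> ln (1 + \<bar>t\<bar>) - C \<le> p j t"
    "\<And>j t. j \<in> {1..l} \<Longrightarrow> t \<in> coord_domain E j \<Longrightarrow> ln (1 + \<bar>t\<bar>) - C \<le> p j t - ln (slope E j t)"
    by (rule coercive_const) blast
  \<comment> \<open>A bound for each single summand of the energy, because every other summand is at
    least -C.\<close>
  define b' where "b' = b + real l * C"
  \<comment> \<open>The value {0} at the remaining indices makes the box compact in the space of all
    sequences.\<close>
  define K where "K j = (if j \<in> {1..l}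
    then closure (coord_domain E j) \<inter> {- exp (b' + C)..exp (b' + C)} \<inter> slope E j -` {exp (- b' - C)..}
    else {0})" for j
  have KD: "t \<in> coord_domain E j" if "t \<in> K j" "j \<in> {1..l}" for t j
    using that less_le_trans[OF exp_gt_zero] by (auto simp: K_def intro!: coord_domain_if_slope_pos)
  have "compact (K j)" for j
  proof (cases "j \<in> {1..l}")
    case True
    have "closed (slope E j -` {exp (- b' - C)..})"
      using continuous_on_closed_vimage[of UNIV "slope E j"] continuous_on_slope[of UNIV E j] by auto
    then have "compact (slope E j -` {exp (- b' - C)..} \<inter> (closure (coord_domain E j) \<inter> {- exp (b' + C)..exp (b' + C)}))"
      by (intro closed_Int_compact) (auto intro: closed_Int_compact)
    then show ?thesis using True by (simp add: K_def Int_commute Int_left_commute)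
  next
    case False
    then have "K j = {0}" unfolding K_def by (rule if_not_P)
    then show ?thesis by simp
  qed
  then have "compactin (product_topology (\<lambda>_. euclidean) UNIV) (PiE UNIV K)"
    by (simp add: compactin_PiE)
  then have cK: "compact (PiE UNIV K)"
    by (simp add: euclidean_product_topology)
  let ?e = "\<lambda>y. \<Sum>j=1..l. p j (y j) - ln (slope E j (y j))"
  define Y where "Y = {y \<in> PiE UNIV K. ?e y \<le> b \<and> (\<forall>i\<in>I. coord_moment E y i = c i)}"
  have "continuous_on (PiE UNIV K) ?e"
  proof (rule continuous_on_sum)
    fix j assume j: "j \<in> {1..l}"
    have "continuous_on (coord_domain E j) (\<lambda>t. p j t - ln (slope E j t))"
      using j slope_pos[of _ E j]
      by (intro continuous_on_diff continuous_on_ln continuous continuous_on_slope) fastforce+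
    then show "continuous_on (PiE UNIV K) (\<lambda>y. p j (y j) - ln (slope E j (y j)))"
      by (rule continuous_on_compose2[OF _ continuous_on_coord_apply]) (use KD j in auto)
  qed
  then have "closed {y \<in> PiE UNIV K. ?e y \<le> b}"
    by (intro continuous_on_closed_Collect_le continuous_on_const compact_imp_closed[OF cK])
  moreover have "closed (\<Inter>i\<in>I. {y. coord_moment E y i = c i})"
    by (intro closed_INT ballI closed_Collect_eq continuous_on_coord_moment continuous_on_coord_apply
        continuous_on_const)
  moreover have "Y = PiE UNIV K \<inter> ({y \<in> PiE UNIV K. ?e y \<le> b} \<inter> (\<Inter>i\<in>I. {y. coord_moment E y i = c i}))"
    by (auto simp: Y_def)
  ultimately have cY: "compact Y"
    using cK by (auto intro: compact_Int_closed closed_Int)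
  have "{m \<in> relint_moment_space E I c l. energy m \<le> b} = (\<lambda>y. restrict (coord_moment E y) {1..l}) ` Y"
  proof (intro set_eqI iffI)
    fix m assume m: "m \<in> {m \<in> relint_moment_space E I c l. energy m \<le> b}"
    then have rel: "m \<in> relint_moment_space E I c l" and e: "energy m \<le> b" by auto
    have dom: "coord_of E m j \<in> coord_domain E j" if "j \<in> {1..l}" for j
      using relintD(1)[OF rel] that by (auto simp: coord_set_def)
    define y where "y = (\<lambda>j. if j \<in> {1..l} then coord_of E m j else 0)"
    have yK: "y j \<in> K j" for j
    proof (cases "j \<in> {1..l}")
      case True
      let ?w = "\<lambda>i. p i (coord_of E m i) - ln (slope E i (coord_of E m i))"
      have w: "- C \<le> ?w i" if "i \<in> {1..l}" for i
        using C(3)[OF that dom[OF that]] by (smt (verit) ln_ge_zero abs_ge_zero)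
      have "energy m = ?w j + (\<Sum>i\<in>{1..l} - {j}. ?w i)"
        unfolding energy_def by (rule sum.remove) (use True in auto)
      moreover have "- (real (card ({1..l} - {j})) * C) \<le> (\<Sum>i\<in>{1..l} - {j}. ?w i)"
        using sum_bounded_below[of "{1..l} - {j}" "- C" ?w] w by simp
      moreover have "real (card ({1..l} - {j})) * C \<le> real l * C"
        using C(1) True by (intro mult_right_mono) auto
      ultimately have wj: "?w j \<le> b'" using e by (simp add: b'_def)
      have "ln (1 + \<bar>coord_of E m j\<bar>) \<le> b' + C"
        using C(3)[OF True dom[OF True]] wj by simp
      then have "1 + \<bar>coord_of E m j\<bar> \<le> exp (b' + C)"
        using exp_ln[of "1 + \<bar>coord_of E m j\<bar>"] by (smt (verit) exp_le_cancel_iff)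
      moreover have "- C \<le> p j (coord_of E m j)"
        using C(2)[OF True dom[OF True]] by (smt (verit) ln_ge_zero abs_ge_zero)
      then have "- b' - C \<le> ln (slope E j (coord_of E m j))" using wj by simp
      then have "exp (- b' - C) \<le> slope E j (coord_of E m j)"
        using slope_pos[OF dom[OF True]] by (simp add: ln_ge_iff)
      moreover have "coord_of E m j \<in> closure (coord_domain E j)"
        using dom[OF True] closure_subset by blast
      ultimately show ?thesis using True by (auto simp: K_def y_def)
    next
      case False
      then have "K j = {0}" "y j = 0" unfolding K_def y_def by (rule if_not_P)+
      then show ?thesis by simp
    qed
    have mom: "coord_moment E y j = m j" if "j \<in> {1..l}" for j
    proof -
      have "coord_moment E y j = coord_moment E (coord_of E m) j"
        by (rule coord_moment_cong) (use that in \<open>auto simp: y_def\<close>)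
      also have "\<dots> = m j" by (rule coord_moment_coord_of) (use that dom in auto)
      finally show ?thesis .
    qed
    have "?e y = energy m" unfolding energy_def by (rule sum.cong) (auto simp: y_def)
    moreover have "coord_moment E y i = c i" if "i \<in> I" for i
    proof -
      have "i \<in> {1..l}" using that index by blast
      then show ?thesis using mom relintD(3)[OF rel that] by simp
    qed
    ultimately have "y \<in> Y" using yK e by (auto simp: Y_def)
    moreover have "m = restrict (coord_moment E y) {1..l}"
      by (rule extensionalityI[of _ "{1..l}"]) (use relintD(2)[OF rel] mom in \<open>auto simp: PiE_def\<close>)
    ultimately show "m \<in> (\<lambda>y. restrict (coord_moment E y) {1..l}) ` Y" by blast
  next
    fix m assume "m \<in> (\<lambda>y. restrict (coord_moment E y) {1..l}) ` Y"
    then obtain y where y: "y \<in> Y" and m: "m = restrict (coord_moment E y) {1..l}" by blast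
    have dom: "y j \<in> coord_domain E j" if "j \<in> {1..l}" for j
      using KD[of "y j" j] y that by (auto simp: Y_def)
    have co: "coord_of E m j = y j" if "j \<in> {1..l}" for j
      by (rule coord_of_eqI) (use that dom m in auto)
    then have "m \<in> coord_set E l" using dom by (auto simp: coord_set_def)
    moreover have "m i = c i" if "i \<in> I" for i
    proof -
      have "i \<in> {1..l}" using that index by blast
      then show ?thesis using y that m by (simp add: Y_def)
    qed
    moreover have "energy m = ?e y" unfolding energy_def by (rule sum.cong) (use co in auto)
    ultimately show "m \<in> {m \<in> relint_moment_space E I c l. energy m \<le> b}"
      using y m by (auto simp: relint_eq Y_def)
  qed
  moreover have "compactin (Rtop l) ((\<lambda>y. restrict (coord_moment E y) {1..l}) ` Y)"
    using image_compactin[OF _ continuous_map_coord_moment] cY by simp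
  ultimately show ?thesis by simp
qed

lemma compactin_normalized_rate_sublevel:
  assumes "p = potential (last_index I) V"
  shows "compactin (Rtop l) {m \<in> topspace (Rtop l). normalized_rate E I c V l m \<le> ereal a}"
proof -
  have "{m \<in> topspace (Rtop l). normalized_rate E I c V l m \<le> ereal a}
      = {m \<in> relint_moment_space E I c l. energy m \<le> a + min_energy}"
    using relintD(2) by (auto simp: normalized_rate_eq[OF assms] split: if_splits)
  then show ?thesis using compactin_energy_sublevel by simp
qed

lemma LDP_marginal_law:
  assumes p: "p = potential (last_index I) V"
  shows "LDP (Rtop l) (\<lambda>n. marginal_law E I c V l n) (\<lambda>n. real n) (normalized_rate E I c V l)"
  unfolding LDP_def
proof (intro conjI allI ballI)
  let ?J = "normalized_rate E I c V l" and ?P = "marginal_law E I c V l"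
  let ?R = "\<lambda>\<Gamma> n. ereal (1 / real n) * log_prob (measure (?P n) \<Gamma>)"
  show "\<forall>\<^sub>F n in sequentially. prob_space (?P n) \<and> sets (?P n) = sets (borel_of (Rtop l))"
    using prob_space_marginal_law[OF p] by (simp add: sets_marginal_law)
  show "filterlim real at_top sequentially" by (rule filterlim_real_sequentially)
  show "0 \<le> ?J m" for m
    using min_energy_le by (simp add: normalized_rate_eq[OF p])
  show "closedin (Rtop l) {m \<in> topspace (Rtop l). ?J m \<le> ereal a}" for a
    by (rule compactin_imp_closedin[OF _ compactin_normalized_rate_sublevel[OF p]])
      (simp add: Rtop_def Hausdorff_space_product_topology)
  fix \<Gamma> assume \<Gamma>: "\<Gamma> \<in> sets (borel_of (Rtop l))"
  have sub: "\<Gamma> \<subseteq> topspace (Rtop l)" using sets.sets_into_space[OF \<Gamma>] by simp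
  show "- (INF m\<in>Rtop l interior_of \<Gamma>. ?J m) \<le> liminf (?R \<Gamma>)"
  proof (subst ereal_uminus_le_reorder, rule INF_greatest)
    fix m assume m: "m \<in> Rtop l interior_of \<Gamma>"
    show "- liminf (?R \<Gamma>) \<le> ?J m"
    proof (cases "m \<in> relint_moment_space E I c l")
      case True
      \<comment> \<open>Each point of finite rate in the interior gives a lower bound up to
        \<delta>; points of infinite rate ask for nothing.\<close>
      have "- liminf (?R \<Gamma>) \<le> ereal (energy m - min_energy)"
      proof (rule ereal_le_epsilon2)
        fix \<delta> :: real assume "0 < \<delta>"
        then obtain C N where
          "\<forall>n\<ge>N. exp (C - real n * (energy m - min_energy + \<delta>)) \<le> measure (?P n) \<Gamma>"
          using measure_marginal_lower[OF p \<Gamma> openin_interior_of interior_of_subset m True] by blast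
        then have "ereal (- (energy m - min_energy + \<delta>)) \<le> liminf (?R \<Gamma>)"
          by (intro liminf_log_prob_ge) auto
        then show "- liminf (?R \<Gamma>) \<le> ereal (energy m - min_energy) + ereal \<delta>"
          by (subst ereal_uminus_le_reorder) simp
      qed
      then show ?thesis using True by (simp add: normalized_rate_eq[OF p])
    qed (simp add: normalized_rate_eq[OF p])
  qed
  show "limsup (?R \<Gamma>) \<le> - (INF m\<in>Rtop l closure_of \<Gamma>. ?J m)"
  proof (rule ccontr)
    assume "\<not> limsup (?R \<Gamma>) \<le> - (INF m\<in>Rtop l closure_of \<Gamma>. ?J m)"
    then have "- (INF m\<in>Rtop l closure_of \<Gamma>. ?J m) < limsup (?R \<Gamma>)" by simp
    \<comment> \<open>Separation by a real s also covers the case of an infinite infimum over the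
      closure.\<close>
    then obtain s where s: "- (INF m\<in>Rtop l closure_of \<Gamma>. ?J m) < ereal s" "ereal s < limsup (?R \<Gamma>)"
      using ereal_dense2 by blast
    then have s': "ereal (- s) < (INF m\<in>Rtop l closure_of \<Gamma>. ?J m)"
      by (metis ereal_minus_less_minus ereal_uminus_uminus uminus_ereal.simps(1))
    \<comment> \<open>\<Gamma> is contained in its closure, so the bound passes to \<Gamma>, where
      the mass estimate applies directly.\<close>
    have "- s \<le> energy m - min_energy" if "m \<in> relint_moment_space E I c l" "m \<in> \<Gamma>" for m
    proof -
      have "m \<in> Rtop l closure_of \<Gamma>" using closure_of_subset[OF sub] that by blast
      then have "ereal (- s) < ?J m" using s' by (meson INF_lower less_le_trans)
      then show ?thesis using that by (simp add: normalized_rate_eq[OF p])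
    qed
    note low = this
    have "limsup (?R \<Gamma>) \<le> ereal s + ereal \<delta>" if \<delta>: "0 < \<delta>" for \<delta>
    proof -
      obtain C N where "\<forall>n\<ge>N. measure (?P n) \<Gamma> \<le> exp (C - real n * (- s - \<delta>))"
        using measure_marginal_upper[OF p \<Gamma> \<delta>, of "- s"] low by blast
      then have "limsup (?R \<Gamma>) \<le> ereal (- (- s - \<delta>))"
        by (intro limsup_log_prob_le) auto
      then show ?thesis by (simp add: add.commute)
    qed
    then have "limsup (?R \<Gamma>) \<le> ereal s" by (rule ereal_le_epsilon2)
    then show False using s(2) by simp
  qed
qed

end

section \<open>Verification of the hypotheses\<close>

lemma coord_domain_mod_2: "odd j = odd k \<Longrightarrow> coord_domain E j = coord_domain E k"
  and slope_mod_2: "odd j = odd k \<Longrightarrow> slope E j = slope E k"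
  by (cases E; auto)+

text \<open>The continuation with period two preserves the parity of the index, on which domain,
  slope and growth condition depend for the real line.\<close>

lemma potential_cases:
  assumes "1 \<le> j"
  obtains k where "k \<in> {1..s + 2}" "potential s V j = V k" "odd j = odd k"
proof (cases "j \<le> s + 2")
  case True
  then show thesis using assms by (intro that[of j]) (auto simp: potential_def)
next
  case False
  show thesis
  proof (cases "odd (j - s)")
    case True
    then show thesis using False by (intro that[of "s + 1"]) (auto simp: potential_def)
  next
    case F: False
    then show thesis using False by (intro that[of "s + 2"]) (auto simp: potential_def)
  qed
qed

lemma integrability_conditionsD:
  assumes "integrability_conditions E N V" "k \<in> {1..N}"
  shows "\<exists>\<epsilon>>0. \<exists>R. \<forall>y\<in>closure (coord_domain E k). \<bar>y\<bar> \<ge> R \<longrightarrow>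
      E = UnitInterval \<or> V k y \<ge> ((if E = RealLine \<and> odd k then 1 else 2) + \<epsilon>) * ln \<bar>y\<bar>"
proof (cases E)
  case UnitInterval
  then show ?thesis by (intro exI[of _ 1]) simp
next
  case HalfLine
  then obtain \<epsilon> R where "\<epsilon> > 0" "\<forall>j\<in>{1..N}. \<forall>y\<in>closure (coord_domain HalfLine j). \<bar>y\<bar> \<ge> R \<longrightarrow>
        V j y \<ge> (2 + \<epsilon>) * ln \<bar>y\<bar>"
    using assms(1) by auto
  then show ?thesis using HalfLine assms(2) by (intro exI[of _ \<epsilon>] conjI exI[of _ R]) auto
next
  case RealLine
  then obtain \<epsilon> R where "\<epsilon> > 0" "\<forall>j\<in>{1..N}. \<forall>y\<in>closure (coord_domain RealLine j). \<bar>y\<bar> \<ge> R \<longrightarrow>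
        V j y \<ge> ((if odd j then 1 else 2) + \<epsilon>) * ln \<bar>y\<bar>"
    using assms(1) unfolding RealLine integrability_conditions.simps by blast
  then show ?thesis using RealLine assms(2)
    by (intro exI[of _ \<epsilon>] conjI exI[of _ R]) (auto simp del: coord_domain.simps)
qed

lemma potentials_potential:
  assumes cont: "\<And>j. j \<in> {1..s + 2} \<Longrightarrow> continuous_on (closure (coord_domain E j)) (V j)"
    and int: "integrability_conditions E (s + 2) V"
  shows "potentials E (potential s V)"
proof
  fix j :: nat assume j: "1 \<le> j"
  obtain k where k: "k \<in> {1..s + 2}" "potential s V j = V k" "odd j = odd k"
    using potential_cases[OF j] by blast
  show "continuous_on (coord_domain E j) (potential s V j)"
    unfolding k(2) coord_domain_mod_2[OF k(3)]
    using cont[OF k(1)] closure_subset by (rule continuous_on_subset)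
  show "\<exists>C. \<forall>t\<in>coord_domain E j. ln (1 + \<bar>t\<bar>) - C \<le> potential s V j t
      \<and> ln (1 + \<bar>t\<bar>) - C \<le> potential s V j t - ln (slope E j t)"
    unfolding k(2) coord_domain_mod_2[OF k(3)] slope_mod_2[OF k(3)]
    using cont[OF k(1)] integrability_conditionsD[OF int k(1)] by (rule potentials_coercive)
qed

text \<open>Admissibility concerns dimension i_k only. An interior point there is prolonged by
  coordinates 1 / 2, which leave the constrained moments unchanged and lie in all domains.\<close>

lemma relint_nonempty:
  assumes I: "constraint_indices I" and adm: "admissible E I c" and l: "last_index I \<le> l"
  shows "relint_moment_space E I c l \<noteq> {}"
proof -
  let ?s = "last_index I"
  have Is: "I \<subseteq> {1..?s}"
    using I unfolding constraint_indices_def last_index_def by (auto intro: Max_ge)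
  obtain m where m: "m \<in> relint_moment_space E I c ?s"
    using adm by (auto simp: admissible_def relint_moment_space_def)
  then have m': "m \<in> coord_set E ?s" "\<And>i. i \<in> I \<Longrightarrow> m i = c i"
    using relint_moment_space_coord_set[OF Is] by auto
  define y where "y = (\<lambda>j. if j \<le> ?s then coord_of E m j else 1 / 2)"
  have dom: "y j \<in> coord_domain E j" if "1 \<le> j" for j
  proof (cases "j \<le> ?s")
    case True
    then show ?thesis using m'(1) that by (simp add: y_def coord_set_def)
  next
    case False
    then show ?thesis by (cases E) (auto simp: y_def)
  qed
  define m2 where "m2 = restrict (coord_moment E y) {1..l}"
  have "coord_of E m2 j = y j" if "j \<in> {1..l}" for j
    by (rule coord_of_eqI) (use dom that in \<open>auto simp: m2_def\<close>)
  then have "m2 \<in> coord_set E l" using dom by (auto simp: coord_set_def)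
  moreover have "m2 i = c i" if i: "i \<in> I" for i
  proof -
    have i': "1 \<le> i" "i \<le> ?s" using Is i by auto
    then have "m2 i = coord_moment E y i" using l by (simp add: m2_def)
    also have "\<dots> = coord_moment E (coord_of E m) i"
      by (rule coord_moment_cong) (use i' in \<open>auto simp: y_def\<close>)
    also have "\<dots> = m i"
      by (rule coord_moment_coord_of) (use m'(1) i' in \<open>auto simp: coord_set_def\<close>)
    finally show ?thesis using m'(2)[OF i] by simp
  qed
  moreover have "m2 \<in> PiE {1..l} (\<lambda>_. UNIV)" by (simp add: m2_def)
  moreover have "I \<subseteq> {1..l}" using Is l by auto
  ultimately show ?thesis by (auto simp: relint_moment_space_coord_set)
qed

theorem theorem3p2:
  fixes E :: support and I :: "nat set" and c :: "nat \<Rightarrow> real"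
    and V :: "nat \<Rightarrow> real \<Rightarrow> real" and l :: nat
  assumes "constraint_indices I"
    and "admissible E I c"
    and "\<And>j. j \<in> {1..last_index I + 2} \<Longrightarrow> continuous_on (closure (coord_domain E j)) (V j)"
    and "integrability_conditions E (last_index I + 2) V"
    and "last_index I \<le> l" and "1 \<le> l"
  shows "LDP (Rtop l) (\<lambda>n. marginal_law E I c V l n) (\<lambda>n. real n) (normalized_rate E I c V l)
       \<and> good_rate (Rtop l) (normalized_rate E I c V l)"
proof -
  have "I \<subseteq> {1..last_index I}"
    using assms(1) unfolding constraint_indices_def last_index_def by (auto intro: Max_ge)
  then have "I \<subseteq> {1..l}" using assms(5) by auto
  then interpret constrained_potentials E "potential (last_index I) V" I c l
    using potentials_potential[OF assms(3,4)] relint_nonempty[OF assms(1,2,5)]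
    by (auto simp: constrained_potentials_def constrained_potentials_axioms_def)
  show ?thesis
    using LDP_marginal_law[OF refl] compactin_normalized_rate_sublevel[OF refl]
    by (simp add: good_rate_def)
qed

end
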